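(* Let $X$ and $Y$ be finite sets and $\Gamma:M_{XY}\to M_{XY}$ be a linear map. The following are equivalent: (i) $\Gamma\in\mathcal{Q}_{\rm qa}^{\rm bi}$; (ii) there exists a state $s:\mathcal{T}_X\otimes_{\min}\mathcal{T}_Y\to\mathbb{C}$ such that $\Gamma=\Gamma_s$; (iii) there exists a state $s:\mathcal{C}_X\otimes_{\min}\mathcal{C}_Y\to\mathbb{C}$ such that $\Gamma=\Gamma_s$.
   Context: $M_X$ is the algebra of complex $X\times X$ matrices with matrix units $\epsilon_{x,x'}$; $M_{XY}=M_X\otimes M_Y$. Put $A=X$, $B=Y$. QNS correlations: a quantum channel (completely positive trace preserving map) $\Gamma:M_{XY}\to M_{AB}$ is a quantum no-signalling (QNS) correlation if $\mathrm{Tr}_A\Gamma(\rho_X\otimes\rho_Y)=0$ whenever $\mathrm{Tr}(\rho_X)=0$, and $\mathrm{Tr}_B\Gamma(\rho_X\otimes\rho_Y)=0$ whenever $\mathrm{Tr}(\rho_Y)=0$. With $\langle\omega,\rho\rangle=\mathrm{Tr}(\omega\rho^{\rm t})$ and $\Gamma^*$ defined by $\langle\Gamma^*(\omega),\rho\rangle=\langle\omega,\Gamma(\rho)\rangle$, a QNS correlation $\Gamma:M_{XY}\to M_{XY}$ is a QNS bicorrelation if $\Gamma(I_{XY})=I_{XY}$ and $\Gamma^*$ is a QNS correlation. A bistochastic operator matrix over $X$ on $H$ is a positive block operator matrix $E=(E_{x,x',a,a'})_{x,x',a,a'\in X}\in M_X\otimes M_X\otimes\mathcal{B}(H)$ (i.e.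 $E=\sum\epsilon_{x,x'}\otimes\epsilon_{a,a'}\otimes E_{x,x',a,a'}$) with $\sum_a E_{x,x',a,a}=\delta_{x,x'}I$ and $\sum_x E_{x,x,a,a'}=\delta_{a,a'}I$. A QNS bicorrelation $\Gamma$ is quantum if there exist finite dimensional Hilbert spaces $H_A,H_B$, a unit vector $\xi\in H_A\otimes H_B$ and bistochastic operator matrices $(E_{x,x',a,a'})$ over $X$ on $H_A$ and $(F_{y,y',b,b'})$ over $Y$ on $H_B$ such that $\Gamma(\epsilon_{x,x'}\otimes\epsilon_{y,y'})=\sum_{a,a',b,b'}\langle (E_{x,x',a,a'}\otimes F_{y,y',b,b'})\xi,\xi\rangle\,\epsilon_{a,a'}\otimes\epsilon_{b,b'}$. $\mathcal{Q}_{\rm qa}^{\rm bi}$ is the set of approximately quantum QNS bicorrelations, i.e. limits of quantum QNS bicorrelations. Definition of $\mathcal{C}_X,\mathcal{T}_X$: a bi-isometry is a block operator matrix $V=(V_{a,x})_{a,x\in X}$, $V_{a,x}\in\mathcal{B}(H,K)$, with $\sum_a V_{a,x}^*V_{a,x'}=\delta_{x,x'}I$ and $\sum_x V_{a,x}^*V_{a',x}=\delta_{a,a'}I$. Let $(v_{a,x})$ be the universal bi-isometry (direct sum of representatives of all unitary equivalence classes of bi-isometries on Hilbert spaces of dimension bounded by a fixed sufficiently large infinite cardinal), let $\mathcal{C}_X$ be the unital C*-algebra generated by $e_{x,x',a,a'}:=v_{a,x}^*v_{a',x'}$, and $\mathcal{T}_X=\mathrm{span}\{e_{x,x',a,a'}\}\subseteq\mathcal{C}_X$.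 The corresponding generators for $Y$ are denoted $f_{y,y',b,b'}$. $\otimes_{\min}$ is the minimal (spatial) tensor product of operator systems, resp. C*-algebras: $w\in M_n(\mathcal{S}\otimes\mathcal{T})$ is positive iff $(\phi\otimes\psi)^{(n)}(w)\ge0$ for all unital completely positive $\phi:\mathcal{S}\to M_k$, $\psi:\mathcal{T}\to M_m$, $k,m\in\mathbb{N}$. For a linear functional $s$ on $\mathcal{T}_X\otimes\mathcal{T}_Y$ or $\mathcal{C}_X\otimes\mathcal{C}_Y$, $\Gamma_s(\epsilon_{x,x'}\otimes\epsilon_{y,y'})=\sum_{a,a'\in X}\sum_{b,b'\in Y}s(e_{x,x',a,a'}\otimes f_{y,y',b,b'})\,\epsilon_{a,a'}\otimes\epsilon_{b,b'}$. *)

theory Defs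
  imports "HOL-Analysis.Analysis" "HOL-Library.Function_Algebras"
begin

type_synonym 'n cmat = "complex^'n^'n"

definition mscale :: "complex \<Rightarrow> 'n::finite cmat \<Rightarrow> 'n cmat" where
  "mscale c M = (\<chi> i j. c * M $ i $ j)"

definition mat_linear :: "('n::finite cmat \<Rightarrow> 'm::finite cmat) \<Rightarrow> bool" where
  "mat_linear \<Gamma> \<longleftrightarrow> (\<forall>M N. \<Gamma> (M + N) = \<Gamma> M + \<Gamma> N) \<and> (\<forall>c M. \<Gamma> (mscale c M) = mscale c (\<Gamma> M))"

definition matrix_unit :: "'n::finite \<Rightarrow> 'n \<Rightarrow> 'n cmat" where
  "matrix_unit x x' = (\<chi> i j. if i = x \<and> j = x' then 1 else 0)"

definition kron :: "'n::finite cmat \<Rightarrow> 'm::finite cmat \<Rightarrow> ('n \<times> 'm) cmat" where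
  "kron M N = (\<chi> p q. M $ fst p $ fst q * N $ snd p $ snd q)"

definition ptrace_fst :: "('n::finite \<times> 'm::finite) cmat \<Rightarrow> 'm cmat" where
  "ptrace_fst M = (\<chi> b b'. \<Sum>a\<in>UNIV. M $ (a, b) $ (a, b'))"

definition ptrace_snd :: "('n::finite \<times> 'm::finite) cmat \<Rightarrow> 'n cmat" where
  "ptrace_snd M = (\<chi> a a'. \<Sum>b\<in>UNIV. M $ (a, b) $ (a', b))"

definition psd_on :: "'i set \<Rightarrow> ('i \<Rightarrow> 'i \<Rightarrow> complex) \<Rightarrow> bool" where
  "psd_on P M \<longleftrightarrow> (\<forall>c. (\<Sum>p\<in>P. \<Sum>q\<in>P. cnj (c p) * M p q * c q) \<in> \<real>\<^sub>\<ge>\<^sub>0)"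

definition completely_positive :: "('n::finite cmat \<Rightarrow> 'm::finite cmat) \<Rightarrow> bool" where
  "completely_positive \<Gamma> \<longleftrightarrow> (\<forall>(n::nat) R.
     psd_on ({..<n} \<times> UNIV) (\<lambda>(i, p) (j, q). R i j $ p $ q) \<longrightarrow>
     psd_on ({..<n} \<times> UNIV) (\<lambda>(i, p) (j, q). \<Gamma> (R i j) $ p $ q))"

definition quantum_channel :: "('n::finite cmat \<Rightarrow> 'm::finite cmat) \<Rightarrow> bool" where
  "quantum_channel \<Gamma> \<longleftrightarrow>
     mat_linear \<Gamma> \<and> completely_positive \<Gamma> \<and> (\<forall>M. trace (\<Gamma> M) = trace M)"

definition QNS_correlation ::
  "(('x::finite \<times> 'y::finite) cmat \<Rightarrow> ('a::finite \<times> 'b::finite) cmat) \<Rightarrow> bool" where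
  "QNS_correlation \<Gamma> \<longleftrightarrow> quantum_channel \<Gamma> \<and>
     (\<forall>M N. trace M = 0 \<longrightarrow> ptrace_fst (\<Gamma> (kron M N)) = 0) \<and>
     (\<forall>M N. trace N = 0 \<longrightarrow> ptrace_snd (\<Gamma> (kron M N)) = 0)"

definition pairing :: "'n::finite cmat \<Rightarrow> 'n cmat \<Rightarrow> complex" where
  "pairing \<omega> \<rho> = trace (\<omega> ** transpose \<rho>)"

definition dual_map :: "('n::finite cmat \<Rightarrow> 'm::finite cmat) \<Rightarrow> 'm cmat \<Rightarrow> 'n cmat" where
  "dual_map \<Gamma> \<omega> = (THE \<sigma>. \<forall>\<rho>. pairing \<sigma> \<rho> = pairing \<omega> (\<Gamma> \<rho>))"

definition QNS_bicorrelation ::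
  "(('x::finite \<times> 'y::finite) cmat \<Rightarrow> ('x \<times> 'y) cmat) \<Rightarrow> bool" where
  "QNS_bicorrelation \<Gamma> \<longleftrightarrow>
     QNS_correlation \<Gamma> \<and> \<Gamma> (mat 1) = mat 1 \<and> QNS_correlation (dual_map \<Gamma>)"

text \<open>Hilbert spaces are taken in the form \<open>\<ell>\<^sup>2(I)\<close>, where \<open>I\<close> is a subset of a type; up to unitary
  equivalence these are all the Hilbert spaces of dimension at most the cardinality of that type.
  The inner product is linear in its first argument.\<close>

definition ell2 :: "'i set \<Rightarrow> ('i \<Rightarrow> complex) set" where
  "ell2 I = {f. (\<forall>i. i \<notin> I \<longrightarrow> f i = 0) \<and> (\<lambda>i. (cmod (f i))\<^sup>2) summable_on UNIV}"

definition inner2 :: "('i \<Rightarrow> complex) \<Rightarrow> ('i \<Rightarrow> complex) \<Rightarrow> complex" where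
  "inner2 f g = (\<Sum>\<^sub>\<infinity>i. f i * cnj (g i))"

definition norm2 :: "('i \<Rightarrow> complex) \<Rightarrow> real" where
  "norm2 f = sqrt (\<Sum>\<^sub>\<infinity>i. (cmod (f i))\<^sup>2)"

type_synonym ('i, 'j) op = "('i \<Rightarrow> complex) \<Rightarrow> ('j \<Rightarrow> complex)"

text \<open>Complex scalar multiplication, used both for operators and for scalar matrices written as
  functions of two indices.\<close>

definition cscale :: "complex \<Rightarrow> ('a \<Rightarrow> 'b \<Rightarrow> complex) \<Rightarrow> ('a \<Rightarrow> 'b \<Rightarrow> complex)" where
  "cscale c S = (\<lambda>f i. c * S f i)"

lemma vector_space_cscale: "vector_space cscale"
  by unfold_locales (auto simp: cscale_def fun_eq_iff algebra_simps)

text \<open>Operators are \<open>0\<close> off their domain, so that equality of operators is equality of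
  functions.\<close>

definition Bop :: "'i set \<Rightarrow> 'j set \<Rightarrow> ('i, 'j) op set" where
  "Bop I J = {T.
     (\<forall>f\<in>ell2 I. T f \<in> ell2 J) \<and>
     (\<forall>f\<in>ell2 I. \<forall>g\<in>ell2 I. T (f + g) = T f + T g) \<and>
     (\<forall>c. \<forall>f\<in>ell2 I. T (\<lambda>i. c * f i) = (\<lambda>j. c * T f j)) \<and>
     (\<exists>C. \<forall>f\<in>ell2 I. norm2 (T f) \<le> C * norm2 f) \<and>
     (\<forall>f. f \<notin> ell2 I \<longrightarrow> T f = 0)}"

definition id_op :: "'i set \<Rightarrow> ('i, 'i) op" where
  "id_op I = (\<lambda>f. if f \<in> ell2 I then f else 0)"

definition op_norm :: "'i set \<Rightarrow> ('i, 'j) op \<Rightarrow> real" where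
  "op_norm I T = Sup {norm2 (T f) | f. f \<in> ell2 I \<and> norm2 f \<le> 1}"

definition adj :: "'i set \<Rightarrow> 'j set \<Rightarrow> ('i, 'j) op \<Rightarrow> ('j, 'i) op" where
  "adj I J T = (THE S. S \<in> Bop J I \<and>
     (\<forall>f\<in>ell2 I. \<forall>g\<in>ell2 J. inner2 (T f) g = inner2 f (S g)))"

definition unitary_op :: "'i set \<Rightarrow> 'j set \<Rightarrow> ('i, 'j) op \<Rightarrow> bool" where
  "unitary_op I J U \<longleftrightarrow> U \<in> Bop I J \<and> adj I J U \<circ> U = id_op I \<and> U \<circ> adj I J U = id_op J"

text \<open>The Hilbert space tensor product of \<open>\<ell>\<^sup>2(I)\<close> and \<open>\<ell>\<^sup>2(J)\<close> is \<open>\<ell>\<^sup>2(I \<times> J)\<close>.\<close>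

definition vec_tensor :: "('i \<Rightarrow> complex) \<Rightarrow> ('j \<Rightarrow> complex) \<Rightarrow> ('i \<times> 'j \<Rightarrow> complex)" where
  "vec_tensor f g = (\<lambda>(i, j). f i * g j)"

definition op_tensor ::
  "'i set \<Rightarrow> 'j set \<Rightarrow> ('i, 'i) op \<Rightarrow> ('j, 'j) op \<Rightarrow> ('i \<times> 'j, 'i \<times> 'j) op" where
  "op_tensor I J S T = (THE R. R \<in> Bop (I \<times> J) (I \<times> J) \<and>
     (\<forall>f\<in>ell2 I. \<forall>g\<in>ell2 J. R (vec_tensor f g) = vec_tensor (S f) (T g)))"

definition op_block_pos :: "'i set \<Rightarrow> 'p set \<Rightarrow> ('p \<Rightarrow> 'p \<Rightarrow> ('i, 'i) op) \<Rightarrow> bool" where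
  "op_block_pos I P E \<longleftrightarrow> (\<forall>\<eta>. (\<forall>p\<in>P. \<eta> p \<in> ell2 I) \<longrightarrow>
     (\<Sum>p\<in>P. \<Sum>q\<in>P. inner2 (E p q (\<eta> q)) (\<eta> p)) \<in> \<real>\<^sub>\<ge>\<^sub>0)"

definition op_closure :: "'i set \<Rightarrow> ('i, 'i) op set \<Rightarrow> ('i, 'i) op set" where
  "op_closure I A = {T \<in> Bop I I. \<forall>\<epsilon>>0. \<exists>S\<in>A. op_norm I (T - S) < \<epsilon>}"

definition unital_cstar_subalgebra :: "'i set \<Rightarrow> ('i, 'i) op set \<Rightarrow> bool" where
  "unital_cstar_subalgebra I A \<longleftrightarrow> A \<subseteq> Bop I I \<and> id_op I \<in> A \<and>
     (\<forall>S\<in>A. \<forall>T\<in>A. S + T \<in> A \<and> S \<circ> T \<in> A) \<and>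
     (\<forall>c. \<forall>S\<in>A. cscale c S \<in> A) \<and> (\<forall>S\<in>A. adj I I S \<in> A) \<and> op_closure I A \<subseteq> A"

definition cstar_generated :: "'i set \<Rightarrow> ('i, 'i) op set \<Rightarrow> ('i, 'i) op set" where
  "cstar_generated I G = \<Inter>{A. unital_cstar_subalgebra I A \<and> G \<subseteq> A}"

text \<open>In \<open>M\<^sub>X \<otimes> M\<^sub>X \<otimes> \<B>(H)\<close> the entry \<open>E x x' a a'\<close> sits in row \<open>(x, a)\<close> and column \<open>(x', a')\<close>.\<close>

definition bistochastic_op_matrix ::
  "'i set \<Rightarrow> ('x::finite \<Rightarrow> 'x \<Rightarrow> 'x \<Rightarrow> 'x \<Rightarrow> ('i, 'i) op) \<Rightarrow> bool" where
  "bistochastic_op_matrix I E \<longleftrightarrow>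
     (\<forall>x x' a a'. E x x' a a' \<in> Bop I I) \<and>
     op_block_pos I UNIV (\<lambda>(x, a) (x', a'). E x x' a a') \<and>
     (\<forall>x x'. (\<Sum>a\<in>UNIV. E x x' a a) = (if x = x' then id_op I else 0)) \<and>
     (\<forall>a a'. (\<Sum>x\<in>UNIV. E x x a a') = (if a = a' then id_op I else 0))"

definition quantum_bicorrelation ::
  "(('x::finite \<times> 'y::finite) cmat \<Rightarrow> ('x \<times> 'y) cmat) \<Rightarrow> bool" where
  "quantum_bicorrelation \<Gamma> \<longleftrightarrow> QNS_bicorrelation \<Gamma> \<and>
     (\<exists>(I::nat set) (J::nat set) \<xi> E F.
        finite I \<and> finite J \<and> \<xi> \<in> ell2 (I \<times> J) \<and> norm2 \<xi> = 1 \<and>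
        bistochastic_op_matrix I E \<and> bistochastic_op_matrix J F \<and>
        (\<forall>x x' y y'. \<Gamma> (kron (matrix_unit x x') (matrix_unit y y')) =
           (\<Sum>a\<in>UNIV. \<Sum>a'\<in>UNIV. \<Sum>b\<in>UNIV. \<Sum>b'\<in>UNIV.
              mscale (inner2 (op_tensor I J (E x x' a a') (F y y' b b') \<xi>) \<xi>)
                (kron (matrix_unit a a') (matrix_unit b b')))))"

text \<open>Limits are pointwise, which on maps between matrix algebras is the same as in norm.\<close>

definition Q_qa_bi :: "(('x::finite \<times> 'y::finite) cmat \<Rightarrow> ('x \<times> 'y) cmat) set" where
  "Q_qa_bi = {\<Gamma>. \<exists>G. (\<forall>n::nat. quantum_bicorrelation (G n)) \<and>
                     (\<forall>M. (\<lambda>n. G n M) \<longlonglongrightarrow> \<Gamma> M)}"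

text \<open>A triple \<open>(I, J, V)\<close> stands for a block operator matrix with entries
  \<open>V a x \<in> \<B>(\<ell>\<^sup>2(I), \<ell>\<^sup>2(J))\<close>. The cardinality of the type \<open>'k\<close> is the cardinal bounding the
  dimensions of the Hilbert spaces.\<close>

type_synonym ('x, 'k) block = "'k set \<times> 'k set \<times> ('x \<Rightarrow> 'x \<Rightarrow> ('k, 'k) op)"

definition bi_isometries :: "('x::finite, 'k) block set" where
  "bi_isometries = {(I, J, V).
     (\<forall>a x. V a x \<in> Bop I J) \<and>
     (\<forall>x x'. (\<Sum>a\<in>UNIV. adj I J (V a x) \<circ> V a x') = (if x = x' then id_op I else 0)) \<and>
     (\<forall>a a'. (\<Sum>x\<in>UNIV. adj I J (V a x) \<circ> V a' x) = (if a = a' then id_op I else 0))}"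

definition unitarily_equivalent :: "('x::finite, 'k) block rel" where
  "unitarily_equivalent = {((I, J, V), (I', J', W)).
     (I, J, V) \<in> bi_isometries \<and> (I', J', W) \<in> bi_isometries \<and>
     (\<exists>U U'. unitary_op I I' U \<and> unitary_op J J' U' \<and> (\<forall>a x. U' \<circ> V a x = W a x \<circ> U))}"

definition bi_isometry_reps :: "('x::finite, 'k) block set" where
  "bi_isometry_reps = (\<lambda>C. SOME v. v \<in> C) ` (bi_isometries // unitarily_equivalent)"

text \<open>The direct sum of the spaces \<open>\<ell>\<^sup>2(I\<^sub>v)\<close> over the representatives \<open>v\<close> is \<open>\<ell>\<^sup>2\<close> of the
  disjoint union of the sets \<open>I\<^sub>v\<close>.\<close>

type_synonym ('x, 'k) univ_index = "('x, 'k) block \<times> 'k"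

definition univ_dom :: "('x::finite, 'k) univ_index set" where
  "univ_dom = (SIGMA v:bi_isometry_reps. fst v)"

definition univ_cod :: "('x::finite, 'k) univ_index set" where
  "univ_cod = (SIGMA v:bi_isometry_reps. fst (snd v))"

definition univ_bi_isometry ::
  "'x::finite \<Rightarrow> 'x \<Rightarrow> (('x, 'k) univ_index, ('x, 'k) univ_index) op" where
  "univ_bi_isometry a x = (\<lambda>f. if f \<in> ell2 univ_dom
     then (\<lambda>(v, j). if (v, j) \<in> univ_cod then snd (snd v) a x (\<lambda>i. f (v, i)) j else 0)
     else 0)"

definition univ_e ::
  "'x::finite \<Rightarrow> 'x \<Rightarrow> 'x \<Rightarrow> 'x \<Rightarrow> (('x, 'k) univ_index, ('x, 'k) univ_index) op" where
  "univ_e x x' a a' =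
     adj univ_dom univ_cod (univ_bi_isometry a x) \<circ> univ_bi_isometry a' x'"

definition e_gens :: "(('x::finite, 'k) univ_index, ('x, 'k) univ_index) op set" where
  "e_gens = {univ_e x x' a a' | x x' a a'. True}"

definition C_alg :: "(('x::finite, 'k) univ_index, ('x, 'k) univ_index) op set" where
  "C_alg = cstar_generated univ_dom e_gens"

definition T_sys :: "(('x::finite, 'k) univ_index, ('x, 'k) univ_index) op set" where
  "T_sys = module.span cscale e_gens"

definition clinear_on ::
  "('a \<Rightarrow> 'b \<Rightarrow> complex) set \<Rightarrow> (('a \<Rightarrow> 'b \<Rightarrow> complex) \<Rightarrow> ('c \<Rightarrow> 'd \<Rightarrow> complex)) \<Rightarrow> bool" where
  "clinear_on A \<phi> \<longleftrightarrow> (\<forall>S\<in>A. \<forall>T\<in>A. \<phi> (S + T) = \<phi> S + \<phi> T) \<and>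
     (\<forall>c. \<forall>S\<in>A. \<phi> (cscale c S) = cscale c (\<phi> S))"

text \<open>\<open>M\<^sub>k\<close> is represented by the functions of two natural numbers that vanish unless both are
  less than \<open>k\<close>; its unit is the Kronecker delta restricted to indices below \<open>k\<close>.\<close>

definition ucp :: "'i set \<Rightarrow> ('i, 'i) op set \<Rightarrow> nat \<Rightarrow>
    (('i, 'i) op \<Rightarrow> nat \<Rightarrow> nat \<Rightarrow> complex) \<Rightarrow> bool" where
  "ucp I A k \<phi> \<longleftrightarrow> clinear_on A \<phi> \<and>
     (\<forall>T\<in>A. \<forall>i j. \<not> (i < k \<and> j < k) \<longrightarrow> \<phi> T i j = 0) \<and>
     \<phi> (id_op I) = (\<lambda>i j. if i = j \<and> i < k then 1 else 0) \<and>
     (\<forall>(n::nat) R. (\<forall>i<n. \<forall>j<n. R i j \<in> A) \<and> op_block_pos I {..<n} R \<longrightarrow>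
        psd_on ({..<n} \<times> {..<k}) (\<lambda>(i, p) (j, q). \<phi> (R i j) p q))"

text \<open>The algebraic tensor product of operator systems \<open>A \<subseteq> \<B>(\<ell>\<^sup>2(I))\<close> and \<open>B \<subseteq> \<B>(\<ell>\<^sup>2(J))\<close>,
  realised (faithfully) in \<open>\<B>(\<ell>\<^sup>2(I \<times> J))\<close>.\<close>

definition alg_tensor :: "'i set \<Rightarrow> 'j set \<Rightarrow> ('i, 'i) op set \<Rightarrow> ('j, 'j) op set \<Rightarrow>
    ('i \<times> 'j, 'i \<times> 'j) op set" where
  "alg_tensor I J A B = module.span cscale {op_tensor I J S T | S T. S \<in> A \<and> T \<in> B}"

text \<open>\<open>\<phi> \<otimes> \<psi>\<close>: the linear map, unique on \<open>alg_tensor I J A B\<close>, that sends \<open>S \<otimes> T\<close> to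
  \<open>\<phi>(S) \<otimes> \<psi>(T)\<close>.\<close>

definition map_tensor :: "'i set \<Rightarrow> 'j set \<Rightarrow> ('i, 'i) op set \<Rightarrow> ('j, 'j) op set \<Rightarrow>
    (('i, 'i) op \<Rightarrow> nat \<Rightarrow> nat \<Rightarrow> complex) \<Rightarrow> (('j, 'j) op \<Rightarrow> nat \<Rightarrow> nat \<Rightarrow> complex) \<Rightarrow>
    ('i \<times> 'j, 'i \<times> 'j) op \<Rightarrow> nat \<times> nat \<Rightarrow> nat \<times> nat \<Rightarrow> complex" where
  "map_tensor I J A B \<phi> \<psi> = (SOME \<Phi>. clinear_on (alg_tensor I J A B) \<Phi> \<and>
     (\<forall>S\<in>A. \<forall>T\<in>B. \<Phi> (op_tensor I J S T) = (\<lambda>(p, q) (p', q'). \<phi> S p p' * \<psi> T q q')))"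

definition min_pos :: "'i set \<Rightarrow> 'j set \<Rightarrow> ('i, 'i) op set \<Rightarrow> ('j, 'j) op set \<Rightarrow> nat \<Rightarrow>
    (nat \<Rightarrow> nat \<Rightarrow> ('i \<times> 'j, 'i \<times> 'j) op) \<Rightarrow> bool" where
  "min_pos I J A B n w \<longleftrightarrow> (\<forall>i<n. \<forall>j<n. w i j \<in> alg_tensor I J A B) \<and>
     (\<forall>k m \<phi> \<psi>. ucp I A k \<phi> \<and> ucp J B m \<psi> \<longrightarrow>
        psd_on ({..<n} \<times> {..<k} \<times> {..<m})
          (\<lambda>(i, p) (j, q). map_tensor I J A B \<phi> \<psi> (w i j) p q))"

definition min_cone :: "'i set \<Rightarrow> 'j set \<Rightarrow> ('i, 'i) op set \<Rightarrow> ('j, 'j) op set \<Rightarrow>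
    ('i \<times> 'j, 'i \<times> 'j) op set" where
  "min_cone I J A B = {w. min_pos I J A B 1 (\<lambda>_ _. w)}"

definition is_state :: "('i, 'i) op set \<Rightarrow> ('i, 'i) op set \<Rightarrow> ('i, 'i) op \<Rightarrow>
    (('i, 'i) op \<Rightarrow> complex) \<Rightarrow> bool" where
  "is_state A P u s \<longleftrightarrow>
     (\<forall>S\<in>A. \<forall>T\<in>A. s (S + T) = s S + s T) \<and> (\<forall>c. \<forall>S\<in>A. s (cscale c S) = c * s S) \<and>
     (\<forall>w\<in>P. s w \<in> \<real>\<^sub>\<ge>\<^sub>0) \<and> s u = 1"

definition min_state :: "'i set \<Rightarrow> 'j set \<Rightarrow> ('i, 'i) op set \<Rightarrow> ('j, 'j) op set \<Rightarrow>
    (('i \<times> 'j, 'i \<times> 'j) op \<Rightarrow> complex) \<Rightarrow> bool" where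
  "min_state I J A B s \<longleftrightarrow>
     is_state (alg_tensor I J A B) (min_cone I J A B) (id_op (I \<times> J)) s"

text \<open>The minimal tensor product of C*-algebras is the completion of the algebraic one in the
  spatial norm, that is, its norm closure in \<open>\<B>(\<ell>\<^sup>2(I \<times> J))\<close>; the positive elements of the
  completion are the norm limits of positive elements of the algebraic tensor product.\<close>

definition cstar_min_state :: "'i set \<Rightarrow> 'j set \<Rightarrow> ('i, 'i) op set \<Rightarrow> ('j, 'j) op set \<Rightarrow>
    (('i \<times> 'j, 'i \<times> 'j) op \<Rightarrow> complex) \<Rightarrow> bool" where
  "cstar_min_state I J A B s \<longleftrightarrow>
     is_state (op_closure (I \<times> J) (alg_tensor I J A B))
       (op_closure (I \<times> J) (min_cone I J A B)) (id_op (I \<times> J)) s"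

text \<open>\<open>\<Gamma>\<^sub>s\<close>, extended linearly from its values on the matrix units.\<close>

definition Gamma_of ::
  "((('x::finite, 'k) univ_index \<times> ('y::finite, 'k) univ_index,
     ('x, 'k) univ_index \<times> ('y, 'k) univ_index) op \<Rightarrow> complex) \<Rightarrow>
   ('x \<times> 'y) cmat \<Rightarrow> ('x \<times> 'y) cmat" where
  "Gamma_of s M = (\<Sum>x\<in>UNIV. \<Sum>x'\<in>UNIV. \<Sum>y\<in>UNIV. \<Sum>y'\<in>UNIV. mscale (M $ (x, y) $ (x', y'))
     (\<Sum>a\<in>UNIV. \<Sum>a'\<in>UNIV. \<Sum>b\<in>UNIV. \<Sum>b'\<in>UNIV.
        mscale (s (op_tensor univ_dom univ_dom (univ_e x x' a a') (univ_e y y' b b')))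
          (kron (matrix_unit a a') (matrix_unit b b'))))"

end

theory Submission imports Defs begin

text \<open>A functional \<open>s\<close> enters \<open>Gamma_of s\<close> only through the finitely many numbers \<open>s (e \<otimes> f)\<close>, with
\<open>e\<close> and \<open>f\<close> running through the generators. They form a square matrix indexed by
\<open>((x, a), (y, b))\<close>, the Choi matrix of the map, and \<open>Gamma_of s\<close> is the map with this Choi matrix
(\<open>Gamma_of_eq_chan\<close>). The theorem is therefore about two sets of matrices of a fixed finite size:
those coming from states, and the limits of those coming from finite-dimensional bistochastic
operator matrices.

Approximately quantum bicorrelations give states as follows. A finite-dimensional bistochastic
operator matrix \<open>E\<close> is positive, so Gram factorisation gives \<open>E x x' a a' = (V a x)\<^sup>* (V a' x')\<close> for a finite block
matrix \<open>V\<close>, and the two bistochastic identities say that \<open>V\<close> is a bi-isometry. Up to unitary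
equivalence \<open>V\<close> is then a direct summand of the universal bi-isometry, so \<open>E\<close> is the compression
of the generators to an orthonormal family (\<open>univ_compression_exists\<close>). Consequently a quantum
bicorrelation is given by a vector state on \<open>\<ell>\<^sup>2(univ_dom \<times> univ_dom)\<close> at a finite combination
\<open>\<zeta>\<close> of elementary tensors. Since compressions to finite orthonormal families are unital completely
positive, this vector state is nonnegative on the cone of the minimal tensor product
(\<open>min_cone_vector_nonneg\<close>), and by continuity on its norm closure. The values of vector states at a
fixed operator are bounded by its norm, so by Tychonoff's theorem a sequence of them has a pointwise
cluster point, which is a state on both tensor products (\<open>limit_of_vector_states\<close>).

In the converse direction only two properties of \<open>T_sys\<close> and \<open>C_alg\<close> matter: they are linear
spaces of bounded operators, and they contain the generators (\<open>gen_system\<close>). A unital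
completely positive map into \<open>M\<^sub>k\<close> sends the generators to a bistochastic operator matrix over
\<open>\<complex>\<^sup>k\<close> (\<open>ucp_bistoch_mat\<close>). Hence a combination of the \<open>e \<otimes> f\<close> and the unit is positive in the
minimal tensor product as soon as the corresponding affine functional is nonnegative on the Choi
matrices of all quantum bicorrelations (\<open>gen_combination_in_min_cone\<close>). These matrices form a convex
set, because bistochastic operator matrices can be added directly (\<open>convex_quantum_points\<close>). If the
matrix of a state were not in the closure of this set, a hyperplane would separate it, and the
combination of generators given by the hyperplane would be positive with a negative value under the
state (\<open>approximately_quantum_of_state\<close>).

Evaluating \<open>\<phi> \<otimes> \<psi>\<close> presupposes that it is well defined on the algebraic tensor product realised by
operators; this is the faithfulness of that realisation (\<open>tensor_functional_exists\<close>).\<close>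

section \<open>Positive semidefinite matrices and Gram factorisations\<close>

lemma nonneg_Reals_cnj_mult_self: "cnj z * z \<in> \<real>\<^sub>\<ge>\<^sub>0"
  by (simp add: complex_nonneg_Reals_iff)

lemma nonneg_Reals_sum:
  fixes f :: "'a \<Rightarrow> complex"
  assumes "\<And>i. i \<in> A \<Longrightarrow> f i \<in> \<real>\<^sub>\<ge>\<^sub>0"
  shows "sum f A \<in> \<real>\<^sub>\<ge>\<^sub>0"
  using assms by (induction A rule: infinite_finite_induct) (auto intro: nonneg_Reals_add_I)

lemma sum_if_delta_complex:
  fixes f :: "'a \<Rightarrow> complex"
  assumes "finite P" "p \<in> P"
  shows "(\<Sum>q\<in>P. (if q = p then a else 0) * f q) = a * f p"
    and "(\<Sum>q\<in>P. f q * (if q = p then a else 0)) = f p * a"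
  using assms by (simp_all add: if_distrib if_distribR cong: if_cong)

lemma psd_onD: "psd_on P M \<Longrightarrow> (\<Sum>p\<in>P. \<Sum>q\<in>P. cnj (c p) * M p q * c q) \<in> \<real>\<^sub>\<ge>\<^sub>0"
  by (auto simp: psd_on_def)

lemma psd_on_cong:
  assumes "\<And>p q. p \<in> P \<Longrightarrow> q \<in> P \<Longrightarrow> M p q = N p q"
  shows "psd_on P M = psd_on P N"
  unfolding psd_on_def using assms by (intro all_cong1 arg_cong2[where f="(\<in>)"] sum.cong) auto

lemma psd_on_gram:
  "psd_on P (\<lambda>p q. \<Sum>r\<in>R. cnj (g r p) * g r q)"
  unfolding psd_on_def
proof
  fix c
  have "(\<Sum>p\<in>P. \<Sum>q\<in>P. cnj (c p) * (\<Sum>r\<in>R. cnj (g r p) * g r q) * c q)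
      = (\<Sum>p\<in>P. \<Sum>q\<in>P. \<Sum>r\<in>R. cnj (g r p * c p) * (g r q * c q))"
    by (simp add: sum_distrib_left sum_distrib_right mult_ac)
  also have "\<dots> = (\<Sum>p\<in>P. \<Sum>r\<in>R. \<Sum>q\<in>P. cnj (g r p * c p) * (g r q * c q))"
    by (intro sum.cong refl sum.swap)
  also have "\<dots> = (\<Sum>r\<in>R. \<Sum>p\<in>P. \<Sum>q\<in>P. cnj (g r p * c p) * (g r q * c q))"
    by (rule sum.swap)
  also have "\<dots> = (\<Sum>r\<in>R. cnj (\<Sum>p\<in>P. g r p * c p) * (\<Sum>q\<in>P. g r q * c q))"
    by (simp add: sum_product)
  also have "\<dots> \<in> \<real>\<^sub>\<ge>\<^sub>0"
    by (intro nonneg_Reals_sum nonneg_Reals_cnj_mult_self)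
  finally show "(\<Sum>p\<in>P. \<Sum>q\<in>P. cnj (c p) * (\<Sum>r\<in>R. cnj (g r p) * g r q) * c q) \<in> \<real>\<^sub>\<ge>\<^sub>0" .
qed

lemma psd_on_diag:
  assumes "finite P" "psd_on P M" "p \<in> P"
  shows "M p p \<in> \<real>\<^sub>\<ge>\<^sub>0"
proof -
  have "(\<Sum>r\<in>P. \<Sum>q\<in>P. cnj (if r = p then 1 else 0) * M r q * (if q = p then 1 else 0))
      = (\<Sum>r\<in>P. cnj (if r = p then 1 else 0) * M r p)"
    using assms by (intro sum.cong refl) (simp add: sum_if_delta_complex)
  also have "\<dots> = (\<Sum>r\<in>P. (if r = p then 1 else 0) * M r p)"
    by (intro sum.cong) auto
  also have "\<dots> = M p p"
    using assms by (subst sum_if_delta_complex) auto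
  finally show ?thesis
    using psd_onD[OF assms(2), of "\<lambda>q. if q = p then 1 else 0"] by simp
qed

lemma psd_on_two:
  assumes "finite P" "psd_on P M" "p \<in> P" "q \<in> P" "p \<noteq> q"
  shows "cnj a * M p p * a + cnj a * M p q * b + cnj b * M q p * a + cnj b * M q q * b \<in> \<real>\<^sub>\<ge>\<^sub>0"
proof -
  let ?c = "\<lambda>r. if r = p then a else if r = q then b else 0"
  have zero: "(\<Sum>r\<in>P. f r) = f p + f q" if "\<And>r. r \<noteq> p \<Longrightarrow> r \<noteq> q \<Longrightarrow> f r = 0" for f :: "'a \<Rightarrow> complex"
  proof -
    have "(\<Sum>r\<in>P. f r) = (\<Sum>r\<in>{p,q}. f r)"
      using assms that by (intro sum.mono_neutral_right) auto
    then show ?thesis using assms by simp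
  qed
  have "(\<Sum>r\<in>P. \<Sum>s\<in>P. cnj (?c r) * M r s * ?c s)
      = (\<Sum>r\<in>P. cnj (?c r) * M r p * a + cnj (?c r) * M r q * b)"
    using assms by (intro sum.cong refl, subst zero) auto
  also have "\<dots> = cnj a * M p p * a + cnj a * M p q * b + cnj b * M q p * a + cnj b * M q q * b"
    using assms by (subst zero) auto
  finally show ?thesis using psd_onD[OF assms(2), of ?c] by simp
qed

lemma psd_on_hermitian:
  assumes "finite P" "psd_on P M" "p \<in> P" "q \<in> P"
  shows "M q p = cnj (M p q)"
proof (cases "p = q")
  case True
  then show ?thesis using psd_on_diag[OF assms(1-3)]
    by (auto simp: complex_nonneg_Reals_iff complex_eq_iff)
next
  case False
  have d: "Im (M p p) = 0" "Im (M q q) = 0"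
    using psd_on_diag[OF assms(1,2)] assms by (auto simp: complex_nonneg_Reals_iff)
  show ?thesis
    using psd_on_two[OF assms False, of 1 1] psd_on_two[OF assms False, of 1 \<i>] d
    by (auto simp: complex_nonneg_Reals_iff complex_eq_iff)
qed

text \<open>With \<open>M p p = 0\<close> the form on the span of \<open>p\<close> and \<open>q\<close> is affine along \<open>p\<close>, and an affine
function that is bounded below is constant.\<close>

lemma psd_on_zero_diag:
  assumes "finite P" "psd_on P M" "p \<in> P" "q \<in> P" "M p p = 0"
  shows "M p q = 0"
proof (cases "p = q")
  case False
  let ?z = "M p q"
  have h: "M q p = cnj ?z" using psd_on_hermitian[OF assms(1-4)] .
  have "Re (M q q) \<ge> 2 * t * (cmod ?z)\<^sup>2" for t
  proof -
    have *: "cnj (- of_real t * ?z) * ?z * 1 = - of_real (t * (cmod ?z)\<^sup>2)"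
         "cnj 1 * cnj ?z * (- of_real t * ?z) = - of_real (t * (cmod ?z)\<^sup>2)"
      using complex_norm_square[of ?z] by (auto simp: mult_ac)
    show ?thesis
      using psd_on_two[OF assms(1-4) False, of "- of_real t * ?z" 1]
      unfolding assms(5) h * by (auto simp: complex_nonneg_Reals_iff)
  qed
  from this[of "(Re (M q q) + 1) / (2 * (cmod ?z)\<^sup>2)"] show ?thesis
    by (cases "?z = 0") (auto simp: field_simps)
qed (use assms in auto)

text \<open>A vector on \<open>P\<close> is extended to \<open>p\<close> by the coefficient that minimises the form; the minimum is
the form of the Schur complement. If \<open>M p p = 0\<close> then the whole row of \<open>p\<close> vanishes, so the
convention \<open>z / 0 = 0\<close> gives the correct complement.\<close>

lemma psd_on_schur_complement:
  assumes fin: "finite P" and p: "p \<notin> P" and psd: "psd_on (insert p P) M"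
  shows "psd_on P (\<lambda>q q'. M q q' - M q p * M p q' / M p p)"
  unfolding psd_on_def
proof
  fix c :: "'a \<Rightarrow> complex"
  let ?P = "insert p P"
  have finP: "finite ?P" using fin by simp
  define d where "d = M p p"
  define S where "S = (\<Sum>q\<in>P. M p q * c q)"
  \<comment> \<open>The minimiser of \<open>d \<bar>c\<bar>\<^sup>2 + 2 Re (cnj c * S)\<close>.\<close>
  define c0 where "c0 = - S / d"
  let ?c = "\<lambda>q. if q = p then c0 else c q"
  have herm: "M q p = cnj (M p q)" if "q \<in> P" for q
    using psd_on_hermitian[OF finP psd, of p q] that by simp
  have dre: "cnj d = d"
    using psd_on_hermitian[OF finP psd, of p p] by (simp add: d_def)
  have S0: "S = 0" if "d = 0"
    unfolding S_def using psd_on_zero_diag[OF finP psd, of p] that by (simp add: d_def)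
  have cS: "cnj S = (\<Sum>q\<in>P. cnj (c q) * M q p)"
    unfolding S_def by (simp add: herm mult_ac)
  have in1: "(\<Sum>q'\<in>?P. cnj (?c q) * M q q' * ?c q') = cnj (?c q) * M q p * c0 + (\<Sum>q'\<in>P. cnj (?c q) * M q q' * c q')" for q
    using fin p by (subst sum.insert) (auto intro!: sum.cong)
  have "(\<Sum>q\<in>?P. \<Sum>q'\<in>?P. cnj (?c q) * M q q' * ?c q')
     = (cnj c0 * M p p * c0 + (\<Sum>q'\<in>P. cnj c0 * M p q' * c q'))
       + (\<Sum>q\<in>P. cnj (c q) * M q p * c0 + (\<Sum>q'\<in>P. cnj (c q) * M q q' * c q'))"
    unfolding in1 using fin p by (subst sum.insert) (auto intro!: sum.cong)
  also have "\<dots> = cnj c0 * d * c0 + cnj c0 * S + cnj S * c0 + (\<Sum>q\<in>P. \<Sum>q'\<in>P. cnj (c q) * M q q' * c q')"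
  proof -
    have "(\<Sum>q\<in>P. cnj (c q) * M q p * c0) = cnj S * c0"
      unfolding cS by (simp add: sum_distrib_right)
    moreover have "(\<Sum>q\<in>P. cnj c0 * M p q * c q) = cnj c0 * S"
      unfolding S_def by (simp add: sum_distrib_left mult.assoc)
    ultimately show ?thesis by (simp add: d_def sum.distrib)
  qed
  also have "cnj c0 * d * c0 + cnj c0 * S + cnj S * c0 = - (cnj S * S / d)"
    using S0 dre by (cases "d = 0") (auto simp: c0_def field_simps)
  also have "cnj S * S / d = (\<Sum>q\<in>P. \<Sum>q'\<in>P. cnj (c q) * (M q p * M p q' / M p p) * c q')"
    unfolding cS unfolding S_def d_def sum_product sum_divide_distrib by (simp add: mult_ac)
  finally have "(\<Sum>q\<in>?P. \<Sum>q'\<in>?P. cnj (?c q) * M q q' * ?c q')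
     = (\<Sum>q\<in>P. \<Sum>q'\<in>P. cnj (c q) * (M q q' - M q p * M p q' / M p p) * c q')"
    by (simp add: right_diff_distrib left_diff_distrib sum_subtractf)
  then show "(\<Sum>q\<in>P. \<Sum>q'\<in>P. cnj (c q) * (M q q' - M q p * M p q' / M p p) * c q') \<in> \<real>\<^sub>\<ge>\<^sub>0"
    using psd_onD[OF psd, of ?c] by simp
qed

text \<open>Cholesky factorisation: the row of a new index, divided by the square root of its diagonal entry,
becomes a row of \<open>g\<close>, and the Schur complement is factored by induction. The rows of \<open>g\<close> are
indexed by \<open>P\<close> itself, so that no further index type is needed.\<close>

lemma psd_on_imp_gram:
  assumes "finite P" "psd_on P M"
  shows "\<exists>g. \<forall>p\<in>P. \<forall>q\<in>P. M p q = (\<Sum>r\<in>P. cnj (g r p) * g r q)"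
  using assms
proof (induction P arbitrary: M rule: finite_induct)
  case (insert p P)
  have fin: "finite (insert p P)" using insert by simp
  obtain g where g: "\<And>q q'. q \<in> P \<Longrightarrow> q' \<in> P \<Longrightarrow>
      M q q' - M q p * M p q' / M p p = (\<Sum>r\<in>P. cnj (g r q) * g r q')"
    using insert.IH[OF psd_on_schur_complement[OF insert.hyps insert.prems]] by blast
  define s where "s = complex_of_real (sqrt (Re (M p p)))"
  have dpos: "M p p \<in> \<real>\<^sub>\<ge>\<^sub>0" using psd_on_diag[OF fin insert.prems] by simp
  then have s: "cnj s = s" "s * s = M p p"
    by (auto simp: s_def complex_nonneg_Reals_iff complex_eq_iff)
  have herm: "M q p = cnj (M p q)" if "q \<in> P" for q
    using psd_on_hermitian[OF fin insert.prems, of p q] that by simp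
  have z: "M p q = 0" if "s = 0" "q \<in> insert p P" for q
    using psd_on_zero_diag[OF fin insert.prems, of p q] that s by auto
  define g' where "g' r q = (if r = p then M p q / s else if q = p then 0 else g r q)" for r q
  have "M q q' = (\<Sum>r\<in>insert p P. cnj (g' r q) * g' r q')" if "q \<in> insert p P" "q' \<in> insert p P" for q q'
  proof -
    have "(\<Sum>r\<in>insert p P. cnj (g' r q) * g' r q')
       = cnj (M p q / s) * (M p q' / s) + (\<Sum>r\<in>P. cnj (if q = p then 0 else g r q) * (if q' = p then 0 else g r q'))"
      using insert.hyps by (subst sum.insert) (auto simp: g'_def intro!: sum.cong)
    also have "cnj (M p q / s) * (M p q' / s) = cnj (M p q) * M p q' / M p p"
      unfolding s(2)[symmetric] by (simp add: s(1))
    also have "cnj (M p q) * M p q' / M p p + (\<Sum>r\<in>P. cnj (if q = p then 0 else g r q) * (if q' = p then 0 else g r q')) = M q q'"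
    proof (cases "q = p \<or> q' = p")
      case False
      then show ?thesis using that g[of q q'] herm[of q] by (simp add: diff_eq_eq add.commute)
    next
      case True
      have "cnj (M p p) = M p p"
        using psd_on_hermitian[OF fin insert.prems, of p p] by simp
      moreover have "M p r = 0" if "M p p = 0" "r \<in> insert p P" for r
        using z[of r] that s(2) by simp
      moreover have "M q p = cnj (M p q)"
        using psd_on_hermitian[OF fin insert.prems, of p q] that by simp
      ultimately show ?thesis using True that by (cases "M p p = 0") auto
    qed
    finally show ?thesis by simp
  qed
  then show ?case by blast
qed auto

lemma sum_swap3:
  "(\<Sum>a\<in>A. \<Sum>b\<in>B. \<Sum>c\<in>C. f a b c) = (\<Sum>b\<in>B. \<Sum>c\<in>C. \<Sum>a\<in>A. f a b c)"
  by (subst sum.swap) (intro sum.cong refl sum.swap)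

lemma sum_swap4:
  "(\<Sum>a\<in>A. \<Sum>b\<in>B. \<Sum>c\<in>C. \<Sum>d\<in>D. f a b c d) = (\<Sum>d\<in>D. \<Sum>c\<in>C. \<Sum>a\<in>A. \<Sum>b\<in>B. f a b c d)"
  by (subst (2) sum_swap3, subst sum_swap3, subst sum.swap) (intro sum.cong refl sum.swap)

lemma gram_contract:
  fixes u :: "_ \<Rightarrow> _ \<Rightarrow> complex"
  shows "(\<Sum>q\<in>A. \<Sum>q'\<in>B. (\<Sum>s\<in>S. u s q * v s q') * (\<Sum>r\<in>R. u' r q * v' r q'))
      = (\<Sum>r\<in>R. \<Sum>s\<in>S. (\<Sum>q\<in>A. u s q * u' r q) * (\<Sum>q'\<in>B. v s q' * v' r q'))"
proof -
  have "(\<Sum>q\<in>A. \<Sum>q'\<in>B. (\<Sum>s\<in>S. u s q * v s q') * (\<Sum>r\<in>R. u' r q * v' r q'))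
     = (\<Sum>q\<in>A. \<Sum>q'\<in>B. \<Sum>s\<in>S. \<Sum>r\<in>R. (u s q * u' r q) * (v s q' * v' r q'))"
    by (simp add: sum_product mult_ac)
  also have "\<dots> = (\<Sum>r\<in>R. \<Sum>s\<in>S. \<Sum>q\<in>A. \<Sum>q'\<in>B. (u s q * u' r q) * (v s q' * v' r q'))"
    by (rule sum_swap4)
  finally show ?thesis by (simp add: sum_product)
qed

text \<open>Schur's product theorem, combined with a summation over a common index: a contraction of the
entrywise product of two Gram matrices is again a Gram matrix. It is behind the complete positivity
of maps with positive Choi matrix and behind the positivity of tensor products.\<close>

lemma psd_on_contract:
  assumes M: "\<And>p p'. p \<in> P \<Longrightarrow> p' \<in> P \<Longrightarrow>
    M p p' = (\<Sum>q\<in>A. \<Sum>q'\<in>A. (\<Sum>s\<in>S. cnj (h s p q) * h s p' q') * (\<Sum>r\<in>R. cnj (g r p q) * g r p' q'))"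
  shows "psd_on P M"
proof -
  have "M p p' = (\<Sum>t\<in>R\<times>S. cnj (\<Sum>q\<in>A. h (snd t) p q * g (fst t) p q) * (\<Sum>q\<in>A. h (snd t) p' q * g (fst t) p' q))"
    if "p \<in> P" "p' \<in> P" for p p'
    unfolding M[OF that] gram_contract by (simp add: sum.cartesian_product case_prod_beta)
  then have "psd_on P M = psd_on P (\<lambda>p p'. \<Sum>t\<in>R\<times>S. cnj (\<Sum>q\<in>A. h (snd t) p q * g (fst t) p q) * (\<Sum>q\<in>A. h (snd t) p' q * g (fst t) p' q))"
    by (intro psd_on_cong) blast
  then show ?thesis
    using psd_on_gram[where R = "R\<times>S" and g = "\<lambda>t p. \<Sum>q\<in>A. h (snd t) p q * g (fst t) p q"] by simp
qed

section \<open>Maps with a given Choi matrix\<close>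

text \<open>\<open>T\<close> is the Choi matrix of the map: its entry at \<open>((x, a), (y, b))\<close>, \<open>((x', a'), (y', b'))\<close> is the
coefficient of \<open>\<epsilon>\<^sub>a\<^sub>a\<^sub>' \<otimes> \<epsilon>\<^sub>b\<^sub>b\<^sub>'\<close> in the image of \<open>\<epsilon>\<^sub>x\<^sub>x\<^sub>' \<otimes> \<epsilon>\<^sub>y\<^sub>y\<^sub>'\<close>. The input and the output of each
party are kept together, since this is how the blocks of its operator matrix are indexed.\<close>

definition chan ::
  "(('x::finite \<times> 'a::finite) \<times> ('y::finite \<times> 'b::finite) \<Rightarrow> ('x \<times> 'a) \<times> ('y \<times> 'b) \<Rightarrow> complex) \<Rightarrow>
   ('x \<times> 'y) cmat \<Rightarrow> ('a \<times> 'b) cmat" where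
  "chan T M = (\<chi> p p'. \<Sum>q\<in>UNIV. \<Sum>q'\<in>UNIV. M $ q $ q' *
     T ((fst q, fst p), (snd q, snd p)) ((fst q', fst p'), (snd q', snd p')))"

text \<open>What a Choi matrix has to satisfy for the map to be a QNS correlation. The two functions \<open>f\<close> are the
marginals that remain when the output of one party is traced out.\<close>

definition corr_tensor ::
  "(('x::finite \<times> 'a::finite) \<times> ('y::finite \<times> 'b::finite) \<Rightarrow> ('x \<times> 'a) \<times> ('y \<times> 'b) \<Rightarrow> complex) \<Rightarrow> bool" where
  "corr_tensor T \<longleftrightarrow> psd_on UNIV T \<and>
     (\<exists>f. \<forall>x x' q q'. (\<Sum>a\<in>UNIV. T ((x, a), q) ((x', a), q')) = (if x = x' then f q q' else 0)) \<and>
     (\<exists>f. \<forall>y y' p p'. (\<Sum>b\<in>UNIV. T (p, (y, b)) (p', (y', b))) = (if y = y' then f p p' else 0)) \<and>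
     (\<forall>x x' y y'. (\<Sum>a\<in>UNIV. \<Sum>b\<in>UNIV. T ((x, a), (y, b)) ((x', a), (y', b))) =
        (if x = x' \<and> y = y' then 1 else 0))"

definition flip_tensor ::
  "(('x \<times> 'a) \<times> ('y \<times> 'b) \<Rightarrow> ('x \<times> 'a) \<times> ('y \<times> 'b) \<Rightarrow> complex) \<Rightarrow>
   ('a \<times> 'x) \<times> ('b \<times> 'y) \<Rightarrow> ('a \<times> 'x) \<times> ('b \<times> 'y) \<Rightarrow> complex" where
  "flip_tensor T p q = T (map_prod prod.swap prod.swap p) (map_prod prod.swap prod.swap q)"

lemma sum_UNIV_prod:
  "(\<Sum>z\<in>(UNIV :: ('a::finite \<times> 'b::finite) set). f z) = (\<Sum>x\<in>UNIV. \<Sum>y\<in>UNIV. f (x, y))"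
  by (simp add: sum.cartesian_product UNIV_Times_UNIV[symmetric] del: UNIV_Times_UNIV)

lemma chan_mat_linear: "mat_linear (chan T)"
  by (auto simp: mat_linear_def chan_def mscale_def vec_eq_iff distrib_right sum.distrib sum_distrib_left mult.assoc)

text \<open>Both the Choi matrix and the block matrix \<open>R\<close> are replaced by Gram factorisations; the output is then
a contraction of their product.\<close>

lemma completely_positive_chan:
  fixes T :: "('x::finite \<times> 'a::finite) \<times> ('y::finite \<times> 'b::finite) \<Rightarrow> ('x \<times> 'a) \<times> ('y \<times> 'b) \<Rightarrow> complex"
  assumes "psd_on UNIV T"
  shows "completely_positive (chan T)"
  unfolding completely_positive_def
proof (intro allI impI)
  fix n :: nat and R :: "nat \<Rightarrow> nat \<Rightarrow> ('x \<times> 'y) cmat"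
  assume R: "psd_on ({..<n} \<times> UNIV) (\<lambda>(i, p) (j, q). R i j $ p $ q)"
  let ?P = "{..<n} \<times> (UNIV :: ('x \<times> 'y) set)"
  obtain h where h0: "\<forall>p\<in>?P. \<forall>q\<in>?P. (\<lambda>(i, p) (j, q). R i j $ p $ q) p q = (\<Sum>r\<in>?P. cnj (h r p) * h r q)"
    using psd_on_imp_gram[OF _ R] by auto
  then have h: "R i j $ p $ q = (\<Sum>r\<in>?P. cnj (h r (i, p)) * h r (j, q))" if "i < n" "j < n" for i j p q
    using bspec[OF bspec[OF h0], of "(i, p)" "(j, q)"] that by simp
  obtain g :: "('x \<times> 'a) \<times> ('y \<times> 'b) \<Rightarrow> _" where "\<forall>p\<in>UNIV. \<forall>q\<in>UNIV. T p q = (\<Sum>r\<in>UNIV. cnj (g r p) * g r q)"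
    using psd_on_imp_gram[OF finite assms] ..
  then have g: "T p q = (\<Sum>r\<in>UNIV. cnj (g r p) * g r q)" for p q
    by blast
  let ?g = "\<lambda>r (p :: nat \<times> ('a \<times> 'b)) (q :: 'x \<times> 'y). g r ((fst q, fst (snd p)), (snd q, snd (snd p)))"
  show "psd_on ({..<n} \<times> UNIV) (\<lambda>(i, p) (j, q). chan T (R i j) $ p $ q)"
    by (rule psd_on_contract[where A = UNIV and S = ?P and R = UNIV and h = "\<lambda>r p q. h r (fst p, q)" and g = ?g])
       (auto simp: chan_def g h)
qed

lemma quantum_channel_chan:
  assumes T: "corr_tensor T"
  shows "quantum_channel (chan T)"
proof -
  have n: "(\<Sum>a\<in>UNIV. \<Sum>b\<in>UNIV. T ((x, a), (y, b)) ((x', a), (y', b))) = (if x = x' \<and> y = y' then 1 else 0)" for x x' y y'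
    using T by (simp add: corr_tensor_def)
  have "trace (chan T M) = trace M" for M
  proof -
    have "trace (chan T M) = (\<Sum>p\<in>UNIV. \<Sum>q\<in>UNIV. \<Sum>q'\<in>UNIV. M $ q $ q' *
     T ((fst q, fst p), (snd q, snd p)) ((fst q', fst p), (snd q', snd p)))"
      by (simp add: trace_def chan_def)
    also have "\<dots> = (\<Sum>q\<in>UNIV. \<Sum>q'\<in>UNIV. \<Sum>p\<in>UNIV. M $ q $ q' *
     T ((fst q, fst p), (snd q, snd p)) ((fst q', fst p), (snd q', snd p)))"
      by (rule sum_swap3)
    also have "\<dots> = (\<Sum>q\<in>UNIV. \<Sum>q'\<in>UNIV. M $ q $ q' * (if q = q' then 1 else 0))"
      by (simp add: sum_distrib_left[symmetric] sum_UNIV_prod[where f = "\<lambda>p. T (_ p) (_ p)"] n prod_eq_iff)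
    also have "\<dots> = trace M"
      by (simp add: trace_def if_distrib cong: if_cong)
    finally show ?thesis .
  qed
  then show ?thesis
    using T completely_positive_chan chan_mat_linear unfolding quantum_channel_def corr_tensor_def by blast
qed

lemma chan_no_signalling_fst:
  assumes T: "\<And>x x' q q'. (\<Sum>a\<in>UNIV. T ((x, a), q) ((x', a), q')) = (if x = x' then f q q' else 0)"
    and M: "trace M = 0"
  shows "ptrace_fst (chan T (kron M N)) = 0"
proof -
  have "(\<Sum>a\<in>UNIV. \<Sum>q\<in>UNIV. \<Sum>q'\<in>UNIV. kron M N $ q $ q' * T ((fst q, a), (snd q, b)) ((fst q', a), (snd q', b'))) = 0" for b b'
  proof -
    have "(\<Sum>a\<in>UNIV. \<Sum>q\<in>UNIV. \<Sum>q'\<in>UNIV. kron M N $ q $ q' * T ((fst q, a), (snd q, b)) ((fst q', a), (snd q', b')))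
       = (\<Sum>q\<in>UNIV. \<Sum>q'\<in>UNIV. \<Sum>a\<in>UNIV. kron M N $ q $ q' * T ((fst q, a), (snd q, b)) ((fst q', a), (snd q', b')))"
      by (rule sum_swap3)
    also have "\<dots> = (\<Sum>q\<in>UNIV. \<Sum>q'\<in>UNIV. kron M N $ q $ q' * (if fst q = fst q' then f (snd q, b) (snd q', b') else 0))"
      by (simp add: sum_distrib_left[symmetric] T)
    also have "\<dots> = (\<Sum>x\<in>UNIV. \<Sum>y\<in>UNIV. \<Sum>x'\<in>UNIV. \<Sum>y'\<in>UNIV. M $ x $ x' * N $ y $ y' * (if x = x' then f (y, b) (y', b') else 0))"
      by (simp add: sum_UNIV_prod kron_def cong: if_cong)
    also have "\<dots> = (\<Sum>x\<in>UNIV. \<Sum>y\<in>UNIV. \<Sum>y'\<in>UNIV. \<Sum>x'\<in>UNIV. M $ x $ x' * N $ y $ y' * (if x = x' then f (y, b) (y', b') else 0))"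
      by (intro sum.cong refl sum.swap)
    also have "\<dots> = (\<Sum>x\<in>UNIV. \<Sum>y\<in>UNIV. \<Sum>y'\<in>UNIV. M $ x $ x * (N $ y $ y' * f (y, b) (y', b')))"
      by (simp add: if_distrib mult.assoc cong: if_cong)
    also have "\<dots> = trace M * (\<Sum>y\<in>UNIV. \<Sum>y'\<in>UNIV. N $ y $ y' * f (y, b) (y', b'))"
      unfolding trace_def by (subst sum_distrib_right) (simp only: sum_distrib_left)
    finally show ?thesis using M by simp
  qed
  then show ?thesis by (simp add: ptrace_fst_def chan_def vec_eq_iff)
qed

lemma chan_no_signalling_snd:
  assumes T: "\<And>y y' p p'. (\<Sum>b\<in>UNIV. T (p, (y, b)) (p', (y', b))) = (if y = y' then f p p' else 0)"
    and N: "trace N = 0"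
  shows "ptrace_snd (chan T (kron M N)) = 0"
proof -
  have "(\<Sum>b\<in>UNIV. \<Sum>q\<in>UNIV. \<Sum>q'\<in>UNIV. kron M N $ q $ q' * T ((fst q, a), (snd q, b)) ((fst q', a'), (snd q', b))) = 0" for a a'
  proof -
    have "(\<Sum>b\<in>UNIV. \<Sum>q\<in>UNIV. \<Sum>q'\<in>UNIV. kron M N $ q $ q' * T ((fst q, a), (snd q, b)) ((fst q', a'), (snd q', b)))
       = (\<Sum>q\<in>UNIV. \<Sum>q'\<in>UNIV. \<Sum>b\<in>UNIV. kron M N $ q $ q' * T ((fst q, a), (snd q, b)) ((fst q', a'), (snd q', b)))"
      by (rule sum_swap3)
    also have "\<dots> = (\<Sum>q\<in>UNIV. \<Sum>q'\<in>UNIV. kron M N $ q $ q' * (if snd q = snd q' then f (fst q, a) (fst q', a') else 0))"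
      by (simp add: sum_distrib_left[symmetric] T)
    also have "\<dots> = (\<Sum>x\<in>UNIV. \<Sum>y\<in>UNIV. \<Sum>x'\<in>UNIV. \<Sum>y'\<in>UNIV. M $ x $ x' * N $ y $ y' * (if y = y' then f (x, a) (x', a') else 0))"
      by (simp add: sum_UNIV_prod kron_def cong: if_cong)
    also have "\<dots> = (\<Sum>x\<in>UNIV. \<Sum>y\<in>UNIV. \<Sum>x'\<in>UNIV. N $ y $ y * (M $ x $ x' * f (x, a) (x', a')))"
      by (simp add: if_distrib mult_ac cong: if_cong)
    also have "\<dots> = (\<Sum>y\<in>UNIV. \<Sum>x\<in>UNIV. \<Sum>x'\<in>UNIV. N $ y $ y * (M $ x $ x' * f (x, a) (x', a')))"
      by (rule sum.swap)
    also have "\<dots> = trace N * (\<Sum>x\<in>UNIV. \<Sum>x'\<in>UNIV. M $ x $ x' * f (x, a) (x', a'))"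
      unfolding trace_def by (subst sum_distrib_right) (simp only: sum_distrib_left)
    finally show ?thesis using N by simp
  qed
  then show ?thesis by (simp add: ptrace_snd_def chan_def vec_eq_iff)
qed

lemma QNS_correlation_chan:
  assumes "corr_tensor T"
  shows "QNS_correlation (chan T)"
proof -
  obtain f where f: "\<forall>x x' q q'. (\<Sum>a\<in>UNIV. T ((x, a), q) ((x', a), q')) = (if x = x' then f q q' else 0)"
    using assms unfolding corr_tensor_def by (elim conjE exE)
  obtain g where g: "\<forall>y y' p p'. (\<Sum>b\<in>UNIV. T (p, (y, b)) (p', (y', b))) = (if y = y' then g p p' else 0)"
    using assms unfolding corr_tensor_def by (elim conjE exE)
  show ?thesis
    unfolding QNS_correlation_def
    using chan_no_signalling_fst[OF f[rule_format]] chan_no_signalling_snd[OF g[rule_format]]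
      quantum_channel_chan[OF assms] by simp
qed

lemma pairing_eq: "pairing M N = (\<Sum>p\<in>UNIV. \<Sum>q\<in>UNIV. M $ p $ q * N $ p $ q)"
  by (simp add: pairing_def trace_def matrix_matrix_mult_def transpose_def)

lemma sum_delta2:
  fixes p :: "'a::finite" and q :: "'b::finite" and f :: "'a \<Rightarrow> 'b \<Rightarrow> complex"
  shows "(\<Sum>i\<in>UNIV. \<Sum>j\<in>UNIV. f i j * (if i = p \<and> j = q then 1 else 0)) = f p q"
proof -
  have "(\<Sum>i\<in>UNIV. \<Sum>j\<in>UNIV. f i j * (if i = p \<and> j = q then 1 else 0))
      = (\<Sum>i\<in>UNIV. \<Sum>j\<in>UNIV. if j = q then if i = p then f i j else 0 else 0)"
    by (intro sum.cong refl) simp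
  then show ?thesis by simp
qed

lemma pairing_matrix_unit: "pairing M (matrix_unit p q) = M $ p $ q"
  unfolding pairing_eq matrix_unit_def by (simp add: sum_delta2)

text \<open>The pairing is symmetric in the matrix entries, so dualising exchanges the inputs with the outputs.
The description in \<open>dual_map\<close> determines the value because pairing with a matrix unit picks out an
entry.\<close>

lemma dual_map_chan:
  fixes T :: "('x::finite \<times> 'a::finite) \<times> ('y::finite \<times> 'b::finite) \<Rightarrow> ('x \<times> 'a) \<times> ('y \<times> 'b) \<Rightarrow> complex"
  shows "dual_map (chan T) = chan (flip_tensor T)"
proof
  fix \<omega> :: "('a \<times> 'b) cmat"
  have "pairing (chan (flip_tensor T) \<omega>) \<rho> = pairing \<omega> (chan T \<rho>)" for \<rho>
  proof -
    let ?f = "\<lambda>p p' q q'. \<omega> $ q $ q' * \<rho> $ p $ p' * T ((fst p, fst q), (snd p, snd q)) ((fst p', fst q'), (snd p', snd q'))"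
    have "pairing (chan (flip_tensor T) \<omega>) \<rho> = (\<Sum>p\<in>UNIV. \<Sum>p'\<in>UNIV. \<Sum>q\<in>UNIV. \<Sum>q'\<in>UNIV. ?f p p' q q')"
      unfolding pairing_eq chan_def flip_tensor_def by (simp add: sum_distrib_right, simp add: mult_ac)
    also have "\<dots> = (\<Sum>q'\<in>UNIV. \<Sum>q\<in>UNIV. \<Sum>p\<in>UNIV. \<Sum>p'\<in>UNIV. ?f p p' q q')"
      by (rule sum_swap4)
    also have "\<dots> = (\<Sum>q\<in>UNIV. \<Sum>q'\<in>UNIV. \<Sum>p\<in>UNIV. \<Sum>p'\<in>UNIV. ?f p p' q q')"
      by (rule sum.swap)
    also have "\<dots> = pairing \<omega> (chan T \<rho>)"
      unfolding pairing_eq chan_def by (simp add: sum_distrib_left mult.assoc)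
    finally show ?thesis .
  qed
  then show "dual_map (chan T) \<omega> = chan (flip_tensor T) \<omega>"
    unfolding dual_map_def
    by (intro the_equality) (auto simp: vec_eq_iff simp flip: pairing_matrix_unit)
qed

lemma chan_mat_1:
  assumes "corr_tensor (flip_tensor T)"
  shows "chan T (mat 1) = mat 1"
proof -
  have n: "(\<Sum>x\<in>UNIV. \<Sum>y\<in>UNIV. T ((x, a), (y, b)) ((x, a'), (y, b'))) = (if a = a' \<and> b = b' then 1 else 0)" for a a' b b'
    using assms by (simp add: corr_tensor_def flip_tensor_def)
  have "(\<Sum>q\<in>UNIV. \<Sum>q'\<in>UNIV. mat 1 $ q $ q' * T ((fst q, fst p), (snd q, snd p)) ((fst q', fst p'), (snd q', snd p')))
     = (\<Sum>q\<in>UNIV. T ((fst q, fst p), (snd q, snd p)) ((fst q, fst p'), (snd q, snd p')))" for p p'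
    by (simp add: mat_def if_distrib if_distribR cong: if_cong)
  also have "\<And>p p'. (\<Sum>q\<in>UNIV. T ((fst q, fst p), (snd q, snd p)) ((fst q, fst p'), (snd q, snd p'))) = mat 1 $ p $ p'"
    by (simp add: sum_UNIV_prod n mat_def prod_eq_iff)
  finally show ?thesis by (simp add: chan_def vec_eq_iff)
qed

lemma QNS_bicorrelation_chan:
  assumes "corr_tensor T" "corr_tensor (flip_tensor T)"
  shows "QNS_bicorrelation (chan T)"
  unfolding QNS_bicorrelation_def dual_map_chan
  using QNS_correlation_chan[OF assms(1)] QNS_correlation_chan[OF assms(2)] chan_mat_1[OF assms(2)] by blast

lemma matrix_unit_nth: "matrix_unit x x' $ i $ j = (if i = x \<and> j = x' then 1 else 0)"
  by (simp add: matrix_unit_def)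

lemma kron_matrix_unit: "kron (matrix_unit x x') (matrix_unit y y') = matrix_unit (x, y) (x', y')"
  by (simp add: kron_def matrix_unit_def vec_eq_iff prod_eq_iff)

lemma sum_mscale_matrix_units:
  "(\<Sum>a\<in>UNIV. \<Sum>a'\<in>UNIV. \<Sum>b\<in>UNIV. \<Sum>b'\<in>UNIV.
      mscale (t a a' b b') (kron (matrix_unit a a') (matrix_unit b b')))
   = (\<chi> p p'. t (fst p) (fst p') (snd p) (snd p'))"
proof -
  have "mscale c (kron (matrix_unit a a') (matrix_unit b b')) $ p $ p' =
     (if b' = snd p' then if b = snd p then if a' = fst p' then if a = fst p then c else 0 else 0 else 0 else 0)"
    for c a a' b b' and p p' :: "'a \<times> 'b"
    by (simp add: kron_matrix_unit mscale_def matrix_unit_nth prod_eq_iff)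
  then show ?thesis by (simp add: vec_eq_iff)
qed

lemma chan_matrix_unit:
  "chan T (kron (matrix_unit x x') (matrix_unit y y')) =
     (\<chi> p p'. T ((x, fst p), (y, snd p)) ((x', fst p'), (y', snd p')))"
  using sum_delta2[where p = "(x, y)" and q = "(x', y')"]
  by (simp add: kron_matrix_unit chan_def matrix_unit_nth vec_eq_iff mult.commute[of "if _ then _ else _"])

lemma mat_linear_expand:
  assumes "mat_linear \<Gamma>"
  shows "\<Gamma> M = (\<Sum>q\<in>UNIV. \<Sum>q'\<in>UNIV. mscale (M $ q $ q') (\<Gamma> (matrix_unit q q')))"
proof -
  have add: "\<Gamma> (A + B) = \<Gamma> A + \<Gamma> B" and sc: "\<Gamma> (mscale c A) = mscale c (\<Gamma> A)" for A B c
    using assms by (auto simp: mat_linear_def)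
  have 0: "\<Gamma> 0 = 0" using add[of 0 0] by simp
  have s: "\<Gamma> (sum f S) = (\<Sum>i\<in>S. \<Gamma> (f i))" for f and S :: "'i set"
    by (induction S rule: infinite_finite_induct) (auto simp: add 0)
  have "M = (\<Sum>q\<in>UNIV. \<Sum>q'\<in>UNIV. mscale (M $ q $ q') (matrix_unit q q'))"
  proof -
    have "mscale (M $ q $ q') (matrix_unit q q') $ i $ j = (if q' = j then if q = i then M $ i $ j else 0 else 0)" for i j q q'
      by (auto simp: mscale_def matrix_unit_def)
    then show ?thesis by (simp add: vec_eq_iff)
  qed
  then have "\<Gamma> M = \<Gamma> (\<Sum>q\<in>UNIV. \<Sum>q'\<in>UNIV. mscale (M $ q $ q') (matrix_unit q q'))" by simp
  then show ?thesis by (simp add: s sc)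
qed

lemma mat_linear_eqI:
  assumes "mat_linear \<Gamma>" "mat_linear \<Delta>"
    and "\<And>x x' y y'. \<Gamma> (kron (matrix_unit x x') (matrix_unit y y')) = \<Delta> (kron (matrix_unit x x') (matrix_unit y y'))"
  shows "\<Gamma> = \<Delta>"
proof
  fix M
  have "\<Gamma> (matrix_unit q q') = \<Delta> (matrix_unit q q')" for q q'
    using assms(3)[of "fst q" "fst q'" "snd q" "snd q'"] by (simp add: kron_matrix_unit)
  then show "\<Gamma> M = \<Delta> M"
    using mat_linear_expand[OF assms(1), of M] mat_linear_expand[OF assms(2), of M] by simp
qed

section \<open>Quantum correlations in coordinates\<close>

text \<open>A bistochastic operator matrix on \<open>\<complex>\<^sup>k\<close> in coordinates: \<open>E (x, a) (x', a') i j\<close> is the entry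
\<open>(i, j)\<close> of the block in row \<open>(x, a)\<close> and column \<open>(x', a')\<close>.\<close>

definition bistoch_mat :: "nat \<Rightarrow> ('x::finite \<times> 'x \<Rightarrow> 'x \<times> 'x \<Rightarrow> nat \<Rightarrow> nat \<Rightarrow> complex) \<Rightarrow> bool" where
  "bistoch_mat k E \<longleftrightarrow>
     psd_on (UNIV \<times> {..<k}) (\<lambda>z w. E (fst z) (fst w) (snd z) (snd w)) \<and>
     (\<forall>x x'. \<forall>i<k. \<forall>j<k. (\<Sum>a\<in>UNIV. E (x, a) (x', a) i j) = (if x = x' \<and> i = j then 1 else 0)) \<and>
     (\<forall>a a'. \<forall>i<k. \<forall>j<k. (\<Sum>x\<in>UNIV. E (x, a) (x, a') i j) = (if a = a' \<and> i = j then 1 else 0))"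

text \<open>The Choi matrix \<open>\<langle>(E \<otimes> F) c, c\<rangle>\<close> of the bicorrelation defined by two operator matrices and a vector.\<close>

definition mat_corr :: "'i set \<Rightarrow> ('p \<Rightarrow> 'p \<Rightarrow> 'i \<Rightarrow> 'i \<Rightarrow> complex) \<Rightarrow> 'j set \<Rightarrow> ('q \<Rightarrow> 'q \<Rightarrow> 'j \<Rightarrow> 'j \<Rightarrow> complex) \<Rightarrow>
    ('i \<times> 'j \<Rightarrow> complex) \<Rightarrow> 'p \<times> 'q \<Rightarrow> 'p \<times> 'q \<Rightarrow> complex" where
  "mat_corr K E L F c p q = (\<Sum>z\<in>K \<times> L. \<Sum>w\<in>K \<times> L.
     cnj (c z) * (E (fst p) (fst q) (fst z) (fst w) * F (snd p) (snd q) (snd z) (snd w)) * c w)"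

definition unit_vec :: "'i set \<Rightarrow> ('i \<Rightarrow> complex) \<Rightarrow> bool" where
  "unit_vec K c \<longleftrightarrow> (\<Sum>z\<in>K. cnj (c z) * c z) = 1"

text \<open>The tensor product of positive block matrices is positive, and contracting with the vector \<open>c\<close> on both
sides preserves positivity.\<close>

lemma psd_on_mat_corr:
  fixes E :: "'p::finite \<Rightarrow> 'p \<Rightarrow> 'i \<Rightarrow> 'i \<Rightarrow> complex" and F :: "'q::finite \<Rightarrow> 'q \<Rightarrow> 'j \<Rightarrow> 'j \<Rightarrow> complex"
  assumes fin: "finite K" "finite L"
    and E: "psd_on (UNIV \<times> K) (\<lambda>z w. E (fst z) (fst w) (snd z) (snd w))"
    and F: "psd_on (UNIV \<times> L) (\<lambda>z w. F (fst z) (fst w) (snd z) (snd w))"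
  shows "psd_on UNIV (mat_corr K E L F c)"
proof -
  have fK: "finite ((UNIV :: 'p set) \<times> K)" and fL: "finite ((UNIV :: 'q set) \<times> L)" using fin by auto
  obtain g :: "'p \<times> 'i \<Rightarrow> _" where g0: "\<forall>z\<in>UNIV \<times> K. \<forall>w\<in>UNIV \<times> K. E (fst z) (fst w) (snd z) (snd w) = (\<Sum>r\<in>UNIV \<times> K. cnj (g r z) * g r w)"
    using psd_on_imp_gram[OF fK E] ..
  obtain h :: "'q \<times> 'j \<Rightarrow> _" where h0: "\<forall>z\<in>UNIV \<times> L. \<forall>w\<in>UNIV \<times> L. F (fst z) (fst w) (snd z) (snd w) = (\<Sum>r\<in>UNIV \<times> L. cnj (h r z) * h r w)"
    using psd_on_imp_gram[OF fL F] ..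
  have g: "E p q i j = (\<Sum>r\<in>UNIV \<times> K. cnj (g r (p, i)) * g r (q, j))" if "i \<in> K" "j \<in> K" for p q i j
    using bspec[OF bspec[OF g0], of "(p, i)" "(q, j)"] that by simp
  have h: "F p q i j = (\<Sum>r\<in>UNIV \<times> L. cnj (h r (p, i)) * h r (q, j))" if "i \<in> L" "j \<in> L" for p q i j
    using bspec[OF bspec[OF h0], of "(p, i)" "(q, j)"] that by simp
  show ?thesis
  proof (rule psd_on_contract[where A = "K \<times> L" and S = "UNIV \<times> K" and R = "UNIV \<times> L"
        and h = "\<lambda>r p z. g r (fst p, fst z)" and g = "\<lambda>r p z. h r (snd p, snd z) * c z"])
    fix p q :: "'p \<times> 'q"
    have "cnj (c z) * (E (fst p) (fst q) (fst z) (fst w) * F (snd p) (snd q) (snd z) (snd w)) * c w =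
       (\<Sum>s\<in>UNIV \<times> K. cnj (g s (fst p, fst z)) * g s (fst q, fst w)) *
       (\<Sum>r\<in>UNIV \<times> L. cnj (h r (snd p, snd z) * c z) * (h r (snd q, snd w) * c w))"
      if "z \<in> K \<times> L" "w \<in> K \<times> L" for z w
    proof -
      have "(\<Sum>r\<in>UNIV \<times> L. cnj (h r (snd p, snd z) * c z) * (h r (snd q, snd w) * c w))
          = cnj (c z) * F (snd p) (snd q) (snd z) (snd w) * c w"
        using that by (subst h) (auto simp: sum_distrib_left sum_distrib_right mult_ac intro!: sum.cong)
      moreover have "(\<Sum>s\<in>UNIV \<times> K. cnj (g s (fst p, fst z)) * g s (fst q, fst w)) = E (fst p) (fst q) (fst z) (fst w)"
        using that by (subst g) auto
      ultimately show ?thesis by (simp only: mult_ac)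
    qed
    then show "mat_corr K E L F c p q = (\<Sum>z\<in>K \<times> L. \<Sum>w\<in>K \<times> L.
       (\<Sum>s\<in>UNIV \<times> K. cnj (g s (fst p, fst z)) * g s (fst q, fst w)) *
       (\<Sum>r\<in>UNIV \<times> L. cnj (h r (snd p, snd z) * c z) * (h r (snd q, snd w) * c w)))"
      unfolding mat_corr_def by (intro sum.cong refl) blast
  qed
qed

text \<open>A sum over blocks of one party is moved inside. The summed operator matrix no longer depends on the
block indices, hence the trivial index.\<close>

lemma sum_mat_corr_fst:
  "(\<Sum>a\<in>A. mat_corr K E L F c (p a, q) (p' a, q')) =
   mat_corr K (\<lambda>_ _ i j. \<Sum>a\<in>A. E (p a) (p' a) i j) L F c ((), q) ((), q')"
  unfolding mat_corr_def fst_conv snd_conv sum_swap3[where A = A]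
  by (simp add: sum_distrib_left sum_distrib_right)

lemma sum_mat_corr_snd:
  "(\<Sum>b\<in>B. mat_corr K E L F c (p, q b) (p', q' b)) =
   mat_corr K E L (\<lambda>_ _ i j. \<Sum>b\<in>B. F (q b) (q' b) i j) c (p, ()) (p', ())"
  unfolding mat_corr_def fst_conv snd_conv sum_swap3[where A = B]
  by (simp add: sum_distrib_left sum_distrib_right)

lemma mat_corr_cong:
  assumes "\<And>i j. i \<in> K \<Longrightarrow> j \<in> K \<Longrightarrow> E (fst p) (fst q) i j = E' (fst p') (fst q') i j"
    "\<And>i j. i \<in> L \<Longrightarrow> j \<in> L \<Longrightarrow> F (snd p) (snd q) i j = F' (snd p') (snd q') i j"
  shows "mat_corr K E L F c p q = mat_corr K E' L F' c p' q'"
  unfolding mat_corr_def using assms by (intro sum.cong refl) auto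

lemma mat_corr_delta:
  assumes "finite K" "finite L" "unit_vec (K \<times> L) c"
  shows "mat_corr K (\<lambda>_ _ i j. if P \<and> i = j then 1 else 0) L (\<lambda>_ _ i j. if Q \<and> i = j then 1 else 0) c p q
    = (if P \<and> Q then 1 else 0)"
proof (cases "P \<and> Q")
  case True
  have "mat_corr K (\<lambda>_ _ i j. if P \<and> i = j then 1 else 0) L (\<lambda>_ _ i j. if Q \<and> i = j then 1 else 0) c p q
     = (\<Sum>z\<in>K \<times> L. \<Sum>w\<in>K \<times> L. if w = z then cnj (c z) * c z else 0)"
    unfolding mat_corr_def using True by (intro sum.cong refl) (auto simp: prod_eq_iff)
  also have "\<dots> = (\<Sum>z\<in>K \<times> L. cnj (c z) * c z)"
    using assms by (intro sum.cong refl) simp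
  finally show ?thesis using assms True by (simp add: unit_vec_def)
next
  case False
  then have "cnj (c z) * ((if P \<and> fst z = fst w then 1 else 0) * (if Q \<and> snd z = snd w then 1 else 0)) * c w = 0" for z w
    by auto
  then show ?thesis unfolding mat_corr_def using False by auto
qed

lemma mat_corr_zero_fst: "mat_corr K (\<lambda>_ _ i j. 0) L F c p q = 0"
  and mat_corr_zero_snd: "mat_corr K E L (\<lambda>_ _ i j. 0) c p q = 0"
  by (simp_all add: mat_corr_def)

text \<open>Tracing out the output of one party replaces its blocks by \<open>\<delta>\<close> times the identity, and the remaining
expression does not contain its input: this is no-signalling.\<close>

lemma corr_tensor_mat_corr:
  fixes E :: "('x::finite \<times> 'a::finite) \<Rightarrow> _" and F :: "('y::finite \<times> 'b::finite) \<Rightarrow> _" and k m :: nat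
  assumes E: "psd_on (UNIV \<times> {..<k}) (\<lambda>z w. E (fst z) (fst w) (snd z) (snd w))"
    "\<And>x x' i j. i < k \<Longrightarrow> j < k \<Longrightarrow> (\<Sum>a\<in>UNIV. E (x, a) (x', a) i j) = (if x = x' \<and> i = j then 1 else 0)"
    and F: "psd_on (UNIV \<times> {..<m}) (\<lambda>z w. F (fst z) (fst w) (snd z) (snd w))"
    "\<And>y y' i j. i < m \<Longrightarrow> j < m \<Longrightarrow> (\<Sum>b\<in>UNIV. F (y, b) (y', b) i j) = (if y = y' \<and> i = j then 1 else 0)"
    and c: "unit_vec ({..<k} \<times> {..<m}) c"
  shows "corr_tensor (mat_corr {..<k} E {..<m} F c)"
  unfolding corr_tensor_def
proof (intro conjI)
  let ?\<delta> = "\<lambda>_ _ i j. if True \<and> i = j then 1 else (0::complex)"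
  let ?T = "mat_corr {..<k} E {..<m} F c"
  show "psd_on UNIV ?T" using E(1) F(1) by (intro psd_on_mat_corr) auto
  show "\<exists>f. \<forall>x x' q q'. (\<Sum>a\<in>UNIV. ?T ((x, a), q) ((x', a), q')) = (if x = x' then f q q' else 0)"
  proof (intro exI allI)
    fix x x' q q'
    have "(\<Sum>a\<in>UNIV. ?T ((x, a), q) ((x', a), q')) = mat_corr {..<k} (\<lambda>_ _ i j. if x = x' \<and> i = j then 1 else 0) {..<m} F c ((), q) ((), q')"
      unfolding sum_mat_corr_fst using E(2) by (intro mat_corr_cong) auto
    then show "(\<Sum>a\<in>UNIV. ?T ((x, a), q) ((x', a), q')) = (if x = x' then mat_corr {..<k} ?\<delta> {..<m} F c ((), q) ((), q') else 0)"
      by (simp add: mat_corr_zero_fst)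
  qed
  show "\<exists>f. \<forall>y y' p p'. (\<Sum>b\<in>UNIV. ?T (p, (y, b)) (p', (y', b))) = (if y = y' then f p p' else 0)"
  proof (intro exI allI)
    fix y y' p p'
    have "(\<Sum>b\<in>UNIV. ?T (p, (y, b)) (p', (y', b))) = mat_corr {..<k} E {..<m} (\<lambda>_ _ i j. if y = y' \<and> i = j then 1 else 0) c (p, ()) (p', ())"
      unfolding sum_mat_corr_snd using F(2) by (intro mat_corr_cong) auto
    then show "(\<Sum>b\<in>UNIV. ?T (p, (y, b)) (p', (y', b))) = (if y = y' then mat_corr {..<k} E {..<m} ?\<delta> c (p, ()) (p', ()) else 0)"
      by (simp add: mat_corr_zero_snd)
  qed
  show "\<forall>x x' y y'. (\<Sum>a\<in>UNIV. \<Sum>b\<in>UNIV. ?T ((x, a), (y, b)) ((x', a), (y', b))) = (if x = x' \<and> y = y' then 1 else 0)"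
  proof (intro allI)
    fix x x' y y'
    have "(\<Sum>a\<in>UNIV. \<Sum>b\<in>UNIV. ?T ((x, a), (y, b)) ((x', a), (y', b)))
       = mat_corr {..<k} (\<lambda>_ _ i j. if x = x' \<and> i = j then 1 else 0) {..<m} (\<lambda>_ _ i j. if y = y' \<and> i = j then 1 else 0) c ((), ()) ((), ())"
      unfolding sum_mat_corr_snd sum_mat_corr_fst using E(2) F(2) by (intro mat_corr_cong) auto
    also have "\<dots> = (if x = x' \<and> y = y' then 1 else 0)"
      using c by (intro mat_corr_delta) auto
    finally show "(\<Sum>a\<in>UNIV. \<Sum>b\<in>UNIV. ?T ((x, a), (y, b)) ((x', a), (y', b))) = (if x = x' \<and> y = y' then 1 else 0)" .
  qed
qed

lemma psd_on_reindex:
  assumes "inj_on h P" "psd_on (h ` P) M"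
  shows "psd_on P (\<lambda>p q. M (h p) (h q))"
  unfolding psd_on_def
proof
  fix c
  have "(\<Sum>p\<in>h ` P. \<Sum>q\<in>h ` P. cnj (c (inv_into P h p)) * M p q * c (inv_into P h q)) \<in> \<real>\<^sub>\<ge>\<^sub>0"
    by (rule psd_onD[OF assms(2), of "\<lambda>p. c (inv_into P h p)"])
  then show "(\<Sum>p\<in>P. \<Sum>q\<in>P. cnj (c p) * M (h p) (h q) * c q) \<in> \<real>\<^sub>\<ge>\<^sub>0"
    using assms(1) by (simp add: sum.reindex)
qed

text \<open>The bistochastic conditions are symmetric under exchanging the two indices in each block index
\<open>(x, a)\<close>, and this exchange turns the Choi matrix into that of the dual map.\<close>

lemma QNS_bicorrelation_mat_corr:
  fixes E :: "('x::finite \<times> 'x) \<Rightarrow> _" and F :: "('y::finite \<times> 'y) \<Rightarrow> _"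
  assumes E: "bistoch_mat k E" and F: "bistoch_mat m F" and c: "unit_vec ({..<k} \<times> {..<m}) c"
  shows "QNS_bicorrelation (chan (mat_corr {..<k} E {..<m} F c))"
proof (rule QNS_bicorrelation_chan)
  show "corr_tensor (mat_corr {..<k} E {..<m} F c)"
    using assms by (intro corr_tensor_mat_corr) (auto simp: bistoch_mat_def)
  have psd: "psd_on (UNIV \<times> {..<k}) (\<lambda>z w. E (prod.swap (fst z)) (prod.swap (fst w)) (snd z) (snd w))"
    if "psd_on (UNIV \<times> {..<k}) (\<lambda>z w. E (fst z) (fst w) (snd z) (snd w))" for E :: "('c::finite \<times> 'c) \<Rightarrow> _" and k :: nat
  proof -
    let ?h = "\<lambda>z :: ('c \<times> 'c) \<times> nat. (prod.swap (fst z), snd z)"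
    have "?h ` (UNIV \<times> {..<k}) = UNIV \<times> {..<k}"
      by (auto simp: image_iff split_paired_all) 
    moreover have "inj_on ?h (UNIV \<times> {..<k})" by (auto simp: inj_on_def)
    ultimately show ?thesis using psd_on_reindex[of ?h "UNIV \<times> {..<k}"] that by fastforce
  qed
  have "flip_tensor (mat_corr {..<k} E {..<m} F c) =
     mat_corr {..<k} (\<lambda>p q. E (prod.swap p) (prod.swap q)) {..<m} (\<lambda>p q. F (prod.swap p) (prod.swap q)) c"
    by (auto simp: fun_eq_iff flip_tensor_def mat_corr_def)
  moreover have "corr_tensor \<dots>"
    using assms psd[of k E] psd[of m F] by (intro corr_tensor_mat_corr) (auto simp: bistoch_mat_def)
  ultimately show "corr_tensor (flip_tensor (mat_corr {..<k} E {..<m} F c))" by simp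
qed

lemma sum_lessThan_add:
  fixes f :: "nat \<Rightarrow> complex"
  shows "(\<Sum>i<k + k'. f i) = (\<Sum>i<k. f i) + (\<Sum>i<k'. f (k + i))"
  by (induction k') (auto simp: add.assoc)

lemma sum_block_diagonal:
  fixes f :: "nat \<times> nat \<Rightarrow> complex"
  assumes "\<And>i j. i < k \<Longrightarrow> m \<le> j \<Longrightarrow> f (i, j) = 0" "\<And>i j. k \<le> i \<Longrightarrow> j < m \<Longrightarrow> f (i, j) = 0"
  shows "(\<Sum>z\<in>{..<k + k'} \<times> {..<m + m'}. f z)
    = (\<Sum>z\<in>{..<k} \<times> {..<m}. f z) + (\<Sum>z\<in>{..<k'} \<times> {..<m'}. f (k + fst z, m + snd z))"
  using assms by (simp add: sum.cartesian_product' sum_lessThan_add sum.distrib)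

definition direct_sum_mat :: "nat \<Rightarrow> ('p \<Rightarrow> 'p \<Rightarrow> nat \<Rightarrow> nat \<Rightarrow> complex) \<Rightarrow> ('p \<Rightarrow> 'p \<Rightarrow> nat \<Rightarrow> nat \<Rightarrow> complex) \<Rightarrow>
    'p \<Rightarrow> 'p \<Rightarrow> nat \<Rightarrow> nat \<Rightarrow> complex" where
  "direct_sum_mat k E E' p q i j =
     (if i < k \<and> j < k then E p q i j else if k \<le> i \<and> k \<le> j then E' p q (i - k) (j - k) else 0)"

lemma sum_direct_sum_mat:
  "(\<Sum>a\<in>A. direct_sum_mat k E E' (p a) (q a) i j) =
     direct_sum_mat k (\<lambda>_ _ i j. \<Sum>a\<in>A. E (p a) (q a) i j) (\<lambda>_ _ i j. \<Sum>a\<in>A. E' (p a) (q a) i j) () () i j"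
  by (cases "i < k"; cases "j < k") (simp_all add: direct_sum_mat_def not_less)

lemma bistoch_direct_sum:
  assumes E: "bistoch_mat k E" and E': "bistoch_mat k' E'"
  shows "bistoch_mat (k + k') (direct_sum_mat k E E')"
proof -
  let ?P = "(UNIV :: ('a \<times> 'a) set) \<times> {..<k}" and ?P' = "(UNIV :: ('a \<times> 'a) set) \<times> {..<k'}"
  obtain g :: "('a \<times> 'a) \<times> nat \<Rightarrow> _" where g0: "\<forall>z\<in>?P. \<forall>w\<in>?P. E (fst z) (fst w) (snd z) (snd w) = (\<Sum>r\<in>?P. cnj (g r z) * g r w)"
    using psd_on_imp_gram[of ?P "\<lambda>z w. E (fst z) (fst w) (snd z) (snd w)"] E by (auto simp: bistoch_mat_def)
  obtain h :: "('a \<times> 'a) \<times> nat \<Rightarrow> _" where h0: "\<forall>z\<in>?P'. \<forall>w\<in>?P'. E' (fst z) (fst w) (snd z) (snd w) = (\<Sum>r\<in>?P'. cnj (h r z) * h r w)"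
    using psd_on_imp_gram[of ?P' "\<lambda>z w. E' (fst z) (fst w) (snd z) (snd w)"] E' by (auto simp: bistoch_mat_def)
  define G where "G r z = (case r of Inl s \<Rightarrow> (if snd z < k then g s z else 0)
     | Inr s \<Rightarrow> (if snd z < k then 0 else h s (fst z, snd z - k)))" for r and z :: "('a \<times> 'a) \<times> nat"
  have "direct_sum_mat k E E' (fst z) (fst w) (snd z) (snd w) = (\<Sum>r\<in>?P <+> ?P'. cnj (G r z) * G r w)"
    if "z \<in> UNIV \<times> {..<k + k'}" "w \<in> UNIV \<times> {..<k + k'}" for z w
  proof -
    have s: "(\<Sum>r\<in>?P <+> ?P'. cnj (G r z) * G r w) = (\<Sum>r\<in>?P. cnj (G (Inl r) z) * G (Inl r) w) + (\<Sum>r\<in>?P'. cnj (G (Inr r) z) * G (Inr r) w)"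
      by (subst sum.Plus) auto
    consider "snd z < k" "snd w < k" | "snd z < k" "\<not> snd w < k" | "\<not> snd z < k" "snd w < k" | "\<not> snd z < k" "\<not> snd w < k" by blast
    then show ?thesis
    proof cases
      case 1
      then have "z \<in> ?P" "w \<in> ?P" by (auto simp: mem_Times_iff)
      then have "E (fst z) (fst w) (snd z) (snd w) = (\<Sum>r\<in>?P. cnj (g r z) * g r w)"
        using g0 by blast
      then show ?thesis using 1 unfolding s by (simp add: direct_sum_mat_def G_def)
    next
      case 4
      let ?z = "(fst z, snd z - k)" and ?w = "(fst w, snd w - k)"
      have "?z \<in> ?P'" "?w \<in> ?P'" using 4 that by auto
      then have "E' (fst ?z) (fst ?w) (snd ?z) (snd ?w) = (\<Sum>r\<in>?P'. cnj (h r ?z) * h r ?w)"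
        using h0 by blast
      then show ?thesis using 4 unfolding s by (simp add: direct_sum_mat_def G_def)
    qed (unfold s, simp_all add: direct_sum_mat_def G_def)
  qed
  then have "psd_on (UNIV \<times> {..<k + k'}) (\<lambda>z w. direct_sum_mat k E E' (fst z) (fst w) (snd z) (snd w))
     = psd_on (UNIV \<times> {..<k + k'}) (\<lambda>z w. \<Sum>r\<in>?P <+> ?P'. cnj (G r z) * G r w)"
    by (intro psd_on_cong)
  then have "psd_on (UNIV \<times> {..<k + k'}) (\<lambda>z w. direct_sum_mat k E E' (fst z) (fst w) (snd z) (snd w))"
    using psd_on_gram by simp
  then show ?thesis
    using E E' unfolding bistoch_mat_def sum_direct_sum_mat by (auto simp: direct_sum_mat_def)
qed

text \<open>The vector \<open>d\<close> has no components in the mixed summands \<open>\<complex>\<^sup>k \<otimes> \<complex>\<^bsup>m'\<^esup>\<close> and \<open>\<complex>\<^bsup>k'\<^esup> \<otimes> \<complex>\<^sup>m\<close>, and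
block diagonal operators do not connect the two others. So the correlations just add up, with the
squares of the weights.\<close>

lemma mat_corr_direct_sum:
  fixes E :: "'p \<Rightarrow> 'p \<Rightarrow> nat \<Rightarrow> nat \<Rightarrow> complex" and F :: "'q \<Rightarrow> 'q \<Rightarrow> nat \<Rightarrow> nat \<Rightarrow> complex"
  fixes c c' :: "nat \<times> nat \<Rightarrow> complex" and k k' m m' :: nat and \<alpha> \<beta> :: complex
  defines "d \<equiv> \<lambda>z. if fst z < k \<and> snd z < m then \<alpha> * c z
    else if k \<le> fst z \<and> m \<le> snd z then \<beta> * c' (fst z - k, snd z - m) else 0"
  shows "mat_corr {..<k + k'} (direct_sum_mat k E E') {..<m + m'} (direct_sum_mat m F F') d p q
    = cnj \<alpha> * \<alpha> * mat_corr {..<k} E {..<m} F c p q + cnj \<beta> * \<beta> * mat_corr {..<k'} E' {..<m'} F' c' p q" (is ?A)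
    and "(\<Sum>z\<in>{..<k + k'} \<times> {..<m + m'}. cnj (d z) * d z)
    = cnj \<alpha> * \<alpha> * (\<Sum>z\<in>{..<k} \<times> {..<m}. cnj (c z) * c z) + cnj \<beta> * \<beta> * (\<Sum>z\<in>{..<k'} \<times> {..<m'}. cnj (c' z) * c' z)" (is ?B)
proof -
  have d0: "d (i, j) = 0" if "i < k" "m \<le> j" for i j using that by (auto simp: d_def)
  have d0': "d (i, j) = 0" if "k \<le> i" "j < m" for i j using that by (auto simp: d_def)
  have d1: "d z = \<alpha> * c z" if "z \<in> {..<k} \<times> {..<m}" for z using that by (auto simp: d_def)
  have d2: "d (k + i, m + j) = \<beta> * c' (i, j)" for i j by (auto simp: d_def)
  show ?B
    by (subst sum_block_diagonal) (auto simp: d0 d0' d1 d2 sum_distrib_left mult_ac intro!: sum.cong arg_cong2[where f = "(+)"])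
  let ?E = "direct_sum_mat k E E'" and ?F = "direct_sum_mat m F F'"
  let ?t = "\<lambda>z w. cnj (d z) * (?E (fst p) (fst q) (fst z) (fst w) * ?F (snd p) (snd q) (snd z) (snd w)) * d w"
  have in1: "(\<Sum>w\<in>{..<k + k'} \<times> {..<m + m'}. ?t z w)
    = (\<Sum>w\<in>{..<k} \<times> {..<m}. ?t z w) + (\<Sum>w\<in>{..<k'} \<times> {..<m'}. ?t z (k + fst w, m + snd w))" for z
    by (rule sum_block_diagonal) (auto simp: d0 d0')
  have "mat_corr {..<k + k'} ?E {..<m + m'} ?F d p q
     = (\<Sum>z\<in>{..<k} \<times> {..<m}. (\<Sum>w\<in>{..<k} \<times> {..<m}. ?t z w) + (\<Sum>w\<in>{..<k'} \<times> {..<m'}. ?t z (k + fst w, m + snd w)))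
     + (\<Sum>z\<in>{..<k'} \<times> {..<m'}. (\<Sum>w\<in>{..<k} \<times> {..<m}. ?t (k + fst z, m + snd z) w)
         + (\<Sum>w\<in>{..<k'} \<times> {..<m'}. ?t (k + fst z, m + snd z) (k + fst w, m + snd w)))"
    unfolding mat_corr_def in1 by (rule sum_block_diagonal) (auto simp: d0 d0')
  also have "\<dots> = (\<Sum>z\<in>{..<k} \<times> {..<m}. \<Sum>w\<in>{..<k} \<times> {..<m}. cnj \<alpha> * \<alpha> * (cnj (c z) * (E (fst p) (fst q) (fst z) (fst w) * F (snd p) (snd q) (snd z) (snd w)) * c w))
     + (\<Sum>z\<in>{..<k'} \<times> {..<m'}. \<Sum>w\<in>{..<k'} \<times> {..<m'}. cnj \<beta> * \<beta> * (cnj (c' z) * (E' (fst p) (fst q) (fst z) (fst w) * F' (snd p) (snd q) (snd z) (snd w)) * c' w))"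
  proof -
    have "?t z w = cnj \<alpha> * \<alpha> * (cnj (c z) * (E (fst p) (fst q) (fst z) (fst w) * F (snd p) (snd q) (snd z) (snd w)) * c w)"
      if "z \<in> {..<k} \<times> {..<m}" "w \<in> {..<k} \<times> {..<m}" for z w
      using that by (auto simp: d1 direct_sum_mat_def)
    moreover have "(\<Sum>w\<in>{..<k'} \<times> {..<m'}. ?t z (k + fst w, m + snd w)) = 0" if "z \<in> {..<k} \<times> {..<m}" for z
      using that by (intro sum.neutral) (auto simp: direct_sum_mat_def)
    moreover have "(\<Sum>w\<in>{..<k} \<times> {..<m}. ?t (k + fst z, m + snd z) w) = 0" for z
      by (intro sum.neutral) (auto simp: direct_sum_mat_def)
    moreover have "?t (k + fst z, m + snd z) (k + fst w, m + snd w) = cnj \<beta> * \<beta> * (cnj (c' z) * (E' (fst p) (fst q) (fst z) (fst w) * F' (snd p) (snd q) (snd z) (snd w)) * c' w)" for z w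
      by (simp add: d2 direct_sum_mat_def)
    ultimately show ?thesis by (intro arg_cong2[where f = "(+)"] sum.cong refl) (simp_all only: add_0_right add_0_left cong: sum.cong)
  qed
  also have "\<dots> = cnj \<alpha> * \<alpha> * mat_corr {..<k} E {..<m} F c p q + cnj \<beta> * \<beta> * mat_corr {..<k'} E' {..<m'} F' c' p q"
    unfolding mat_corr_def by (simp only: sum_distrib_left)
  finally show ?A .
qed

definition quantum_points :: "(complex ^ (('x::finite \<times> 'x) \<times> ('y::finite \<times> 'y)) ^ (('x \<times> 'x) \<times> ('y \<times> 'y))) set" where
  "quantum_points = {(\<chi> p q. mat_corr {..<k} E {..<m} F c p q) | k E m F c.
     bistoch_mat k E \<and> bistoch_mat m F \<and> unit_vec ({..<k} \<times> {..<m}) c}"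

lemma convex_quantum_points: "convex quantum_points"
proof (rule convexI)
  fix S T :: "complex ^ (('x::finite \<times> 'x) \<times> ('y::finite \<times> 'y)) ^ (('x \<times> 'x) \<times> ('y \<times> 'y))" and u v :: real
  assume S: "S \<in> quantum_points" and T: "T \<in> quantum_points" and uv: "0 \<le> u" "0 \<le> v" "u + v = 1"
  obtain k E m F c where 1: "S = (\<chi> p q. mat_corr {..<k} E {..<m} F c p q)"
      "bistoch_mat k E" "bistoch_mat m F" "unit_vec ({..<k} \<times> {..<m}) c"
    using S unfolding quantum_points_def by blast
  obtain k' E' m' F' c' where 2: "T = (\<chi> p q. mat_corr {..<k'} E' {..<m'} F' c' p q)"
      "bistoch_mat k' E'" "bistoch_mat m' F'" "unit_vec ({..<k'} \<times> {..<m'}) c'"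
    using T unfolding quantum_points_def by blast
  \<comment> \<open>The weights enter quadratically, hence the square roots.\<close>
  let ?\<alpha> = "complex_of_real (sqrt u)" and ?\<beta> = "complex_of_real (sqrt v)"
  define d where "d = (\<lambda>z. if fst z < k \<and> snd z < m then ?\<alpha> * c z
    else if k \<le> fst z \<and> m \<le> snd z then ?\<beta> * c' (fst z - k, snd z - m) else 0)"
  have ab: "cnj ?\<alpha> * ?\<alpha> = of_real u" "cnj ?\<beta> * ?\<beta> = of_real v"
    using uv by (simp_all flip: of_real_mult)
  note ds = mat_corr_direct_sum[where \<alpha> = ?\<alpha> and \<beta> = ?\<beta> and k = k and m = m and c = c and c' = c', folded d_def, unfolded ab]
  have ds2: "(\<Sum>z\<in>{..<k + k'} \<times> {..<m + m'}. cnj (d z) * d z) = of_real u * (\<Sum>z\<in>{..<k} \<times> {..<m}. cnj (c z) * c z)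
      + of_real v * (\<Sum>z\<in>{..<k'} \<times> {..<m'}. cnj (c' z) * c' z)"
    using ds(2)[where k' = k' and m' = m'] unfolding d_def .
  have "u *\<^sub>R S + v *\<^sub>R T = (\<chi> p q. mat_corr {..<k + k'} (direct_sum_mat k E E') {..<m + m'} (direct_sum_mat m F F') d p q)"
    unfolding 1(1) 2(1) ds by (simp add: vec_eq_iff scaleR_conv_of_real[where 'a = complex])
  moreover have "unit_vec ({..<k + k'} \<times> {..<m + m'}) d"
    using 1(4) 2(4) uv unfolding unit_vec_def ds2 by (simp flip: of_real_add)
  ultimately show "u *\<^sub>R S + v *\<^sub>R T \<in> quantum_points"
    using bistoch_direct_sum[OF 1(2) 2(2)] bistoch_direct_sum[OF 1(3) 2(3)]
    unfolding quantum_points_def by blast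
qed

section \<open>The Hilbert spaces of square summable families\<close>

definition ket :: "'i \<Rightarrow> 'i \<Rightarrow> complex" where
  "ket i = (\<lambda>j. if j = i then 1 else 0)"

definition cut :: "'i set \<Rightarrow> ('i \<Rightarrow> complex) \<Rightarrow> 'i \<Rightarrow> complex" where
  "cut F f = (\<lambda>i. if i \<in> F then f i else 0)"

lemma sum_fun_eval: "sum f A i = (\<Sum>a\<in>A. f a i)"
  by (induction A rule: infinite_finite_induct) (auto simp: zero_fun_def)

lemma ell2_outside: "f \<in> ell2 I \<Longrightarrow> i \<notin> I \<Longrightarrow> f i = 0"
  by (simp add: ell2_def)

lemma ell2_summable: "f \<in> ell2 I \<Longrightarrow> (\<lambda>i. (cmod (f i))\<^sup>2) summable_on UNIV"
  by (simp add: ell2_def)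

lemma ell2_0 [simp]: "0 \<in> ell2 I" "(\<lambda>_. 0) \<in> ell2 I"
  by (simp_all add: ell2_def zero_fun_def)

lemma ell2_scale: "f \<in> ell2 I \<Longrightarrow> (\<lambda>i. c * f i) \<in> ell2 I"
  by (auto simp: ell2_def norm_mult power_mult_distrib intro!: summable_on_cmult_right)

lemma ell2_add: assumes "f \<in> ell2 I" "g \<in> ell2 I" shows "f + g \<in> ell2 I"
proof -
  have "(\<lambda>i. 2 * ((cmod (f i))\<^sup>2 + (cmod (g i))\<^sup>2)) summable_on UNIV"
    using assms by (intro summable_on_cmult_right summable_on_add ell2_summable)
  moreover have "(cmod (f i + g i))\<^sup>2 \<le> 2 * ((cmod (f i))\<^sup>2 + (cmod (g i))\<^sup>2)" for i
  proof -
    have "(cmod (f i + g i))\<^sup>2 \<le> (cmod (f i) + cmod (g i))\<^sup>2"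
      by (intro power_mono norm_triangle_ineq) auto
    also have "\<dots> \<le> 2 * ((cmod (f i))\<^sup>2 + (cmod (g i))\<^sup>2)"
      using sum_squares_bound[of "cmod (f i)" "cmod (g i)"] by (simp add: power2_sum)
    finally show ?thesis .
  qed
  ultimately have "(\<lambda>i. (cmod (f i + g i))\<^sup>2) summable_on UNIV"
    by (rule summable_on_comparison_test) auto
  then show ?thesis using assms by (auto simp: ell2_def)
qed

lemma ell2_diff: "f \<in> ell2 I \<Longrightarrow> g \<in> ell2 I \<Longrightarrow> f - g \<in> ell2 I"
  using ell2_add[of f I "\<lambda>i. -1 * g i"] ell2_scale[of g I "-1"] by (simp add: fun_diff_def plus_fun_def)

lemma ell2_sum: "(\<And>a. a \<in> A \<Longrightarrow> f a \<in> ell2 I) \<Longrightarrow> sum f A \<in> ell2 I"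
  by (induction A rule: infinite_finite_induct) (auto intro: ell2_add)

lemma ell2_mono: "I \<subseteq> J \<Longrightarrow> f \<in> ell2 I \<Longrightarrow> f \<in> ell2 J"
  by (auto simp: ell2_def)

lemma ell2_finite_support:
  assumes "finite F" "F \<subseteq> I" "\<And>i. i \<notin> F \<Longrightarrow> f i = 0"
  shows "f \<in> ell2 I"
proof -
  have "(\<lambda>i. (cmod (f i))\<^sup>2) summable_on UNIV"
    using assms by (intro finite_nonzero_values_imp_summable_on) (auto elim!: finite_subset[rotated])
  then show ?thesis using assms by (auto simp: ell2_def)
qed

lemma ket_in_ell2: "i \<in> I \<Longrightarrow> ket i \<in> ell2 I"
  by (rule ell2_finite_support[of "{i}"]) (auto simp: ket_def)

lemma cut_in_ell2: "f \<in> ell2 I \<Longrightarrow> finite F \<Longrightarrow> cut F f \<in> ell2 I"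
  by (rule ell2_finite_support[of "F \<inter> I"]) (auto simp: cut_def ell2_outside)

lemma inner2_summable:
  assumes "f \<in> ell2 I" "g \<in> ell2 J"
  shows "(\<lambda>i. f i * cnj (g i)) summable_on UNIV"
proof -
  have "(\<lambda>i. (cmod (f i))\<^sup>2 + (cmod (g i))\<^sup>2) summable_on UNIV"
    using assms by (intro summable_on_add ell2_summable)
  moreover have "norm (f i * cnj (g i)) \<le> (cmod (f i))\<^sup>2 + (cmod (g i))\<^sup>2" for i
    using sum_squares_bound[of "cmod (f i)" "cmod (g i)"]
      mult_nonneg_nonneg[OF norm_ge_zero norm_ge_zero, of "f i" "g i"]
    unfolding norm_mult complex_mod_cnj by linarith
  ultimately have "(\<lambda>i. norm (f i * cnj (g i))) summable_on UNIV"
    by (rule summable_on_comparison_test) auto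
  then show ?thesis by (rule abs_summable_summable)
qed

lemma inner2_add_left:
  "f \<in> ell2 I \<Longrightarrow> f' \<in> ell2 I \<Longrightarrow> g \<in> ell2 J \<Longrightarrow> inner2 (f + f') g = inner2 f g + inner2 f' g"
  unfolding inner2_def by (simp add: distrib_right infsum_add inner2_summable)

lemma inner2_scale_left: "inner2 (\<lambda>i. c * f i) g = c * inner2 f g"
  unfolding inner2_def by (simp add: mult.assoc infsum_cmult_right')

lemma inner2_commute: "inner2 g f = cnj (inner2 f g)"
  unfolding inner2_def by (simp add: mult.commute flip: infsum_cnj)

lemma inner2_add_right:
  "f \<in> ell2 I \<Longrightarrow> f' \<in> ell2 I \<Longrightarrow> g \<in> ell2 J \<Longrightarrow> inner2 g (f + f') = inner2 g f + inner2 g f'"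
  by (simp add: inner2_commute[of g] inner2_add_left)

lemma inner2_scale_right: "inner2 g (\<lambda>i. c * f i) = cnj c * inner2 g f"
  by (simp add: inner2_commute[of g] inner2_scale_left)

lemma inner2_0 [simp]: "inner2 0 g = 0" "inner2 g 0 = 0" "inner2 (\<lambda>_. 0) g = 0" "inner2 g (\<lambda>_. 0) = 0"
  by (simp_all add: inner2_def)

lemma inner2_sum_left:
  assumes "\<And>a. a \<in> A \<Longrightarrow> f a \<in> ell2 I" "g \<in> ell2 J"
  shows "inner2 (sum f A) g = (\<Sum>a\<in>A. inner2 (f a) g)"
  using assms by (induction A rule: infinite_finite_induct) (auto simp: inner2_add_left[where I = I and J = J] ell2_sum)

lemma inner2_sum_right:
  assumes "\<And>a. a \<in> A \<Longrightarrow> f a \<in> ell2 I" "g \<in> ell2 J"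
  shows "inner2 g (sum f A) = (\<Sum>a\<in>A. inner2 g (f a))"
  using assms by (simp add: inner2_commute[of g] inner2_sum_left[where I = I and J = J])

lemma inner2_diff_left:
  assumes "f \<in> ell2 I" "f' \<in> ell2 I" "g \<in> ell2 J"
  shows "inner2 (f - f') g = inner2 f g - inner2 f' g"
  using inner2_add_left[OF ell2_diff[OF assms(1,2)] assms(2,3)] by (simp add: algebra_simps)

lemma inner2_diff_right:
  assumes "f \<in> ell2 I" "f' \<in> ell2 I" "g \<in> ell2 J"
  shows "inner2 g (f - f') = inner2 g f - inner2 g f'"
  using assms by (simp add: inner2_commute[of g] inner2_diff_left)

lemma norm2_nonneg [simp]: "norm2 f \<ge> 0"
  unfolding norm2_def by (simp add: infsum_nonneg)

lemma norm2_square: "(norm2 f)\<^sup>2 = (\<Sum>\<^sub>\<infinity>i. (cmod (f i))\<^sup>2)"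
  unfolding norm2_def by (simp add: infsum_nonneg)

lemma inner2_self:
  shows "inner2 f f = of_real ((norm2 f)\<^sup>2)"
proof -
  have "inner2 f f = (\<Sum>\<^sub>\<infinity>i. of_real ((cmod (f i))\<^sup>2))"
    unfolding inner2_def by (simp only: complex_norm_square)
  also have "\<dots> = of_real (\<Sum>\<^sub>\<infinity>i. (cmod (f i))\<^sup>2)"
  proof (cases "(\<lambda>i. (cmod (f i))\<^sup>2) summable_on UNIV")
    case True
    then show ?thesis by (intro infsumI has_sum_of_real has_sum_infsum)
  next
    case False
    then have "\<not> (\<lambda>i. complex_of_real ((cmod (f i))\<^sup>2)) summable_on UNIV"
      using summable_on_Re[of "\<lambda>i. complex_of_real ((cmod (f i))\<^sup>2)" UNIV] by auto
    with False show ?thesis by (simp add: infsum_not_exists)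
  qed
  finally show ?thesis by (simp add: norm2_square)
qed

lemma norm2_0 [simp]: "norm2 0 = 0" "norm2 (\<lambda>_. 0) = 0"
  by (simp_all add: norm2_def)

lemma cmod_le_norm2: 
  assumes "f \<in> ell2 I"
  shows "cmod (f i) \<le> norm2 f"
proof -
  have "(\<Sum>i\<in>{i}. (cmod (f i))\<^sup>2) \<le> (\<Sum>\<^sub>\<infinity>i. (cmod (f i))\<^sup>2)"
    using assms by (intro finite_sum_le_infsum ell2_summable) auto
  then have "(cmod (f i))\<^sup>2 \<le> (norm2 f)\<^sup>2" by (simp add: norm2_square)
  then show ?thesis by (rule power2_le_imp_le) simp
qed

lemma norm2_eq_0: "f \<in> ell2 I \<Longrightarrow> norm2 f = 0 \<Longrightarrow> f = 0"
  using cmod_le_norm2[of f I] by (auto simp: fun_eq_iff)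

lemma norm2_scale: "norm2 (\<lambda>i. c * f i) = cmod c * norm2 f"
  unfolding norm2_def by (simp add: norm_mult power_mult_distrib infsum_cmult_right' real_sqrt_mult)

text \<open>The squared norm of \<open>f\<close> minus its projection to \<open>g\<close> is nonnegative.\<close>

lemma Cauchy_Schwarz2:
  assumes f: "f \<in> ell2 I" and g: "g \<in> ell2 J"
  shows "cmod (inner2 f g) \<le> norm2 f * norm2 g"
proof (cases "norm2 g = 0")
  case True
  then show ?thesis using norm2_eq_0[OF g] by simp
next
  case False
  have f': "f \<in> ell2 UNIV" and g': "g \<in> ell2 UNIV" using f g ell2_mono by blast+
  let ?z = "inner2 f g" and ?n = "(norm2 g)\<^sup>2"
  let ?t = "?z / of_real ?n"
  let ?h = "\<lambda>i. ?t * g i"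
  have h: "?h \<in> ell2 UNIV" using g' by (rule ell2_scale)
  have n: "?n > 0" using False by simp
  have "of_real ((norm2 (f - ?h))\<^sup>2) = inner2 (f - ?h) (f - ?h)"
    by (rule inner2_self[symmetric])
  also have "\<dots> = inner2 f f - inner2 f ?h - (inner2 ?h f - inner2 ?h ?h)"
    unfolding inner2_diff_left[OF f' h ell2_diff[OF f' h]]
      inner2_diff_right[OF f' h f'] inner2_diff_right[OF f' h h] ..
  also have "inner2 f ?h = cnj ?t * ?z" by (rule inner2_scale_right)
  also have "inner2 ?h f = ?t * cnj ?z" unfolding inner2_scale_left by (simp add: inner2_commute[of g f])
  also have "inner2 ?h ?h = ?t * (cnj ?t * of_real ?n)"
    unfolding inner2_scale_left inner2_scale_right inner2_self ..
  also have "inner2 f f - cnj ?t * ?z - (?t * cnj ?z - ?t * (cnj ?t * of_real ?n))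
     = of_real ((norm2 f)\<^sup>2 - (cmod ?z)\<^sup>2 / ?n)"
    using n complex_norm_square[of ?z] by (simp add: inner2_self field_simps)
  finally have "(norm2 (f - ?h))\<^sup>2 = (norm2 f)\<^sup>2 - (cmod ?z)\<^sup>2 / ?n" 
    by (simp only: of_real_eq_iff)
  then have "(cmod ?z)\<^sup>2 / ?n \<le> (norm2 f)\<^sup>2" by (smt (verit) zero_le_power2)
  then have "(cmod ?z)\<^sup>2 \<le> (norm2 f * norm2 g)\<^sup>2"
    using n by (simp add: field_simps power_mult_distrib)
  then show ?thesis by (rule power2_le_imp_le) simp
qed

lemma norm2_triangle:
  assumes f: "f \<in> ell2 I" and g: "g \<in> ell2 I"
  shows "norm2 (f + g) \<le> norm2 f + norm2 g"
proof -
  have "of_real ((norm2 (f + g))\<^sup>2) = inner2 f f + inner2 g g + (inner2 f g + cnj (inner2 f g))"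
    unfolding inner2_self[symmetric] inner2_add_left[OF f g ell2_add[OF f g]]
      inner2_add_right[OF f g f] inner2_add_right[OF f g g]
    by (simp add: inner2_commute[of g f])
  also have "\<dots> = of_real ((norm2 f)\<^sup>2 + (norm2 g)\<^sup>2 + 2 * Re (inner2 f g))"
    unfolding complex_add_cnj inner2_self by simp
  finally have "(norm2 (f + g))\<^sup>2 = (norm2 f)\<^sup>2 + (norm2 g)\<^sup>2 + 2 * Re (inner2 f g)"
    by (simp only: of_real_eq_iff)
  also have "\<dots> \<le> (norm2 f + norm2 g)\<^sup>2"
    using complex_Re_le_cmod[of "inner2 f g"] Cauchy_Schwarz2[OF f g] by (simp add: power2_sum)
  finally show ?thesis by (rule power2_le_imp_le) simp
qed

lemma inner2_ket_right: "inner2 f (ket i) = f i"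
proof -
  have "inner2 f (ket i) = (\<Sum>\<^sub>\<infinity>j\<in>{i}. f j * cnj (ket i j))"
    unfolding inner2_def by (intro infsum_cong_neutral) (auto simp: ket_def)
  then show ?thesis by (simp add: ket_def)
qed

lemma inner2_ket_left: "inner2 (ket i) f = cnj (f i)"
  by (simp add: inner2_commute[of "ket i"] inner2_ket_right)

lemma norm2_ket [simp]: "norm2 (ket i) = 1"
proof -
  have "of_real ((norm2 (ket i))\<^sup>2) = (1::complex)"
    unfolding inner2_self[symmetric] inner2_ket_right by (simp add: ket_def)
  then have "(norm2 (ket i))\<^sup>2 = 1" by (metis of_real_eq_1_iff)
  then show ?thesis using norm2_nonneg[of "ket i"] by (simp add: power2_eq_1_iff)
qed

lemma cut_eq_sum: "finite F \<Longrightarrow> cut F f = (\<Sum>i\<in>F. (\<lambda>j. f i * ket i j))"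
  by (auto simp: fun_eq_iff sum_fun_eval cut_def ket_def if_distrib cong: if_cong)

lemma cut_finite: "f \<in> ell2 I \<Longrightarrow> cut I f = f"
  by (auto simp: cut_def ell2_outside fun_eq_iff)

lemma norm2_cut: "finite F \<Longrightarrow> (norm2 (cut F f))\<^sup>2 = (\<Sum>i\<in>F. (cmod (f i))\<^sup>2)"
proof -
  assume "finite F"
  have "(norm2 (cut F f))\<^sup>2 = (\<Sum>\<^sub>\<infinity>i\<in>F. (cmod (f i))\<^sup>2)"
    unfolding norm2_square by (intro infsum_cong_neutral) (auto simp: cut_def)
  then show ?thesis using \<open>finite F\<close> by simp
qed

lemma inner2_finite:
  assumes "finite I" "f \<in> ell2 I"
  shows "inner2 f g = (\<Sum>i\<in>I. f i * cnj (g i))"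
proof -
  have "inner2 f g = (\<Sum>\<^sub>\<infinity>i\<in>I. f i * cnj (g i))"
    unfolding inner2_def using assms by (intro infsum_cong_neutral) (auto simp: ell2_outside)
  then show ?thesis using assms by simp
qed

text \<open>The tail \<open>f - cut F f\<close> and \<open>cut F f\<close> have disjoint supports, so their squared norms add up to that
of \<open>f\<close>.\<close>

lemma cut_approx:
  assumes f: "f \<in> ell2 I" and "\<epsilon> > 0"
  obtains F where "finite F" "F \<subseteq> I" "norm2 (f - cut F f) < \<epsilon>"
proof -
  let ?T = "\<Sum>\<^sub>\<infinity>i. (cmod (f i))\<^sup>2"
  obtain F where F: "finite F" "dist (\<Sum>i\<in>F. (cmod (f i))\<^sup>2) ?T \<le> \<epsilon>\<^sup>2 / 2"
    using infsum_finite_approximation[OF ell2_summable[OF f], of "\<epsilon>\<^sup>2 / 2"] assms by auto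
  let ?F = "F \<inter> I"
  have fin: "finite ?F" using F by simp
  have c: "cut ?F f \<in> ell2 I" using f fin by (rule cut_in_ell2)
  have s: "(\<Sum>i\<in>?F. (cmod (f i))\<^sup>2) = (\<Sum>i\<in>F. (cmod (f i))\<^sup>2)"
    using F f by (intro sum.mono_neutral_left) (auto simp: ell2_outside)
  have "?T = (\<Sum>\<^sub>\<infinity>i. (cmod ((f - cut ?F f) i))\<^sup>2 + (cmod (cut ?F f i))\<^sup>2)"
    by (intro infsum_cong) (auto simp: cut_def)
  also have "\<dots> = (norm2 (f - cut ?F f))\<^sup>2 + (norm2 (cut ?F f))\<^sup>2"
    unfolding norm2_square using f c by (intro infsum_add ell2_summable ell2_diff)
  finally have "(norm2 (f - cut ?F f))\<^sup>2 \<le> \<epsilon>\<^sup>2 / 2"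
    using F s norm2_cut[OF fin, of f] by (auto simp: dist_real_def)
  also have "\<dots> < \<epsilon>\<^sup>2" using assms by simp
  finally have "norm2 (f - cut ?F f) < \<epsilon>"
    by (rule power2_less_imp_less) (use assms in simp)
  then show ?thesis using that fin by blast
qed

text \<open>Finite combinations of basis vectors are dense.\<close>

lemma bounded_functional_zero:
  assumes add: "\<And>f g. f \<in> ell2 I \<Longrightarrow> g \<in> ell2 I \<Longrightarrow> \<Lambda> (f + g) = \<Lambda> f + (\<Lambda> g :: complex)"
    and scale: "\<And>c f. f \<in> ell2 I \<Longrightarrow> \<Lambda> (\<lambda>i. c * f i) = c * \<Lambda> f"
    and bd: "\<And>f. f \<in> ell2 I \<Longrightarrow> cmod (\<Lambda> f) \<le> C * norm2 f"
    and ket: "\<And>i. i \<in> I \<Longrightarrow> \<Lambda> (ket i) = 0"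
    and f: "f \<in> ell2 I"
  shows "\<Lambda> f = 0"
proof -
  have z: "\<Lambda> 0 = 0" using add[of 0 0] by simp
  have "cmod (\<Lambda> f) \<le> \<epsilon>" if "\<epsilon> > 0" for \<epsilon>
  proof -
    have "\<epsilon> / (\<bar>C\<bar> + 1) > 0" using that by simp
    then obtain F where F: "finite F" "F \<subseteq> I" "norm2 (f - cut F f) < \<epsilon> / (\<bar>C\<bar> + 1)"
      using cut_approx[OF f] by blast
    have c: "cut F f \<in> ell2 I" using f F by (simp add: cut_in_ell2)
    have "\<Lambda> (\<Sum>i\<in>G. (\<lambda>j. f i * ket i j)) = 0" if "finite G" "G \<subseteq> I" for G
      using that
    proof (induction G rule: finite_induct)
      case (insert x G)
      have "\<Lambda> (\<Sum>i\<in>insert x G. (\<lambda>j. f i * ket i j)) = \<Lambda> ((\<lambda>j. f x * ket x j) + (\<Sum>i\<in>G. (\<lambda>j. f i * ket i j)))"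
        using insert by simp
      also have "\<dots> = \<Lambda> (\<lambda>j. f x * ket x j) + \<Lambda> (\<Sum>i\<in>G. (\<lambda>j. f i * ket i j))"
        using insert by (intro add ell2_sum ell2_scale ket_in_ell2) auto
      also have "\<dots> = 0" using insert by (simp add: scale ket ket_in_ell2)
      finally show ?case .
    qed (simp add: z)
    then have "\<Lambda> (cut F f) = 0" using F by (simp add: cut_eq_sum)
    moreover have "\<Lambda> ((f - cut F f) + cut F f) = \<Lambda> (f - cut F f) + \<Lambda> (cut F f)"
      using f c by (intro add ell2_diff)
    ultimately have "\<Lambda> f = \<Lambda> (f - cut F f)" by simp
    then have "cmod (\<Lambda> f) \<le> C * norm2 (f - cut F f)"
      using bd[OF ell2_diff[OF f c]] by simp
    also have "\<dots> \<le> (\<bar>C\<bar> + 1) * norm2 (f - cut F f)"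
      by (intro mult_right_mono) auto
    also have "\<dots> \<le> (\<bar>C\<bar> + 1) * (\<epsilon> / (\<bar>C\<bar> + 1))"
      using F by (intro mult_left_mono) auto
    also have "\<dots> = \<epsilon>" by simp
    finally show ?thesis .
  qed
  then have "cmod (\<Lambda> f) \<le> 0" using field_le_epsilon[of "cmod (\<Lambda> f)" 0] by simp
  then show ?thesis by simp
qed

text \<open>Bounds for finite partial sums give membership and the norm bound at once; this is how all operators
on infinite-dimensional spaces are constructed below.\<close>

lemma ell2_boundedI:
  assumes out: "\<And>j. j \<notin> J \<Longrightarrow> g j = 0" and C: "C \<ge> 0"
    and bd: "\<And>F. finite F \<Longrightarrow> F \<subseteq> J \<Longrightarrow> (\<Sum>j\<in>F. (cmod (g j))\<^sup>2) \<le> C\<^sup>2"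
  shows "g \<in> ell2 J" "norm2 g \<le> C"
proof -
  have bd': "(\<Sum>j\<in>F. (cmod (g j))\<^sup>2) \<le> C\<^sup>2" if "finite F" for F
  proof -
    have "(\<Sum>j\<in>F. (cmod (g j))\<^sup>2) = (\<Sum>j\<in>F \<inter> J. (cmod (g j))\<^sup>2)"
      using that out by (intro sum.mono_neutral_right) auto
    also have "\<dots> \<le> C\<^sup>2" using bd[of "F \<inter> J"] that by simp
    finally show ?thesis .
  qed
  have s: "(\<lambda>j. (cmod (g j))\<^sup>2) summable_on UNIV"
    by (rule nonneg_bounded_partial_sums_imp_summable_on[where C = "C\<^sup>2"])
       (auto simp: bd' intro!: eventually_finite_subsets_at_top_weakI)
  then show "g \<in> ell2 J" using out by (simp add: ell2_def)
  have "(norm2 g)\<^sup>2 \<le> C\<^sup>2"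
    unfolding norm2_square using s bd' by (intro infsum_le_finite_sums) auto
  then show "norm2 g \<le> C" using C by (rule power2_le_imp_le)
qed

lemma BopD:
  assumes "T \<in> Bop I J"
  shows "f \<in> ell2 I \<Longrightarrow> T f \<in> ell2 J"
    and "f \<in> ell2 I \<Longrightarrow> g \<in> ell2 I \<Longrightarrow> T (f + g) = T f + T g"
    and "f \<in> ell2 I \<Longrightarrow> T (\<lambda>i. c * f i) = (\<lambda>j. c * T f j)"
    and "f \<notin> ell2 I \<Longrightarrow> T f = 0"
  using assms by (auto simp: Bop_def)

lemma Bop_0: assumes "T \<in> Bop I J" shows "T 0 = 0"
  using BopD(3)[OF assms, of 0 0] by (simp add: zero_fun_def)

lemma Bop_bound:
  assumes "T \<in> Bop I J"
  obtains C where "C \<ge> 0" "\<And>f. f \<in> ell2 I \<Longrightarrow> norm2 (T f) \<le> C * norm2 f"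
proof -
  obtain C where C: "\<forall>f\<in>ell2 I. norm2 (T f) \<le> C * norm2 f"
    using assms unfolding Bop_def by blast
  have "norm2 (T f) \<le> \<bar>C\<bar> * norm2 f" if "f \<in> ell2 I" for f
    using bspec[OF C that] mult_right_mono[OF abs_ge_self norm2_nonneg, of C f] by linarith
  then show ?thesis using that[of "\<bar>C\<bar>"] by auto
qed

lemma BopI:
  assumes "\<And>f. f \<in> ell2 I \<Longrightarrow> T f \<in> ell2 J"
    and "\<And>f g. f \<in> ell2 I \<Longrightarrow> g \<in> ell2 I \<Longrightarrow> T (f + g) = T f + T g"
    and "\<And>c f. f \<in> ell2 I \<Longrightarrow> T (\<lambda>i. c * f i) = (\<lambda>j. c * T f j)"
    and "\<And>f. f \<in> ell2 I \<Longrightarrow> norm2 (T f) \<le> C * norm2 f"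
    and "\<And>f. f \<notin> ell2 I \<Longrightarrow> T f = 0"
  shows "T \<in> Bop I J"
  using assms unfolding Bop_def by blast

lemma Bop_sum:
  assumes T: "T \<in> Bop I J" and f: "\<And>a. a \<in> A \<Longrightarrow> f a \<in> ell2 I"
  shows "T (sum f A) = (\<Sum>a\<in>A. T (f a))"
  using f by (induction A rule: infinite_finite_induct) (auto simp: Bop_0[OF T] BopD(2)[OF T] ell2_sum)

text \<open>Matrix coefficients of bounded operators agree on the whole space once they agree on the basis. The
two operators may act on different spaces, so that one of them can be the identity on the domain.\<close>

lemma Bop_functional_zero:
  assumes T: "T \<in> Bop I J" and S: "S \<in> Bop I' J'"
    and g: "g \<in> ell2 J" and h: "h \<in> ell2 J'" and II: "I \<subseteq> I'"
    and ket: "\<And>i. i \<in> I \<Longrightarrow> inner2 (T (ket i)) g = inner2 (S (ket i)) h"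
    and f: "f \<in> ell2 I"
  shows "inner2 (T f) g = inner2 (S f) h"
proof -
  obtain C where C: "\<And>f. f \<in> ell2 I \<Longrightarrow> norm2 (T f) \<le> C * norm2 f" using T Bop_bound by blast
  obtain D where D: "\<And>f. f \<in> ell2 I' \<Longrightarrow> norm2 (S f) \<le> D * norm2 f" using S Bop_bound by blast
  note I' = ell2_mono[OF II]
  have "inner2 (T f) g - inner2 (S f) h = 0"
  proof (rule bounded_functional_zero[where I = I and \<Lambda> = "\<lambda>f. inner2 (T f) g - inner2 (S f) h"])
    show "cmod (inner2 (T f) g - inner2 (S f) h) \<le> (C * norm2 g + D * norm2 h) * norm2 f" if "f \<in> ell2 I" for f
    proof -
      have "cmod (inner2 (T f) g - inner2 (S f) h) \<le> cmod (inner2 (T f) g) + cmod (inner2 (S f) h)"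
        by (rule norm_triangle_ineq4)
      also have "\<dots> \<le> norm2 (T f) * norm2 g + norm2 (S f) * norm2 h"
        using that I' T S g h by (intro add_mono Cauchy_Schwarz2) (auto dest: BopD(1))
      also have "\<dots> \<le> (C * norm2 f) * norm2 g + (D * norm2 f) * norm2 h"
        using C D that I' by (intro add_mono mult_right_mono) auto
      finally show ?thesis by (simp add: algebra_simps)
    qed
    show "inner2 (T (f + f')) g - inner2 (S (f + f')) h = inner2 (T f) g - inner2 (S f) h + (inner2 (T f') g - inner2 (S f') h)"
      if "f \<in> ell2 I" "f' \<in> ell2 I" for f f'
      unfolding BopD(2)[OF T that] BopD(2)[OF S I'[OF that(1)] I'[OF that(2)]]
        inner2_add_left[OF BopD(1)[OF T that(1)] BopD(1)[OF T that(2)] g]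
        inner2_add_left[OF BopD(1)[OF S I'[OF that(1)]] BopD(1)[OF S I'[OF that(2)]] h]
      by simp
    show "inner2 (T (\<lambda>i. c * f i)) g - inner2 (S (\<lambda>i. c * f i)) h = c * (inner2 (T f) g - inner2 (S f) h)"
      if "f \<in> ell2 I" for c f
      unfolding BopD(3)[OF T that] BopD(3)[OF S I'[OF that]] inner2_scale_left
      by (simp add: right_diff_distrib)
  qed (use ket f in auto)
  then show ?thesis by simp
qed

lemma Bop_eqI:
  assumes T: "T \<in> Bop I J" and S: "S \<in> Bop I J"
    and ket: "\<And>i. i \<in> I \<Longrightarrow> T (ket i) = S (ket i)"
  shows "T = S"
proof
  fix f
  show "T f = S f"
  proof (cases "f \<in> ell2 I")
    case True
    have "T f j = S f j" for j
    proof (cases "j \<in> J")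
      case True
      then have "inner2 (T f) (ket j) = inner2 (S f) (ket j)"
        using Bop_functional_zero[OF T S ket_in_ell2 ket_in_ell2] ket \<open>f \<in> ell2 I\<close> by (metis order_refl)
      then show ?thesis by (simp add: inner2_ket_right)
    qed (use BopD(1)[OF T True] BopD(1)[OF S True] ell2_outside in metis)
    then show ?thesis by blast
  qed (use BopD(4)[OF T] BopD(4)[OF S] in simp)
qed

text \<open>The coordinates of \<open>S g\<close> are forced to be \<open>\<langle>g, T e\<^sub>i\<rangle>\<close>. If \<open>h\<close> is a finite truncation of \<open>S g\<close>, then
\<open>\<parallel>h\<parallel>\<^sup>2 = \<langle>g, T h\<rangle> \<le> C \<parallel>g\<parallel> \<parallel>h\<parallel>\<close>, which bounds all finite partial sums.\<close>

lemma adj_exists: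
  assumes T: "T \<in> Bop I J"
  shows "\<exists>S\<in>Bop J I. \<forall>f\<in>ell2 I. \<forall>g\<in>ell2 J. inner2 (T f) g = inner2 f (S g)"
proof -
  obtain C where C: "C \<ge> 0" "\<And>f. f \<in> ell2 I \<Longrightarrow> norm2 (T f) \<le> C * norm2 f" using T Bop_bound by blast
  define S where "S g = (\<lambda>i. if g \<in> ell2 J \<and> i \<in> I then inner2 g (T (ket i)) else 0)" for g
  have Tk: "T (ket i) \<in> ell2 J" if "i \<in> I" for i by (rule BopD(1)[OF T ket_in_ell2[OF that]])
  have fin: "(\<Sum>i\<in>F. (cmod (S g i))\<^sup>2) \<le> (C * norm2 g)\<^sup>2" if g: "g \<in> ell2 J" and F: "finite F" "F \<subseteq> I" for g F
  proof -
    let ?s = "\<Sum>i\<in>F. (cmod (S g i))\<^sup>2"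
    define h where "h = cut F (S g)"
    have h: "h \<in> ell2 I" unfolding h_def using F by (intro ell2_finite_support[of F]) (auto simp: cut_def)
    have Th: "T h = (\<Sum>i\<in>F. (\<lambda>j. S g i * T (ket i) j))"
      unfolding h_def cut_eq_sum[OF F(1)] using F
      by (subst Bop_sum[OF T]) (auto intro!: sum.cong ell2_scale ket_in_ell2 BopD(3)[OF T])
    have "inner2 g (T h) = (\<Sum>i\<in>F. cnj (S g i) * inner2 g (T (ket i)))"
      unfolding Th using F g Tk
      by (subst inner2_sum_right[where I = J]) (auto simp: inner2_scale_right intro!: ell2_scale)
    also have "\<dots> = (\<Sum>i\<in>F. of_real ((cmod (S g i))\<^sup>2))"
      using F g by (intro sum.cong refl) (auto simp: S_def complex_norm_square simp del: of_real_power)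
    also have "\<dots> = of_real ?s" by simp
    finally have "?s = cmod (inner2 g (T h))"
      by (simp add: norm_of_real sum_nonneg del: of_real_sum of_real_power)
    also have "\<dots> \<le> norm2 g * norm2 (T h)"
      using g BopD(1)[OF T h] by (rule Cauchy_Schwarz2)
    also have "\<dots> \<le> norm2 g * (C * norm2 h)" using C h by (intro mult_left_mono) auto
    finally have "?s \<le> (C * norm2 g) * norm2 h" by (simp add: mult_ac)
    moreover have "(norm2 h)\<^sup>2 = ?s" unfolding h_def by (rule norm2_cut[OF F(1)])
    ultimately have "norm2 h * norm2 h \<le> (C * norm2 g) * norm2 h" by (simp add: power2_eq_square)
    then have "norm2 h \<le> C * norm2 g"
      using C norm2_nonneg[of h] by (cases "norm2 h = 0") (auto dest: mult_right_le_imp_le)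
    then show ?thesis unfolding \<open>(norm2 h)\<^sup>2 = ?s\<close>[symmetric] by (intro power_mono) auto
  qed
  have S1: "S g \<in> ell2 I" "norm2 (S g) \<le> C * norm2 g" if "g \<in> ell2 J" for g
    using ell2_boundedI[of I "S g" "C * norm2 g"] fin[OF that] C by (auto simp: S_def)
  have S: "S \<in> Bop J I"
  proof (rule BopI)
    show "S (f + g) = S f + S g" if "f \<in> ell2 J" "g \<in> ell2 J" for f g
      using that Tk by (auto simp: S_def fun_eq_iff ell2_add inner2_add_left[where I = J and J = J])
    show "S (\<lambda>i. c * f i) = (\<lambda>j. c * S f j)" if "f \<in> ell2 J" for c f
      using that by (auto simp: S_def fun_eq_iff ell2_scale inner2_scale_left)
    show "S f = 0" if "f \<notin> ell2 J" for f using that by (auto simp: S_def)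
  qed (use S1 in auto)
  have "inner2 (T f) g = inner2 f (S g)" if f: "f \<in> ell2 I" and g: "g \<in> ell2 J" for f g
  proof -
    have id: "id_op I \<in> Bop I I"
      by (rule BopI[where C = 1]) (auto simp: id_op_def ell2_add ell2_scale)
    have "inner2 (T f) g = inner2 (id_op I f) (S g)"
      by (rule Bop_functional_zero[OF T id g S1(1)[OF g] order_refl _ f])
         (auto simp: id_op_def ket_in_ell2 inner2_ket_left S_def g inner2_commute[of g])
    then show ?thesis using f by (simp add: id_op_def)
  qed
  then show ?thesis using S by blast
qed

lemma adj_unique:
  assumes "S \<in> Bop J I" "S' \<in> Bop J I"
    and "\<And>f g. f \<in> ell2 I \<Longrightarrow> g \<in> ell2 J \<Longrightarrow> inner2 f (S g) = inner2 f (S' g)"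
  shows "S = S'"
proof (rule Bop_eqI[OF assms(1,2)])
  fix j assume "j \<in> J"
  then have k: "ket j \<in> ell2 J" by (rule ket_in_ell2)
  show "S (ket j) = S' (ket j)"
  proof
    fix i show "S (ket j) i = S' (ket j) i"
    proof (cases "i \<in> I")
      case True
      then show ?thesis using assms(3)[OF ket_in_ell2 k, of i] by (simp add: inner2_ket_left)
    qed (use BopD(1)[OF assms(1) k] BopD(1)[OF assms(2) k] ell2_outside in metis)
  qed
qed

lemma adj_eqI:
  assumes S: "S \<in> Bop J I"
    and eq: "\<And>f g. f \<in> ell2 I \<Longrightarrow> g \<in> ell2 J \<Longrightarrow> inner2 (T f) g = inner2 f (S g)"
  shows "adj I J T = S"
  unfolding adj_def
proof (rule the_equality)
  show "S \<in> Bop J I \<and> (\<forall>f\<in>ell2 I. \<forall>g\<in>ell2 J. inner2 (T f) g = inner2 f (S g))"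
    using assms by blast
  show "S' = S" if "S' \<in> Bop J I \<and> (\<forall>f\<in>ell2 I. \<forall>g\<in>ell2 J. inner2 (T f) g = inner2 f (S' g))" for S'
    using that S eq by (intro adj_unique) auto
qed

lemma
  assumes T: "T \<in> Bop I J"
  shows adj_in_Bop: "adj I J T \<in> Bop J I"
    and inner2_adj: "f \<in> ell2 I \<Longrightarrow> g \<in> ell2 J \<Longrightarrow> inner2 (T f) g = inner2 f (adj I J T g)"
proof -
  obtain S where S: "S \<in> Bop J I" "\<And>f g. f \<in> ell2 I \<Longrightarrow> g \<in> ell2 J \<Longrightarrow> inner2 (T f) g = inner2 f (S g)"
    using adj_exists[OF T] by blast
  then have "adj I J T = S" by (rule adj_eqI)
  then show "adj I J T \<in> Bop J I"
    "f \<in> ell2 I \<Longrightarrow> g \<in> ell2 J \<Longrightarrow> inner2 (T f) g = inner2 f (adj I J T g)" using S by auto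
qed

lemma id_op_in_Bop: "id_op I \<in> Bop I I"
  by (rule BopI[where C = 1]) (auto simp: id_op_def ell2_add ell2_scale)

lemma zero_in_Bop: "0 \<in> Bop I J"
  by (rule BopI[where C = 0]) (auto simp: fun_eq_iff)

lemma Bop_add:
  assumes S: "S \<in> Bop I J" and T: "T \<in> Bop I J"
  shows "S + T \<in> Bop I J"
proof -
  obtain C where C: "\<And>f. f \<in> ell2 I \<Longrightarrow> norm2 (S f) \<le> C * norm2 f" using S Bop_bound by blast
  obtain D where D: "\<And>f. f \<in> ell2 I \<Longrightarrow> norm2 (T f) \<le> D * norm2 f" using T Bop_bound by blast
  show ?thesis
  proof (rule BopI)
    show "norm2 ((S + T) f) \<le> (C + D) * norm2 f" if "f \<in> ell2 I" for f
      using norm2_triangle[OF BopD(1)[OF S that] BopD(1)[OF T that]] C[OF that] D[OF that]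
      by (simp add: distrib_right)
  qed (auto simp: BopD[OF S] BopD[OF T] ell2_add fun_eq_iff algebra_simps)
qed

lemma Bop_cscale:
  assumes S: "S \<in> Bop I J"
  shows "cscale c S \<in> Bop I J"
proof -
  obtain C where C: "\<And>f. f \<in> ell2 I \<Longrightarrow> norm2 (S f) \<le> C * norm2 f" using S Bop_bound by blast
  show ?thesis
  proof (rule BopI)
    show "norm2 (cscale c S f) \<le> (cmod c * C) * norm2 f" if "f \<in> ell2 I" for f
      using mult_left_mono[OF C[OF that], of "cmod c"] by (simp add: cscale_def norm2_scale)
  qed (auto simp: cscale_def BopD[OF S] ell2_scale fun_eq_iff algebra_simps)
qed

lemma Bop_sum_in: "(\<And>a. a \<in> A \<Longrightarrow> f a \<in> Bop I J) \<Longrightarrow> sum f A \<in> Bop I J"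
  by (induction A rule: infinite_finite_induct) (auto intro: Bop_add zero_in_Bop)

lemma Bop_comp:
  assumes S: "S \<in> Bop J K" and T: "T \<in> Bop I J"
  shows "S \<circ> T \<in> Bop I K"
proof -
  obtain C where C: "C \<ge> 0" "\<And>f. f \<in> ell2 J \<Longrightarrow> norm2 (S f) \<le> C * norm2 f" using S Bop_bound by blast
  obtain D where D: "\<And>f. f \<in> ell2 I \<Longrightarrow> norm2 (T f) \<le> D * norm2 f" using T Bop_bound by blast
  show ?thesis
  proof (rule BopI)
    show "norm2 ((S \<circ> T) f) \<le> (C * D) * norm2 f" if "f \<in> ell2 I" for f
      using C(2)[OF BopD(1)[OF T that]] mult_left_mono[OF D[OF that] C(1)] by (simp add: mult.assoc)
    show "(S \<circ> T) f = 0" if "f \<notin> ell2 I" for f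
      using BopD(4)[OF T that] Bop_0[OF S] by simp
  qed (auto simp: BopD[OF S] BopD[OF T])
qed

lemma op_norm_bound:
  assumes T: "T \<in> Bop I J" and f: "f \<in> ell2 I"
  shows "norm2 (T f) \<le> op_norm I T * norm2 f"
proof (cases "norm2 f = 0")
  case True
  then show ?thesis using norm2_eq_0[OF f True] Bop_0[OF T] by simp
next
  case False
  obtain C where C: "C \<ge> 0" "\<And>f. f \<in> ell2 I \<Longrightarrow> norm2 (T f) \<le> C * norm2 f" using T Bop_bound by blast
  let ?g = "\<lambda>i. complex_of_real (inverse (norm2 f)) * f i"
  have g: "?g \<in> ell2 I" "norm2 ?g = 1"
    using False by (auto simp: norm2_scale norm_of_real norm_inverse simp del: of_real_inverse intro: ell2_scale[OF f])
  have "norm2 (T ?g) \<le> op_norm I T"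
    unfolding op_norm_def
  proof (rule cSup_upper)
    show "norm2 (T ?g) \<in> {norm2 (T f) |f. f \<in> ell2 I \<and> norm2 f \<le> 1}"
      using g by auto
    show "bdd_above {norm2 (T f) |f. f \<in> ell2 I \<and> norm2 f \<le> 1}"
    proof (rule bdd_aboveI[of _ C])
      fix v assume "v \<in> {norm2 (T f) |f. f \<in> ell2 I \<and> norm2 f \<le> 1}"
      then obtain h where "v = norm2 (T h)" "h \<in> ell2 I" "norm2 h \<le> 1" by blast
      then show "v \<le> C" using C(2)[of h] mult_left_mono[of "norm2 h" 1 C] C(1) by simp
    qed
  qed
  also have "norm2 (T ?g) = norm2 (T f) / norm2 f"
    unfolding BopD(3)[OF T f] norm2_scale by (simp add: norm_inverse divide_inverse mult.commute)
  finally show ?thesis using False by (simp add: divide_le_eq less_le)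
qed

lemma op_norm_0: "op_norm I 0 = 0"
proof -
  have "{norm2 ((0 :: ('a \<Rightarrow> complex) \<Rightarrow> 'b \<Rightarrow> complex) f) |f. f \<in> ell2 I \<and> norm2 f \<le> 1} = {0}"
    by (auto intro!: exI[of _ 0])
  then show ?thesis unfolding op_norm_def by simp
qed

section \<open>Direct sums of operators\<close>

definition slice :: "('v \<times> 'i \<Rightarrow> complex) \<Rightarrow> 'v \<Rightarrow> 'i \<Rightarrow> complex" where
  "slice f v = (\<lambda>i. f (v, i))"

text \<open>The inclusion of the summand \<open>v\<close> into a direct sum.\<close>

definition emb :: "'v \<Rightarrow> ('i \<Rightarrow> complex) \<Rightarrow> 'v \<times> 'i \<Rightarrow> complex" where
  "emb v f = (\<lambda>(w, i). if w = v then f i else 0)"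

text \<open>Direct sums of operators cover two cases: the universal bi-isometry, and the amplification \<open>1 \<otimes> T\<close>,
which is a direct sum of copies of \<open>T\<close>.\<close>

definition dsum_op :: "'v set \<Rightarrow> ('v \<Rightarrow> 'i set) \<Rightarrow> ('v \<Rightarrow> 'j set) \<Rightarrow> ('v \<Rightarrow> ('i, 'j) op) \<Rightarrow> ('v \<times> 'i, 'v \<times> 'j) op" where
  "dsum_op V I J T = (\<lambda>f. if f \<in> ell2 (Sigma V I)
     then (\<lambda>(v, j). if (v, j) \<in> Sigma V J then T v (slice f v) j else 0) else 0)"

lemma case_prod_cmod_square: "(\<lambda>(v, i). (cmod (f (v, i)))\<^sup>2) = (\<lambda>z. (cmod (f z))\<^sup>2)"
  by auto

lemma slice_in_ell2:
  assumes f: "f \<in> ell2 (Sigma V I)"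
  shows "slice f v \<in> ell2 (I v)"
proof -
  have "(\<lambda>(v, i). (cmod (f (v, i)))\<^sup>2) summable_on (SIGMA v:UNIV. UNIV)"
    using ell2_summable[OF f] by (simp add: case_prod_cmod_square)
  then have "(\<lambda>i. (cmod (f (v, i)))\<^sup>2) summable_on UNIV"
    by (rule summable_on_SigmaD1) simp
  then show ?thesis
    using f by (auto simp: ell2_def slice_def)
qed

lemma sum_norm2_slice_le:
  assumes f: "f \<in> ell2 K" and G: "finite G"
  shows "(\<Sum>v\<in>G. (norm2 (slice f v))\<^sup>2) \<le> (norm2 f)\<^sup>2"
proof -
  have s: "(\<lambda>(v, i). (cmod (f (v, i)))\<^sup>2) summable_on (SIGMA v:A. UNIV)" for A
    by (rule summable_on_subset[of _ UNIV]) (use ell2_summable[OF f] in \<open>auto simp: case_prod_cmod_square\<close>)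
  have "(\<Sum>v\<in>G. (norm2 (slice f v))\<^sup>2) = (\<Sum>\<^sub>\<infinity>v\<in>G. \<Sum>\<^sub>\<infinity>i. (cmod (f (v, i)))\<^sup>2)"
    using G by (simp add: norm2_square slice_def)
  also have "\<dots> = (\<Sum>\<^sub>\<infinity>(v, i)\<in>(SIGMA v:G. UNIV). (cmod (f (v, i)))\<^sup>2)"
    by (rule infsum_Sigma'_banach[OF s])
  also have "\<dots> \<le> (\<Sum>\<^sub>\<infinity>(v, i)\<in>(SIGMA v:UNIV. UNIV). (cmod (f (v, i)))\<^sup>2)"
    by (rule infsum_mono2[OF s s]) auto
  also have "\<dots> = (norm2 f)\<^sup>2"
    by (simp add: norm2_square case_prod_cmod_square)
  finally show ?thesis .
qed

lemma sum_square_le_norm2: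
  assumes "f \<in> ell2 K" "finite F"
  shows "(\<Sum>j\<in>F. (cmod (f j))\<^sup>2) \<le> (norm2 f)\<^sup>2"
  unfolding norm2_square using assms by (intro finite_sum_le_infsum ell2_summable) auto

lemma dsum_op_bound:
  assumes T: "\<And>v. v \<in> V \<Longrightarrow> T v \<in> Bop (I v) (J v)" and C: "C \<ge> 0"
    and bd: "\<And>v f. v \<in> V \<Longrightarrow> f \<in> ell2 (I v) \<Longrightarrow> norm2 (T v f) \<le> C * norm2 f"
    and f: "f \<in> ell2 (Sigma V I)"
  shows "dsum_op V I J T f \<in> ell2 (Sigma V J)" "norm2 (dsum_op V I J T f) \<le> C * norm2 f"
proof -
  let ?g = "dsum_op V I J T f"
  have Tf: "T v (slice f v) \<in> ell2 (J v)" if "v \<in> V" for v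
    by (rule BopD(1)[OF T[OF that] slice_in_ell2[OF f]])
  have "(\<Sum>z\<in>F. (cmod (?g z))\<^sup>2) \<le> (C * norm2 f)\<^sup>2" if F: "finite F" "F \<subseteq> Sigma V J" for F
  proof -
    have FV: "fst ` F \<subseteq> V" using F by auto
    have "(\<Sum>z\<in>F. (cmod (?g z))\<^sup>2) = (\<Sum>z\<in>F. (cmod (T (fst z) (slice f (fst z)) (snd z)))\<^sup>2)"
      using F f by (intro sum.cong refl) (auto simp: dsum_op_def)
    also have "\<dots> \<le> (\<Sum>z\<in>fst ` F \<times> snd ` F. (cmod (T (fst z) (slice f (fst z)) (snd z)))\<^sup>2)"
      using F by (intro sum_mono2[OF _ subset_fst_snd]) auto
    also have "\<dots> = (\<Sum>v\<in>fst ` F. \<Sum>j\<in>snd ` F. (cmod (T v (slice f v) j))\<^sup>2)"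
      by (simp add: sum.cartesian_product')
    also have "\<dots> \<le> (\<Sum>v\<in>fst ` F. (norm2 (T v (slice f v)))\<^sup>2)"
      using F FV by (intro sum_mono sum_square_le_norm2[OF Tf]) auto
    also have "\<dots> \<le> (\<Sum>v\<in>fst ` F. (C * norm2 (slice f v))\<^sup>2)"
      using FV by (intro sum_mono power_mono bd slice_in_ell2[OF f]) auto
    also have "\<dots> = C\<^sup>2 * (\<Sum>v\<in>fst ` F. (norm2 (slice f v))\<^sup>2)"
      by (simp add: power_mult_distrib sum_distrib_left)
    also have "\<dots> \<le> C\<^sup>2 * (norm2 f)\<^sup>2"
      using F by (intro mult_left_mono sum_norm2_slice_le[OF f]) auto
    finally show ?thesis by (simp add: power_mult_distrib)
  qed
  moreover have "?g z = 0" if "z \<notin> Sigma V J" for z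
    using that by (cases z) (auto simp: dsum_op_def)
  ultimately show "?g \<in> ell2 (Sigma V J)" "norm2 ?g \<le> C * norm2 f"
    using ell2_boundedI[of "Sigma V J" ?g "C * norm2 f"] C by auto
qed

lemma dsum_op_in_Bop:
  assumes T: "\<And>v. v \<in> V \<Longrightarrow> T v \<in> Bop (I v) (J v)" and C: "C \<ge> 0"
    and bd: "\<And>v f. v \<in> V \<Longrightarrow> f \<in> ell2 (I v) \<Longrightarrow> norm2 (T v f) \<le> C * norm2 f"
  shows "dsum_op V I J T \<in> Bop (Sigma V I) (Sigma V J)"
proof (rule BopI)
  fix f g :: "'a \<times> 'b \<Rightarrow> complex" and c assume f: "f \<in> ell2 (Sigma V I)" 
  show "dsum_op V I J T f \<in> ell2 (Sigma V J)" "norm2 (dsum_op V I J T f) \<le> C * norm2 f"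
    by (rule dsum_op_bound[OF T C bd f]; assumption)+
  have sc: "slice (\<lambda>z. c * f z) v = (\<lambda>i. c * slice f v i)" for v by (simp add: slice_def)
  have "T v (\<lambda>i. c * slice f v i) j = c * T v (slice f v) j" if "v \<in> V" for v j
    by (simp add: BopD(3)[OF T[OF that] slice_in_ell2[OF f]])
  then show "dsum_op V I J T (\<lambda>i. c * f i) = (\<lambda>j. c * dsum_op V I J T f j)"
    using f by (auto simp: fun_eq_iff dsum_op_def ell2_scale sc)
  assume g: "g \<in> ell2 (Sigma V I)"
  have sp: "slice (f + g) v = slice f v + slice g v" for v by (auto simp: slice_def)
  have "T v (slice f v + slice g v) j = T v (slice f v) j + T v (slice g v) j" if "v \<in> V" for v j
    by (simp add: BopD(2)[OF T[OF that] slice_in_ell2[OF f] slice_in_ell2[OF g]])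
  then show "dsum_op V I J T (f + g) = dsum_op V I J T f + dsum_op V I J T g"
    using f g by (auto simp: fun_eq_iff dsum_op_def ell2_add[OF f g] sp)
qed (simp add: dsum_op_def)

lemma slice_emb: "slice (emb v f) w = (if w = v then f else 0)"
  by (auto simp: slice_def emb_def fun_eq_iff)

lemma norm2_emb_summable: "f \<in> ell2 I \<Longrightarrow> (\<lambda>z. (cmod (emb v f z))\<^sup>2) summable_on UNIV"
proof -
  assume "f \<in> ell2 I"
  then have "((\<lambda>z. (cmod (emb v f z))\<^sup>2) \<circ> Pair v) summable_on UNIV"
    by (simp add: o_def emb_def ell2_summable)
  then have "(\<lambda>z. (cmod (emb v f z))\<^sup>2) summable_on range (Pair v)"
    by (subst summable_on_reindex) (auto simp: inj_on_def)
  then show ?thesis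
    by (rule summable_on_cong_neutral[THEN iffD1, rotated -1]) (auto simp: emb_def image_iff split: if_splits)
qed

lemma emb_in_ell2: "v \<in> V \<Longrightarrow> f \<in> ell2 (I v) \<Longrightarrow> emb v f \<in> ell2 (Sigma V I)"
  using norm2_emb_summable[of f "I v" v]
  by (auto simp: ell2_def emb_def split: if_splits)

lemma inner2_emb: "inner2 (emb v f) (emb w g) = (if v = w then inner2 f g else 0)"
proof (cases "v = w")
  case True
  have "inner2 (emb v f) (emb v g) = (\<Sum>\<^sub>\<infinity>z\<in>range (Pair v). emb v f z * cnj (emb v g z))"
    unfolding inner2_def by (intro infsum_cong_neutral) (auto simp: emb_def split: if_splits)
  also have "\<dots> = infsum ((\<lambda>z. emb v f z * cnj (emb v g z)) \<circ> Pair v) UNIV"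
    by (intro infsum_reindex) (auto simp: inj_on_def)
  also have "\<dots> = inner2 f g" by (simp add: o_def emb_def inner2_def)
  finally show ?thesis using True by simp
next
  case False
  then have "(\<lambda>z. emb v f z * cnj (emb w g z)) = (\<lambda>_. 0)"
    by (auto simp: emb_def fun_eq_iff)
  then show ?thesis using False by (simp add: inner2_def)
qed

lemma ket_pair: "ket (v, i) = emb v (ket i)"
  by (auto simp: ket_def emb_def fun_eq_iff)

lemma dsum_op_emb:
  assumes T: "\<And>w. w \<in> V \<Longrightarrow> T w \<in> Bop (I w) (J w)" and v: "v \<in> V" and f: "f \<in> ell2 (I v)"
  shows "dsum_op V I J T (emb v f) = emb v (T v f)"
proof -
  have "T w 0 = 0" if "w \<in> V" for w using Bop_0[OF T[OF that]] .
  moreover have "T v f j = 0" if "j \<notin> J v" for j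
    using BopD(1)[OF T[OF v] f] that by (rule ell2_outside)
  moreover have "dsum_op V I J T (emb v f) = (\<lambda>(w, j). if (w, j) \<in> Sigma V J then T w (if w = v then f else 0) j else 0)"
    using emb_in_ell2[of v V f I] v f by (auto simp: dsum_op_def slice_emb fun_eq_iff)
  ultimately show ?thesis
    using v by (auto simp: emb_def fun_eq_iff)
qed

section \<open>Tensor products of operators\<close>

lemma vec_tensor_in_ell2:
  assumes f: "f \<in> ell2 I" and g: "g \<in> ell2 J"
  shows "vec_tensor f g \<in> ell2 (I \<times> J)"
proof (rule ell2_boundedI)
  fix F assume F: "finite F" "F \<subseteq> I \<times> J"
  have "(\<Sum>z\<in>F. (cmod (vec_tensor f g z))\<^sup>2) \<le> (\<Sum>z\<in>fst ` F \<times> snd ` F. (cmod (vec_tensor f g z))\<^sup>2)"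
    using F by (intro sum_mono2[OF _ subset_fst_snd]) auto
  also have "\<dots> = (\<Sum>i\<in>fst ` F. (cmod (f i))\<^sup>2) * (\<Sum>j\<in>snd ` F. (cmod (g j))\<^sup>2)"
    by (simp add: sum.cartesian_product' vec_tensor_def norm_mult power_mult_distrib sum_product)
  also have "\<dots> \<le> (norm2 f)\<^sup>2 * (norm2 g)\<^sup>2"
    using F by (intro mult_mono sum_square_le_norm2[OF f] sum_square_le_norm2[OF g]) (auto intro: sum_nonneg)
  finally show "(\<Sum>z\<in>F. (cmod (vec_tensor f g z))\<^sup>2) \<le> (norm2 f * norm2 g)\<^sup>2"
    by (simp add: power_mult_distrib)
next
  show "vec_tensor f g z = 0" if "z \<notin> I \<times> J" for z
    using that ell2_outside[OF f, of "fst z"] ell2_outside[OF g, of "snd z"]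
    by (cases z) (auto simp: vec_tensor_def)
qed simp

lemma inner2_vec_tensor:
  assumes "f \<in> ell2 I" "f' \<in> ell2 I'" "g \<in> ell2 J" "g' \<in> ell2 J'"
  shows "inner2 (vec_tensor f g) (vec_tensor f' g') = inner2 f f' * inner2 g g'"
proof -
  let ?h = "\<lambda>i j. f i * cnj (f' i) * (g j * cnj (g' j))"
  have eq: "vec_tensor f g z * cnj (vec_tensor f' g' z) = (\<lambda>(i, j). ?h i j) z" for z
    by (cases z) (simp add: vec_tensor_def)
  have "(\<lambda>z. vec_tensor f g z * cnj (vec_tensor f' g' z)) summable_on UNIV"
    using assms by (intro inner2_summable[where I = "I \<times> J" and J = "I' \<times> J'"] vec_tensor_in_ell2)
  then have s: "(\<lambda>(i, j). ?h i j) summable_on (SIGMA i:UNIV. UNIV)"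
    unfolding eq by (simp add: case_prod_unfold)
  have "inner2 (vec_tensor f g) (vec_tensor f' g') = (\<Sum>\<^sub>\<infinity>(i, j)\<in>(SIGMA i:UNIV. UNIV). ?h i j)"
    unfolding inner2_def eq by (simp add: case_prod_unfold)
  also have "\<dots> = (\<Sum>\<^sub>\<infinity>i. \<Sum>\<^sub>\<infinity>j. ?h i j)"
    by (rule infsum_Sigma'_banach[OF s, symmetric])
  also have "\<dots> = inner2 f f' * inner2 g g'"
    unfolding inner2_def by (simp only: infsum_cmult_right' infsum_cmult_left')
  finally show ?thesis .
qed

lemma ket_tensor: "ket (i, j) = vec_tensor (ket i) (ket j)"
  by (auto simp: ket_def vec_tensor_def fun_eq_iff)

definition swap_op :: "'i set \<Rightarrow> 'j set \<Rightarrow> ('i \<times> 'j, 'j \<times> 'i) op" where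
  "swap_op I J = (\<lambda>h. if h \<in> ell2 (I \<times> J) then h \<circ> prod.swap else 0)"

lemma swap_op_in_Bop: "swap_op I J \<in> Bop (I \<times> J) (J \<times> I)"
proof (rule BopI)
  fix h :: "'a \<times> 'b \<Rightarrow> complex" assume h: "h \<in> ell2 (I \<times> J)"
  have b: "bij_betw prod.swap (UNIV :: ('b \<times> 'a) set) (UNIV :: ('a \<times> 'b) set)"
    by (rule bij_swap)
  have "(\<lambda>z. (cmod ((h \<circ> prod.swap) z))\<^sup>2) summable_on UNIV"
    using summable_on_reindex_bij_betw[OF b, of "\<lambda>z. (cmod (h z))\<^sup>2"] ell2_summable[OF h] by simp
  then show "swap_op I J h \<in> ell2 (J \<times> I)"
    using h by (auto simp: swap_op_def ell2_def)
  have "norm2 (h \<circ> prod.swap) = norm2 h"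
    unfolding norm2_def using infsum_reindex_bij_betw[OF b, of "\<lambda>z. (cmod (h z))\<^sup>2"] by simp
  then show "norm2 (swap_op I J h) \<le> 1 * norm2 h" using h by (simp add: swap_op_def)
qed (auto simp: swap_op_def ell2_add ell2_scale fun_eq_iff)

lemma swap_op_vec_tensor: "f \<in> ell2 I \<Longrightarrow> g \<in> ell2 J \<Longrightarrow> swap_op I J (vec_tensor f g) = vec_tensor g f"
  by (auto simp: swap_op_def vec_tensor_in_ell2 fun_eq_iff) (auto simp: vec_tensor_def)

lemma ampl_exists:
  assumes T: "T \<in> Bop J J'"
  shows "\<exists>R\<in>Bop (I \<times> J) (I \<times> J'). \<forall>f\<in>ell2 I. \<forall>g\<in>ell2 J. R (vec_tensor f g) = vec_tensor f (T g)"
proof (intro bexI ballI)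
  obtain C where C: "C \<ge> 0" "\<And>f. f \<in> ell2 J \<Longrightarrow> norm2 (T f) \<le> C * norm2 f" using T Bop_bound by blast
  show "dsum_op I (\<lambda>_. J) (\<lambda>_. J') (\<lambda>_. T) \<in> Bop (I \<times> J) (I \<times> J')"
    by (rule dsum_op_in_Bop) (use T C in auto)
  fix f g assume f: "f \<in> ell2 I" and g: "g \<in> ell2 J"
  have sl: "slice (vec_tensor f g) i = (\<lambda>j. f i * g j)" for i by (simp add: slice_def vec_tensor_def)
  have "dsum_op I (\<lambda>_. J) (\<lambda>_. J') (\<lambda>_. T) (vec_tensor f g) (i, j) = vec_tensor f (T g) (i, j)" for i j
    using vec_tensor_in_ell2[OF f g] ell2_outside[OF f, of i] ell2_outside[OF BopD(1)[OF T g], of j]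
    by (auto simp: dsum_op_def sl BopD(3)[OF T g]) (auto simp: vec_tensor_def)
  then show "dsum_op I (\<lambda>_. J) (\<lambda>_. J') (\<lambda>_. T) (vec_tensor f g) = vec_tensor f (T g)" by auto
qed

text \<open>\<open>S \<otimes> T\<close> is the product of \<open>1 \<otimes> T\<close> and \<open>S \<otimes> 1\<close>, and the latter is \<open>1 \<otimes> S\<close> conjugated by the flip.\<close>

lemma op_tensor_exists:
  assumes S: "S \<in> Bop I I" and T: "T \<in> Bop J J"
  shows "\<exists>R. R \<in> Bop (I \<times> J) (I \<times> J) \<and> (\<forall>f\<in>ell2 I. \<forall>g\<in>ell2 J. R (vec_tensor f g) = vec_tensor (S f) (T g))"
proof -
  obtain R1 where R1: "R1 \<in> Bop (I \<times> J) (I \<times> J)"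
    "\<And>f g. f \<in> ell2 I \<Longrightarrow> g \<in> ell2 J \<Longrightarrow> R1 (vec_tensor f g) = vec_tensor f (T g)"
    using ampl_exists[OF T] by blast
  obtain R2 where R2: "R2 \<in> Bop (J \<times> I) (J \<times> I)"
    "\<And>f g. f \<in> ell2 J \<Longrightarrow> g \<in> ell2 I \<Longrightarrow> R2 (vec_tensor f g) = vec_tensor f (S g)"
    using ampl_exists[OF S] by blast
  let ?R = "R1 \<circ> (swap_op J I \<circ> (R2 \<circ> swap_op I J))"
  have "?R \<in> Bop (I \<times> J) (I \<times> J)"
    by (intro Bop_comp[OF R1(1)] Bop_comp[OF swap_op_in_Bop] Bop_comp[OF R2(1)] swap_op_in_Bop)
  moreover have "?R (vec_tensor f g) = vec_tensor (S f) (T g)" if "f \<in> ell2 I" "g \<in> ell2 J" for f g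
    using that BopD(1)[OF S, of f] by (simp add: swap_op_vec_tensor R1(2) R2(2))
  ultimately show ?thesis by blast
qed

lemma tensor_Bop_eqI:
  assumes "R \<in> Bop (I \<times> J) K" "R' \<in> Bop (I \<times> J) K"
    and "\<And>f g. f \<in> ell2 I \<Longrightarrow> g \<in> ell2 J \<Longrightarrow> R (vec_tensor f g) = R' (vec_tensor f g)"
  shows "R = R'"
  by (rule Bop_eqI[OF assms(1,2)]) (auto simp: ket_tensor intro!: assms(3) ket_in_ell2)

lemma
  assumes S: "S \<in> Bop I I" and T: "T \<in> Bop J J"
  shows op_tensor_in_Bop: "op_tensor I J S T \<in> Bop (I \<times> J) (I \<times> J)"
    and op_tensor_vec_tensor: "f \<in> ell2 I \<Longrightarrow> g \<in> ell2 J \<Longrightarrow> op_tensor I J S T (vec_tensor f g) = vec_tensor (S f) (T g)"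
proof -
  let ?P = "\<lambda>R. R \<in> Bop (I \<times> J) (I \<times> J) \<and> (\<forall>f\<in>ell2 I. \<forall>g\<in>ell2 J. R (vec_tensor f g) = vec_tensor (S f) (T g))"
  obtain R where R: "?P R" using op_tensor_exists[OF S T] by blast
  have "?P (op_tensor I J S T)"
    unfolding op_tensor_def
  proof (rule theI[of ?P])
    show "?P R" by (rule R)
    show "R' = R" if "?P R'" for R'
      by (rule tensor_Bop_eqI[of _ I J "I \<times> J"]) (use that R in auto)
  qed
  then show "op_tensor I J S T \<in> Bop (I \<times> J) (I \<times> J)"
    "f \<in> ell2 I \<Longrightarrow> g \<in> ell2 J \<Longrightarrow> op_tensor I J S T (vec_tensor f g) = vec_tensor (S f) (T g)" by blast+
qed

lemma op_tensor_eqI: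
  assumes S: "S \<in> Bop I I" and T: "T \<in> Bop J J" and R: "R \<in> Bop (I \<times> J) (I \<times> J)"
    and "\<And>f g. f \<in> ell2 I \<Longrightarrow> g \<in> ell2 J \<Longrightarrow> R (vec_tensor f g) = vec_tensor (S f) (T g)"
  shows "op_tensor I J S T = R"
  by (rule tensor_Bop_eqI[OF op_tensor_in_Bop[OF S T] R]) (simp add: op_tensor_vec_tensor[OF S T] assms(4))

lemma cscale_apply: "cscale c S f = (\<lambda>i. c * S f i)"
  by (simp add: cscale_def)

lemma vec_tensor_add:
  "vec_tensor (f + f') g = vec_tensor f g + vec_tensor f' g"
  "vec_tensor f (g + g') = vec_tensor f g + vec_tensor f g'"
  by (auto simp: vec_tensor_def fun_eq_iff algebra_simps)

lemma vec_tensor_cscale: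
  "vec_tensor (\<lambda>i. c * f i) g = (\<lambda>z. c * vec_tensor f g z)"
  "vec_tensor f (\<lambda>i. c * g i) = (\<lambda>z. c * vec_tensor f g z)"
  by (auto simp: vec_tensor_def cscale_def fun_eq_iff)

lemma op_tensor_add_left:
  assumes "S \<in> Bop I I" "S' \<in> Bop I I" "T \<in> Bop J J"
  shows "op_tensor I J (S + S') T = op_tensor I J S T + op_tensor I J S' T"
  by (rule op_tensor_eqI) (use assms in \<open>simp_all add: op_tensor_vec_tensor vec_tensor_add Bop_add Bop_cscale op_tensor_in_Bop\<close>)

lemma op_tensor_add_right:
  assumes "S \<in> Bop I I" "T \<in> Bop J J" "T' \<in> Bop J J"
  shows "op_tensor I J S (T + T') = op_tensor I J S T + op_tensor I J S T'"
  by (rule op_tensor_eqI) (use assms in \<open>simp_all add: op_tensor_vec_tensor vec_tensor_add Bop_add Bop_cscale op_tensor_in_Bop\<close>)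

lemma op_tensor_scale_left:
  assumes "S \<in> Bop I I" "T \<in> Bop J J"
  shows "op_tensor I J (cscale c S) T = cscale c (op_tensor I J S T)"
  by (rule op_tensor_eqI) (use assms in \<open>simp_all add: op_tensor_vec_tensor vec_tensor_cscale cscale_apply Bop_add Bop_cscale op_tensor_in_Bop\<close>)

lemma op_tensor_scale_right:
  assumes "S \<in> Bop I I" "T \<in> Bop J J"
  shows "op_tensor I J S (cscale c T) = cscale c (op_tensor I J S T)"
  by (rule op_tensor_eqI) (use assms in \<open>simp_all add: op_tensor_vec_tensor vec_tensor_cscale cscale_apply Bop_add Bop_cscale op_tensor_in_Bop\<close>)

lemma op_tensor_id: "op_tensor I J (id_op I) (id_op J) = id_op (I \<times> J)"
  by (rule op_tensor_eqI) (simp_all add: id_op_in_Bop, simp add: id_op_def vec_tensor_in_ell2)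

lemma inner2_op_tensor:
  assumes "S \<in> Bop I I" "T \<in> Bop J J" "f \<in> ell2 I" "g \<in> ell2 J" "f' \<in> ell2 I" "g' \<in> ell2 J"
  shows "inner2 (op_tensor I J S T (vec_tensor f g)) (vec_tensor f' g') = inner2 (S f) f' * inner2 (T g) g'"
  using assms by (simp add: op_tensor_vec_tensor inner2_vec_tensor[where I = I and J = J and I' = I and J' = J] BopD(1))

section \<open>Tensor products of linear maps\<close>

interpretation cs: vector_space "cscale :: complex \<Rightarrow> ('a \<Rightarrow> 'b \<Rightarrow> complex) \<Rightarrow> _"
  by (rule vector_space_cscale)

interpretation csp: vector_space_pair "cscale :: complex \<Rightarrow> ('a \<Rightarrow> 'b \<Rightarrow> complex) \<Rightarrow> _"
    "cscale :: complex \<Rightarrow> ('c \<Rightarrow> 'd \<Rightarrow> complex) \<Rightarrow> _"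
  by (intro vector_space_pair.intro vector_space_cscale)

lemma sum_cscale_apply: "(\<Sum>a\<in>A. cscale (u a) (S a)) f = (\<Sum>a\<in>A. (\<lambda>i. u a * S a f i))"
  by (simp add: sum_fun_eval cscale_def)

lemma inner2_sum_cscale:
  assumes "\<And>a. a \<in> A \<Longrightarrow> S a \<in> Bop I J" "f \<in> ell2 I" "g \<in> ell2 J"
  shows "inner2 ((\<Sum>a\<in>A. cscale (u a) (S a)) f) g = (\<Sum>a\<in>A. u a * inner2 (S a f) g)"
proof -
  have "inner2 ((\<Sum>a\<in>A. cscale (u a) (S a)) f) g = (\<Sum>a\<in>A. inner2 (\<lambda>i. u a * S a f i) g)"
    unfolding sum_cscale_apply
    by (rule inner2_sum_left[where I = J and J = J]) (auto intro!: ell2_scale BopD(1)[OF assms(1)] assms(2,3))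
  then show ?thesis by (simp add: inner2_scale_left)
qed

lemma Bop_weak_zero:
  assumes S: "S \<in> Bop I J" and "\<And>f g. f \<in> ell2 I \<Longrightarrow> g \<in> ell2 J \<Longrightarrow> inner2 (S f) g = 0"
  shows "S = 0"
proof (rule Bop_eqI[OF S zero_in_Bop])
  fix i assume i: "i \<in> I"
  have "S (ket i) j = 0" for j
  proof (cases "j \<in> J")
    case True
    then show ?thesis using assms(2)[OF ket_in_ell2[OF i] ket_in_ell2] by (simp add: inner2_ket_right)
  qed (use ell2_outside[OF BopD(1)[OF S ket_in_ell2[OF i]]] in blast)
  then show "S (ket i) = 0 (ket i)" by (simp add: fun_eq_iff)
qed

text \<open>Matrix coefficients with respect to vectors \<open>f\<close>, \<open>f'\<close> of the first space turn the relation into linear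
relations between the \<open>T\<close>, so that \<open>\<Sum> u S T \<langle>S f, f'\<rangle> = 0\<close> for each \<open>T\<close>. Since \<open>f\<close> and \<open>f'\<close> are
arbitrary, this is a linear relation between the \<open>S\<close>.\<close>

lemma tensor_independent:
  assumes BA: "cs.independent BA" "BA \<subseteq> Bop I I" and BB: "cs.independent BB" "BB \<subseteq> Bop J J"
    and fin: "finite tA" "finite tB" "tA \<subseteq> BA" "tB \<subseteq> BB"
    and z: "(\<Sum>S\<in>tA. \<Sum>T\<in>tB. cscale (u S T) (op_tensor I J S T)) = 0"
    and ST: "S \<in> tA" "T \<in> tB"
  shows "u S T = 0"
proof -
  have A: "S \<in> Bop I I" if "S \<in> tA" for S using that BA fin by blast
  have B: "T \<in> Bop J J" if "T \<in> tB" for T using that BB fin by blast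
  have z': "(\<Sum>S\<in>tA. u S T * inner2 (S f) f') = 0" if f: "f \<in> ell2 I" "f' \<in> ell2 I" and T: "T \<in> tB" for f f' T
  proof (rule cs.independentD[OF BB(1) fin(2,4) _ T])
    let ?R = "\<Sum>T\<in>tB. cscale (\<Sum>S\<in>tA. u S T * inner2 (S f) f') T"
    have R: "?R \<in> Bop J J" using B by (intro Bop_sum_in Bop_cscale)
    show "?R = 0"
    proof (rule Bop_weak_zero[OF R])
      fix g g' assume g: "g \<in> ell2 J" "g' \<in> ell2 J"
      let ?v = "vec_tensor f g" and ?v' = "vec_tensor f' g'"
      have v: "?v \<in> ell2 (I \<times> J)" "?v' \<in> ell2 (I \<times> J)" using f g by (auto intro: vec_tensor_in_ell2)
      have "inner2 (?R g) g' = (\<Sum>T\<in>tB. (\<Sum>S\<in>tA. u S T * inner2 (S f) f') * inner2 (T g) g')"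
        using B g by (intro inner2_sum_cscale) auto
      also have "\<dots> = (\<Sum>T\<in>tB. \<Sum>S\<in>tA. u S T * inner2 (op_tensor I J S T ?v) ?v')"
        using A B f g by (auto simp: sum_distrib_right inner2_op_tensor mult.assoc intro!: sum.cong)
      also have "\<dots> = (\<Sum>S\<in>tA. \<Sum>T\<in>tB. u S T * inner2 (op_tensor I J S T ?v) ?v')"
        by (rule sum.swap)
      also have "\<dots> = (\<Sum>z\<in>tA \<times> tB. u (fst z) (snd z) * inner2 (op_tensor I J (fst z) (snd z) ?v) ?v')"
        by (simp add: sum.cartesian_product')
      also have "\<dots> = inner2 ((\<Sum>z\<in>tA \<times> tB. cscale (u (fst z) (snd z)) (op_tensor I J (fst z) (snd z))) ?v) ?v'"
        using A B v by (intro inner2_sum_cscale[symmetric, where I = "I \<times> J" and J = "I \<times> J"]) (auto intro: op_tensor_in_Bop)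
      also have "(\<Sum>z\<in>tA \<times> tB. cscale (u (fst z) (snd z)) (op_tensor I J (fst z) (snd z))) = 0"
        using z by (simp add: sum.cartesian_product')
      finally show "inner2 (?R g) g' = 0" by simp
    qed
  qed
  show ?thesis
  proof (rule cs.independentD[OF BA(1) fin(1,3) _ ST(1)])
    have R: "(\<Sum>S\<in>tA. cscale (u S T) S) \<in> Bop I I" using A by (intro Bop_sum_in Bop_cscale)
    show "(\<Sum>S\<in>tA. cscale (u S T) S) = 0"
      by (rule Bop_weak_zero[OF R]) (use A z'[OF _ _ ST(2)] in \<open>simp add: inner2_sum_cscale[where I = I and J = I]\<close>)
  qed
qed

text \<open>A finite set of pairs is contained in a rectangle, to which the coefficients are extended by \<open>0\<close>.
Injectivity is needed because independence is a property of the image as a set: two different pairs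
with the same product would be a relation as well.\<close>

lemma op_tensor_inj_on_independent:
  assumes BA: "cs.independent BA" "BA \<subseteq> Bop I I" and BB: "cs.independent BB" "BB \<subseteq> Bop J J"
  shows "inj_on (\<lambda>(S, T). op_tensor I J S T) (BA \<times> BB)"
    and "cs.independent ((\<lambda>(S, T). op_tensor I J S T) ` (BA \<times> BB))"
proof -
  let ?g = "\<lambda>(S, T). op_tensor I J S T"
  have rect: "u z = 0" if r: "finite r" "r \<subseteq> BA \<times> BB" "(\<Sum>z\<in>r. cscale (u z) (?g z)) = 0" "z \<in> r" for r u z
  proof -
    let ?A = "fst ` r" and ?B = "snd ` r"
    \<comment> \<open>The set \<open>r\<close> is enlarged to the rectangle \<open>?A \<times> ?B\<close>.\<close>
    have "(\<Sum>S\<in>?A. \<Sum>T\<in>?B. cscale (if (S, T) \<in> r then u (S, T) else 0) (op_tensor I J S T))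
       = (\<Sum>z\<in>?A \<times> ?B. cscale (if z \<in> r then u z else 0) (?g z))"
      by (simp add: sum.cartesian_product')
    also have "\<dots> = (\<Sum>z\<in>r. cscale (u z) (?g z))"
      using r(1) subset_fst_snd[of r] by (intro sum.mono_neutral_cong_right) auto
    finally have 0: "(\<Sum>S\<in>?A. \<Sum>T\<in>?B. cscale (if (S, T) \<in> r then u (S, T) else 0) (op_tensor I J S T)) = 0"
      using r by simp
    have "(if (fst z, snd z) \<in> r then u (fst z, snd z) else 0) = 0"
      by (rule tensor_independent[OF BA BB _ _ _ _ 0]) (use r in auto)
    then show ?thesis using r by simp
  qed
  show inj: "inj_on ?g (BA \<times> BB)"
  proof (rule inj_onI, rule ccontr)
    fix z w assume zw: "z \<in> BA \<times> BB" "w \<in> BA \<times> BB" "?g z = ?g w" "z \<noteq> w"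
    let ?u = "\<lambda>x. if x = z then 1 else -1 :: complex"
    have "(\<Sum>x\<in>{z, w}. cscale (?u x) (?g x)) = cscale 1 (?g w) + cscale (-1) (?g w)"
      using zw by simp
    also have "\<dots> = 0" by (simp add: cs.scale_minus_left)
    finally have "?u z = 0" using zw by (intro rect[of "{z, w}"]) auto
    then show False by simp
  qed
  have "u v = 0" if t: "finite t" "t \<subseteq> ?g ` (BA \<times> BB)" "(\<Sum>v\<in>t. cscale (u v) v) = 0" "v \<in> t" for t u v
  proof -
    obtain r where r: "r \<subseteq> BA \<times> BB" "finite r" "t = ?g ` r"
      using finite_subset_image[OF t(1,2)] by metis
    have 0: "(\<Sum>z\<in>r. cscale (u (?g z)) (?g z)) = 0"
      using t(3) unfolding r(3) by (subst (asm) sum.reindex) (use inj r in \<open>auto intro: inj_on_subset\<close>)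
    obtain z where z: "z \<in> r" "v = ?g z" using t r by blast
    have "u (?g z) = 0" using rect[OF r(2,1) 0 z(1)] .
    then show ?thesis unfolding z(2) .
  qed
  note ind = this
  show "cs.independent (?g ` (BA \<times> BB))"
  proof (rule notI)
    assume "cs.dependent (?g ` (BA \<times> BB))"
    then obtain t u where t: "finite t" "t \<subseteq> ?g ` (BA \<times> BB)" "(\<Sum>v\<in>t. cscale (u v) v) = 0" "\<exists>v\<in>t. u v \<noteq> 0"
      unfolding cs.dependent_explicit by (elim exE conjE)
    then obtain v where "v \<in> t" "u v \<noteq> 0" by blast
    with ind[OF t(1-3)] show False by blast
  qed
qed

lemma clinear_onD:
  assumes "clinear_on A \<phi>"
  shows "S \<in> A \<Longrightarrow> T \<in> A \<Longrightarrow> \<phi> (S + T) = \<phi> S + \<phi> T" "S \<in> A \<Longrightarrow> \<phi> (cscale c S) = cscale c (\<phi> S)"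
  using assms by (auto simp: clinear_on_def)

lemma clinear_on_0:
  assumes "cs.subspace A" "clinear_on A \<phi>"
  shows "\<phi> 0 = 0"
  using clinear_onD(2)[OF assms(2) cs.subspace_0[OF assms(1)], of 0] by simp

lemma clinear_on_eq_on_span:
  assumes A: "cs.subspace A" and f: "clinear_on A f" and g: "clinear_on A g"
    and B: "B \<subseteq> A" "A \<subseteq> cs.span B" and eq: "\<And>S. S \<in> B \<Longrightarrow> f S = g S" and S: "S \<in> A"
  shows "f S = g S"
proof -
  have "cs.subspace {S \<in> A. f S = g S}"
    using cs.subspace_0[OF A] cs.subspace_add[OF A] cs.subspace_scale[OF A]
    by (intro cs.subspaceI) (auto simp: clinear_onD[OF f] clinear_onD[OF g] clinear_on_0[OF A f] clinear_on_0[OF A g])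
  then have "cs.span B \<subseteq> {S \<in> A. f S = g S}"
    using B eq by (intro cs.span_minimal) auto
  then show ?thesis using S B by blast
qed

text \<open>The values are prescribed on the products of basis elements, which are independent, and the formula
for general elements follows by linearity in one argument at a time.\<close>

lemma tensor_functional_exists:
  fixes \<phi> :: "('i, 'i) op \<Rightarrow> nat \<Rightarrow> nat \<Rightarrow> complex" and \<psi> :: "('j, 'j) op \<Rightarrow> nat \<Rightarrow> nat \<Rightarrow> complex"
  assumes A: "cs.subspace A" "A \<subseteq> Bop I I" and B: "cs.subspace B" "B \<subseteq> Bop J J"
    and \<phi>: "clinear_on A \<phi>" and \<psi>: "clinear_on B \<psi>"
  shows "\<exists>\<Phi>. clinear_on (alg_tensor I J A B) \<Phi> \<and>
     (\<forall>S\<in>A. \<forall>T\<in>B. \<Phi> (op_tensor I J S T) = (\<lambda>(p, q) (p', q'). \<phi> S p p' * \<psi> T q q'))"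
proof -
  let ?m = "\<lambda>S T. \<lambda>(p, q) (p', q'). \<phi> S p p' * \<psi> T q q'"
  obtain BA where BA: "BA \<subseteq> A" "cs.independent BA" "A \<subseteq> cs.span BA"
    using cs.maximal_independent_subset[of A] by blast
  obtain BB where BB: "BB \<subseteq> B" "cs.independent BB" "B \<subseteq> cs.span BB"
    using cs.maximal_independent_subset[of B] by blast
  have BA': "BA \<subseteq> Bop I I" and BB': "BB \<subseteq> Bop J J" using BA A BB B by auto
  let ?g = "\<lambda>(S, T). op_tensor I J S T"
  note inj = op_tensor_inj_on_independent(1)[OF BA(2) BA' BB(2) BB']
  obtain \<Phi> where \<Phi>: "Vector_Spaces.linear cscale cscale \<Phi>"
      "\<forall>x\<in>?g ` (BA \<times> BB). \<Phi> x = (\<lambda>(S, T). ?m S T) (inv_into (BA \<times> BB) ?g x)"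
    using csp.linear_independent_extend[OF op_tensor_inj_on_independent(2)[OF BA(2) BA' BB(2) BB'],
        of "\<lambda>x. (\<lambda>(S, T). ?m S T) (inv_into (BA \<times> BB) ?g x)"] by blast
  have add: "\<Phi> (S + T) = \<Phi> S + \<Phi> T" and sc: "\<Phi> (cscale c S) = cscale c (\<Phi> S)" for S T c
    using \<Phi>(1) by (auto simp: Vector_Spaces.linear_iff)
  have base: "\<Phi> (op_tensor I J S T) = ?m S T" if "S \<in> BA" "T \<in> BB" for S T
  proof -
    have "inv_into (BA \<times> BB) ?g (?g (S, T)) = (S, T)"
      by (rule inv_into_f_f[OF inj]) (use that in auto)
    moreover have "?g (S, T) \<in> ?g ` (BA \<times> BB)" using that by blast
    ultimately show ?thesis using \<Phi>(2)[rule_format, of "?g (S, T)"] by simp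
  qed
  have 1: "\<Phi> (op_tensor I J S T) = ?m S T" if S: "S \<in> A" and T: "T \<in> BB" for S T
  proof (rule clinear_on_eq_on_span[OF A(1) _ _ BA(1,3) base[OF _ T] S])
    have T': "T \<in> Bop J J" using T BB' by blast
    show "clinear_on A (\<lambda>S. \<Phi> (op_tensor I J S T))"
      using A(2) T' by (auto simp: clinear_on_def op_tensor_add_left op_tensor_scale_left subset_iff add sc)
    show "clinear_on A (\<lambda>S. ?m S T)"
      by (auto simp: clinear_on_def clinear_onD[OF \<phi>] fun_eq_iff cscale_apply algebra_simps)
  qed
  have 2: "\<Phi> (op_tensor I J S T) = ?m S T" if S: "S \<in> A" and T: "T \<in> B" for S T
  proof (rule clinear_on_eq_on_span[OF B(1) _ _ BB(1,3) 1[OF S] T])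
    have S': "S \<in> Bop I I" using S A by blast
    show "clinear_on B (\<lambda>T. \<Phi> (op_tensor I J S T))"
      using B(2) S' by (auto simp: clinear_on_def op_tensor_add_right op_tensor_scale_right subset_iff add sc)
    show "clinear_on B (\<lambda>T. ?m S T)"
      by (auto simp: clinear_on_def clinear_onD[OF \<psi>] fun_eq_iff cscale_apply algebra_simps)
  qed
  show ?thesis unfolding clinear_on_def by (intro exI[of _ \<Phi>] conjI ballI allI add sc 2)
qed

text \<open>The choice in \<open>map_tensor\<close> is made among maps that exist, so the chosen map has the stated values.\<close>

lemma map_tensor_props:
  fixes \<phi> :: "('i, 'i) op \<Rightarrow> nat \<Rightarrow> nat \<Rightarrow> complex" and \<psi> :: "('j, 'j) op \<Rightarrow> nat \<Rightarrow> nat \<Rightarrow> complex"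
  assumes "cs.subspace A" "A \<subseteq> Bop I I" "cs.subspace B" "B \<subseteq> Bop J J" "clinear_on A \<phi>" "clinear_on B \<psi>"
  shows "clinear_on (alg_tensor I J A B) (map_tensor I J A B \<phi> \<psi>)"
    and "S \<in> A \<Longrightarrow> T \<in> B \<Longrightarrow> map_tensor I J A B \<phi> \<psi> (op_tensor I J S T) (p, q) (p', q') = \<phi> S p p' * \<psi> T q q'"
proof -
  have "clinear_on (alg_tensor I J A B) (map_tensor I J A B \<phi> \<psi>) \<and>
     (\<forall>S\<in>A. \<forall>T\<in>B. map_tensor I J A B \<phi> \<psi> (op_tensor I J S T) = (\<lambda>(p, q) (p', q'). \<phi> S p p' * \<psi> T q q'))"
    unfolding map_tensor_def by (rule someI_ex[OF tensor_functional_exists[OF assms]])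
  then show "clinear_on (alg_tensor I J A B) (map_tensor I J A B \<phi> \<psi>)"
    "S \<in> A \<Longrightarrow> T \<in> B \<Longrightarrow> map_tensor I J A B \<phi> \<psi> (op_tensor I J S T) (p, q) (p', q') = \<phi> S p p' * \<psi> T q q'"
    by auto
qed

lemma subspace_alg_tensor: "cs.subspace (alg_tensor I J A B)"
  unfolding alg_tensor_def by (rule cs.subspace_span)

lemma op_tensor_in_alg_tensor: "S \<in> A \<Longrightarrow> T \<in> B \<Longrightarrow> op_tensor I J S T \<in> alg_tensor I J A B"
  unfolding alg_tensor_def by (rule cs.span_base) blast

lemma subspace_Bop: "cs.subspace (Bop I J)"
  by (rule cs.subspaceI) (auto intro: zero_in_Bop Bop_add Bop_cscale)

lemma alg_tensor_subset_Bop: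
  assumes "A \<subseteq> Bop I I" "B \<subseteq> Bop J J"
  shows "alg_tensor I J A B \<subseteq> Bop (I \<times> J) (I \<times> J)"
  unfolding alg_tensor_def using assms by (intro cs.span_minimal subspace_Bop) (auto intro: op_tensor_in_Bop)

lemma clinear_on_alg_tensor_eqI:
  assumes \<Phi>: "clinear_on (alg_tensor I J A B) \<Phi>" and \<Psi>: "clinear_on (alg_tensor I J A B) \<Psi>"
    and eq: "\<And>S T. S \<in> A \<Longrightarrow> T \<in> B \<Longrightarrow> \<Phi> (op_tensor I J S T) = \<Psi> (op_tensor I J S T)"
    and w: "w \<in> alg_tensor I J A B"
  shows "\<Phi> w = \<Psi> w"
proof (rule clinear_on_eq_on_span[OF subspace_alg_tensor \<Phi> \<Psi> _ _ _ w])
  show "{op_tensor I J S T |S T. S \<in> A \<and> T \<in> B} \<subseteq> alg_tensor I J A B"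
    unfolding alg_tensor_def by (rule cs.span_superset)
  show "alg_tensor I J A B \<subseteq> cs.span {op_tensor I J S T |S T. S \<in> A \<and> T \<in> B}"
    by (simp add: alg_tensor_def)
  show "\<Phi> R = \<Psi> R" if "R \<in> {op_tensor I J S T |S T. S \<in> A \<and> T \<in> B}" for R
    using that eq by blast
qed

section \<open>The universal bi-isometry\<close>

lemma inner2_adj_left:
  assumes T: "T \<in> Bop I J" and "f \<in> ell2 I" "g \<in> ell2 J"
  shows "inner2 (adj I J T g) f = inner2 g (T f)"
  using inner2_adj[OF T assms(2,3)] inner2_commute by metis

lemma inner2_adj_comp:
  assumes U: "U \<in> Bop I J" and V: "V \<in> Bop I J" and "f \<in> ell2 I" "g \<in> ell2 I"
  shows "inner2 ((adj I J U \<circ> V) f) g = inner2 (V f) (U g)"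
  using inner2_adj_left[OF U assms(4) BopD(1)[OF V assms(3)]] by simp

lemma Bop_weak_eqI:
  assumes S: "S \<in> Bop I J" and T: "T \<in> Bop I J"
    and eq: "\<And>i j. i \<in> I \<Longrightarrow> j \<in> J \<Longrightarrow> inner2 (S (ket i)) (ket j) = inner2 (T (ket i)) (ket j)"
  shows "S = T"
proof (rule Bop_eqI[OF S T])
  fix i assume i: "i \<in> I"
  show "S (ket i) = T (ket i)"
  proof
    fix j show "S (ket i) j = T (ket i) j"
    proof (cases "j \<in> J")
      case True
      then show ?thesis using eq[OF i True] by (simp add: inner2_ket_right)
    qed (use ell2_outside[OF BopD(1)[OF S ket_in_ell2[OF i]]] ell2_outside[OF BopD(1)[OF T ket_in_ell2[OF i]]] in simp)
  qed
qed

text \<open>The identities that define bi-isometries, in terms of inner products of images of basis vectors. In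
this form they pass to direct sums and can be read off from a Gram factorisation.\<close>

lemma sum_adj_comp_eq_iff:
  assumes U: "\<And>a. a \<in> A \<Longrightarrow> U a \<in> Bop I J" and V: "\<And>a. a \<in> A \<Longrightarrow> V a \<in> Bop I J"
  shows "(\<Sum>a\<in>A. adj I J (U a) \<circ> V a) = (if P then id_op I else 0) \<longleftrightarrow>
    (\<forall>i\<in>I. \<forall>j\<in>I. (\<Sum>a\<in>A. inner2 (V a (ket i)) (U a (ket j))) = (if P \<and> i = j then 1 else 0))"
proof -
  let ?S = "\<Sum>a\<in>A. adj I J (U a) \<circ> V a" and ?D = "if P then id_op I else 0"
  have S: "?S \<in> Bop I I" using U V by (intro Bop_sum_in Bop_comp[OF adj_in_Bop]) auto
  have D: "?D \<in> Bop I I" by (simp add: id_op_in_Bop zero_in_Bop)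
  have 1: "inner2 (?S (ket i)) (ket j) = (\<Sum>a\<in>A. inner2 (V a (ket i)) (U a (ket j)))" if "i \<in> I" "j \<in> I" for i j
  proof -
    have k: "ket i \<in> ell2 I" "ket j \<in> ell2 I" using that by (auto intro: ket_in_ell2)
    have "inner2 (?S (ket i)) (ket j) = (\<Sum>a\<in>A. inner2 ((adj I J (U a) \<circ> V a) (ket i)) (ket j))"
      unfolding sum_fun_eval[where i = "ket i"]
      by (rule inner2_sum_left[where I = I and J = I]) (use U V k in \<open>auto intro!: BopD(1)[OF adj_in_Bop] intro: BopD(1)\<close>)
    also have "\<dots> = (\<Sum>a\<in>A. inner2 (V a (ket i)) (U a (ket j)))"
      using U V k by (intro sum.cong refl inner2_adj_comp) auto
    finally show ?thesis .
  qed
  have 2: "inner2 (?D (ket i)) (ket j) = (if P \<and> i = j then 1 else 0)" if "i \<in> I" "j \<in> I" for i j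
    using that by (auto simp: inner2_ket_right id_op_def ket_in_ell2) (auto simp: ket_def)
  have "?S = ?D \<longleftrightarrow> (\<forall>i\<in>I. \<forall>j\<in>I. inner2 (?S (ket i)) (ket j) = inner2 (?D (ket i)) (ket j))"
    using Bop_weak_eqI[OF S D] by auto
  then show ?thesis using 1 2 by simp
qed

lemma bi_isometry_iff:
  fixes V :: "'x::finite \<Rightarrow> 'x \<Rightarrow> ('k, 'k) op"
  shows "(I, J, V) \<in> bi_isometries \<longleftrightarrow> (\<forall>a x. V a x \<in> Bop I J) \<and>
    (\<forall>x x'. \<forall>i\<in>I. \<forall>j\<in>I. (\<Sum>a\<in>UNIV. inner2 (V a x' (ket i)) (V a x (ket j))) = (if x = x' \<and> i = j then 1 else 0)) \<and>
    (\<forall>a a'. \<forall>i\<in>I. \<forall>j\<in>I. (\<Sum>x\<in>UNIV. inner2 (V a' x (ket i)) (V a x (ket j))) = (if a = a' \<and> i = j then 1 else 0))"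
proof -
  have eq: "(I, J, V) \<in> bi_isometries \<longleftrightarrow> (\<forall>a x. V a x \<in> Bop I J) \<and>
     (\<forall>x x'. (\<Sum>a\<in>UNIV. adj I J (V a x) \<circ> V a x') = (if x = x' then id_op I else 0)) \<and>
     (\<forall>a a'. (\<Sum>x\<in>UNIV. adj I J (V a x) \<circ> V a' x) = (if a = a' then id_op I else 0))"
    unfolding bi_isometries_def by simp
  show ?thesis
  proof (cases "\<forall>a x. V a x \<in> Bop I J")
    case True
    then show ?thesis unfolding eq by (simp add: sum_adj_comp_eq_iff)
  next
    case False
    then show ?thesis unfolding eq by blast
  qed
qed

text \<open>The operators \<open>(V a x)\<^sup>* (V a x)\<close>, summed over \<open>a\<close>, give the identity. The resulting uniform bound is
what makes the direct sum over all representatives a bounded operator.\<close>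

lemma bi_isometry_norm_le:
  assumes V: "(I, J, V) \<in> bi_isometries" and f: "f \<in> ell2 I"
  shows "norm2 (V a x f) \<le> norm2 f"
proof -
  have VB: "V a x \<in> Bop I J" for a x using V by (simp add: bi_isometries_def)
  have s: "(\<Sum>a\<in>UNIV. adj I J (V a x) \<circ> V a x) = id_op I" using V by (simp add: bi_isometries_def)
  have "inner2 f f = inner2 ((\<Sum>a\<in>UNIV. adj I J (V a x) \<circ> V a x) f) f"
    unfolding s using f by (simp add: id_op_def)
  also have "\<dots> = (\<Sum>a\<in>UNIV. inner2 ((adj I J (V a x) \<circ> V a x) f) f)"
    unfolding sum_fun_eval[where i = f]
    by (rule inner2_sum_left[where I = I and J = I]) (use VB f in \<open>auto intro!: BopD(1)[OF adj_in_Bop[OF VB]] BopD(1)[OF VB]\<close>)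
  also have "\<dots> = (\<Sum>a\<in>UNIV. of_real ((norm2 (V a x f))\<^sup>2))"
    by (simp only: inner2_adj_comp[OF VB VB f f] inner2_self)
  finally have "(norm2 f)\<^sup>2 = (\<Sum>a\<in>UNIV. (norm2 (V a x f))\<^sup>2)"
    unfolding inner2_self of_real_sum[symmetric] by (simp only: of_real_eq_iff)
  moreover have "(norm2 (V a x f))\<^sup>2 \<le> (\<Sum>a\<in>UNIV. (norm2 (V a x f))\<^sup>2)"
    by (rule member_le_sum) auto
  ultimately have "(norm2 (V a x f))\<^sup>2 \<le> (norm2 f)\<^sup>2" by simp
  then show ?thesis by (rule power2_le_imp_le) simp
qed

lemma adj_id_op: "adj I I (id_op I) = id_op I"
  by (rule adj_eqI[OF id_op_in_Bop]) (simp add: id_op_def)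

lemma Bop_comp_id:
  assumes "T \<in> Bop I J"
  shows "id_op J \<circ> T = T" "T \<circ> id_op I = T"
  using BopD(1)[OF assms] BopD(4)[OF assms] Bop_0[OF assms] by (auto simp: id_op_def fun_eq_iff)

text \<open>Reflexivity makes every class nonempty, so that the choice of representatives succeeds.\<close>

lemma unitarily_equivalent_refl:
  assumes "v \<in> bi_isometries"
  shows "(v, v) \<in> unitarily_equivalent"
proof -
  obtain I J V where v: "v = (I, J, V)" by (cases v)
  have VB: "V a x \<in> Bop I J" for a x using assms v by (simp add: bi_isometries_def)
  have u: "unitary_op I I (id_op I)" "unitary_op J J (id_op J)"
    by (simp_all add: unitary_op_def id_op_in_Bop adj_id_op Bop_comp_id(1)[OF id_op_in_Bop])
  have "\<exists>U U'. unitary_op I I U \<and> unitary_op J J U' \<and> (\<forall>a x. U' \<circ> V a x = V a x \<circ> U)"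
    by (rule exI[of _ "id_op I"], rule exI[of _ "id_op J"]) (simp add: u Bop_comp_id[OF VB])
  then show ?thesis using assms unfolding v unitarily_equivalent_def by simp
qed

lemma bi_isometry_rep_exists:
  assumes "v \<in> bi_isometries"
  shows "\<exists>r\<in>bi_isometry_reps. (v, r) \<in> unitarily_equivalent"
proof
  let ?C = "unitarily_equivalent `` {v}"
  have "v \<in> ?C" using unitarily_equivalent_refl[OF assms] by simp
  then have "(SOME w. w \<in> ?C) \<in> ?C" by (rule someI)
  then show "(v, SOME w. w \<in> ?C) \<in> unitarily_equivalent" by simp
  show "(SOME w. w \<in> ?C) \<in> bi_isometry_reps"
    unfolding bi_isometry_reps_def by (intro imageI quotientI assms)
qed

lemma bi_isometry_reps_subset: "bi_isometry_reps \<subseteq> bi_isometries"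
proof
  fix r :: "('x::finite, 'k) block" assume "r \<in> bi_isometry_reps"
  then obtain v where v: "v \<in> bi_isometries" "r = (SOME w. w \<in> unitarily_equivalent `` {v})"
    unfolding bi_isometry_reps_def quotient_def by blast
  have "v \<in> unitarily_equivalent `` {v}" using unitarily_equivalent_refl[OF v(1)] by simp
  then have "r \<in> unitarily_equivalent `` {v}" unfolding v(2) by (rule someI)
  then show "r \<in> bi_isometries" by (auto simp: unitarily_equivalent_def)
qed

lemma rep_block_in_Bop:
  assumes "r \<in> bi_isometry_reps"
  shows "snd (snd r) a x \<in> Bop (fst r) (fst (snd r))"
proof -
  obtain I J V where "r = (I, J, V)" by (cases r)
  then show ?thesis using assms bi_isometry_reps_subset by (auto simp: bi_isometries_def)
qed

lemma rep_block_norm_le: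
  assumes "r \<in> bi_isometry_reps" "f \<in> ell2 (fst r)"
  shows "norm2 (snd (snd r) a x f) \<le> norm2 f"
proof -
  obtain I J V where r: "r = (I, J, V)" by (cases r)
  then show ?thesis using assms bi_isometry_reps_subset bi_isometry_norm_le[of I J V f] by auto
qed

lemma univ_bi_isometry_eq_dsum_op:
  "univ_bi_isometry a x = dsum_op bi_isometry_reps fst (\<lambda>v. fst (snd v)) (\<lambda>v. snd (snd v) a x)"
  unfolding univ_bi_isometry_def dsum_op_def univ_dom_def univ_cod_def slice_def ..

lemma univ_bi_isometry_in_Bop: "univ_bi_isometry a x \<in> Bop univ_dom univ_cod"
  unfolding univ_bi_isometry_eq_dsum_op univ_dom_def univ_cod_def
  by (rule dsum_op_in_Bop[where C = 1]) (auto simp: rep_block_in_Bop rep_block_norm_le)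

lemma univ_bi_isometry_emb:
  assumes "r \<in> bi_isometry_reps" "f \<in> ell2 (fst r)"
  shows "univ_bi_isometry a x (emb r f) = emb r (snd (snd r) a x f)"
  unfolding univ_bi_isometry_eq_dsum_op
  by (rule dsum_op_emb[where I = fst]) (use assms rep_block_in_Bop in auto)

lemma univ_e_in_Bop: "univ_e x x' a a' \<in> Bop univ_dom univ_dom"
  unfolding univ_e_def by (intro Bop_comp[OF adj_in_Bop] univ_bi_isometry_in_Bop)

lemma inner2_univ_e:
  assumes "f \<in> ell2 univ_dom" "g \<in> ell2 univ_dom"
  shows "inner2 (univ_e x x' a a' f) g = inner2 (univ_bi_isometry a' x' f) (univ_bi_isometry a x g)"
  unfolding univ_e_def by (rule inner2_adj_comp[OF univ_bi_isometry_in_Bop univ_bi_isometry_in_Bop assms])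

lemma
  fixes x x' :: "'x::finite"
  shows sum_univ_e_outputs: "(\<Sum>a\<in>UNIV. univ_e x x' a a :: (('x, 'k) univ_index, _) op) = (if x = x' then id_op univ_dom else 0)"
    and sum_univ_e_inputs: "(\<Sum>y\<in>UNIV. univ_e y y x x' :: (('x, 'k) univ_index, _) op) = (if x = x' then id_op univ_dom else 0)"
proof -
  let ?v = "univ_bi_isometry :: 'x \<Rightarrow> 'x \<Rightarrow> (('x, 'k) univ_index, _) op"
  have i: "inner2 (?v a x (ket (r, p))) (?v a' x' (ket (s, q))) =
      (if r = s then inner2 (snd (snd r) a x (ket p)) (snd (snd s) a' x' (ket q)) else 0)"
    if "r \<in> bi_isometry_reps" "s \<in> bi_isometry_reps" "p \<in> fst r" "q \<in> fst s" for r s p q a a' x x'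
    using that by (simp add: ket_pair univ_bi_isometry_emb ket_in_ell2 inner2_emb)
  have bi: "(\<Sum>a\<in>UNIV. inner2 (snd (snd r) a x' (ket i)) (snd (snd r) a x (ket j))) = (if x = x' \<and> i = j then 1 else 0)"
       "(\<Sum>y\<in>UNIV. inner2 (snd (snd r) x' y (ket i)) (snd (snd r) x y (ket j))) = (if x = x' \<and> i = j then 1 else 0)"
    if "r \<in> bi_isometry_reps" "i \<in> fst r" "j \<in> fst r" for r :: "('x, 'k) block" and i j
  proof -
    obtain I J V where r: "r = (I, J, V)" by (cases r)
    then have "(I, J, V) \<in> bi_isometries" using that bi_isometry_reps_subset by auto
    then show "(\<Sum>a\<in>UNIV. inner2 (snd (snd r) a x' (ket i)) (snd (snd r) a x (ket j))) = (if x = x' \<and> i = j then 1 else 0)"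
       "(\<Sum>y\<in>UNIV. inner2 (snd (snd r) x' y (ket i)) (snd (snd r) x y (ket j))) = (if x = x' \<and> i = j then 1 else 0)"
      unfolding bi_isometry_iff using that r by auto
  qed
  have "(\<Sum>a\<in>UNIV. adj univ_dom univ_cod (?v a x) \<circ> ?v a x') = (if x = x' then id_op univ_dom else 0)"
  proof (subst sum_adj_comp_eq_iff, safe)
    fix r s :: "('x, 'k) block" and p q assume "(r, p) \<in> univ_dom" "(s, q) \<in> univ_dom"
    then have m: "r \<in> bi_isometry_reps" "s \<in> bi_isometry_reps" "p \<in> fst r" "q \<in> fst s"
      by (auto simp: univ_dom_def)
    show "(\<Sum>a\<in>UNIV. inner2 (?v a x' (ket (r, p))) (?v a x (ket (s, q)))) = (if x = x' \<and> (r, p) = (s, q) then 1 else 0)"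
      using bi[OF m(1,3), of q] m by (cases "r = s") (simp_all add: i)
  qed (rule univ_bi_isometry_in_Bop)+
  then show "(\<Sum>a\<in>UNIV. univ_e x x' a a :: (('x, 'k) univ_index, _) op) = (if x = x' then id_op univ_dom else 0)"
    by (simp add: univ_e_def)
  have "(\<Sum>y\<in>UNIV. adj univ_dom univ_cod (?v x y) \<circ> ?v x' y) = (if x = x' then id_op univ_dom else 0)"
  proof (subst sum_adj_comp_eq_iff, safe)
    fix r s :: "('x, 'k) block" and p q assume "(r, p) \<in> univ_dom" "(s, q) \<in> univ_dom"
    then have m: "r \<in> bi_isometry_reps" "s \<in> bi_isometry_reps" "p \<in> fst r" "q \<in> fst s"
      by (auto simp: univ_dom_def)
    show "(\<Sum>y\<in>UNIV. inner2 (?v x' y (ket (r, p))) (?v x y (ket (s, q)))) = (if x = x' \<and> (r, p) = (s, q) then 1 else 0)"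
      using bi[OF m(1,3), of q] m by (cases "r = s") (simp_all add: i)
  qed (rule univ_bi_isometry_in_Bop)+
  then show "(\<Sum>y\<in>UNIV. univ_e y y x x' :: (('x, 'k) univ_index, _) op) = (if x = x' then id_op univ_dom else 0)"
    by (simp add: univ_e_def)
qed

text \<open>The form is the squared norm of \<open>\<Sum> v \<eta>\<close>. The map \<open>h\<close> allows the block index to be a number, as in
the definition of complete positivity.\<close>

lemma op_block_pos_univ_e:
  fixes h :: "'p \<Rightarrow> 'x::finite \<times> 'x"
  shows "op_block_pos univ_dom P (\<lambda>p q. univ_e (fst (h p)) (fst (h q)) (snd (h p)) (snd (h q)))"
  unfolding op_block_pos_def
proof (intro allI impI)
  fix \<eta> :: "'p \<Rightarrow> ('x, 'b) univ_index \<Rightarrow> complex" assume \<eta>: "\<forall>p\<in>P. \<eta> p \<in> ell2 univ_dom"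
  let ?v = "\<lambda>p. univ_bi_isometry (snd (h p)) (fst (h p)) (\<eta> p)"
  have v: "?v p \<in> ell2 univ_cod" if "p \<in> P" for p
    using that \<eta> by (intro BopD(1)[OF univ_bi_isometry_in_Bop]) auto
  have "(\<Sum>p\<in>P. \<Sum>q\<in>P. inner2 (univ_e (fst (h p)) (fst (h q)) (snd (h p)) (snd (h q)) (\<eta> q)) (\<eta> p))
     = (\<Sum>p\<in>P. \<Sum>q\<in>P. inner2 (?v q) (?v p))"
    using \<eta> by (intro sum.cong refl inner2_univ_e) auto
  also have "\<dots> = (\<Sum>p\<in>P. inner2 (\<Sum>q\<in>P. ?v q) (?v p))"
    using v by (intro sum.cong refl inner2_sum_left[symmetric]) auto
  also have "\<dots> = inner2 (\<Sum>q\<in>P. ?v q) (\<Sum>p\<in>P. ?v p)"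
    using v by (intro inner2_sum_right[symmetric] ell2_sum) auto
  also have "\<dots> \<in> \<real>\<^sub>\<ge>\<^sub>0" unfolding inner2_self by simp
  finally show "(\<Sum>p\<in>P. \<Sum>q\<in>P. inner2 (univ_e (fst (h p)) (fst (h q)) (snd (h p)) (snd (h q)) (\<eta> q)) (\<eta> p)) \<in> \<real>\<^sub>\<ge>\<^sub>0" .
qed

section \<open>Operator systems containing the generators\<close>

text \<open>The common properties of \<open>T_sys\<close> and \<open>C_alg\<close> from which both implications towards \<open>Q_qa_bi\<close> are derived.\<close>

definition gen_system :: "(('x::finite, 'k) univ_index, ('x, 'k) univ_index) op set \<Rightarrow> bool" where
  "gen_system A \<longleftrightarrow> cs.subspace A \<and> A \<subseteq> Bop univ_dom univ_dom \<and> e_gens \<subseteq> A"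

lemma gen_systemD:
  assumes "gen_system A"
  shows "cs.subspace A" "A \<subseteq> Bop univ_dom univ_dom" "univ_e x x' a a' \<in> A" "id_op univ_dom \<in> A"
proof -
  show A: "cs.subspace A" "A \<subseteq> Bop univ_dom univ_dom" using assms by (auto simp: gen_system_def)
  have e: "univ_e x x' a a' \<in> A" for x x' a a' using assms unfolding gen_system_def e_gens_def by blast
  then show "univ_e x x' a a' \<in> A" .
  have "(\<Sum>b\<in>UNIV. univ_e x x b b) \<in> A" for x using e by (intro cs.subspace_sum[OF A(1)])
  then show "id_op univ_dom \<in> A" by (simp add: sum_univ_e_outputs)
qed

lemma gen_system_T_sys: "gen_system T_sys"
  unfolding gen_system_def T_sys_def
  by (intro conjI cs.subspace_span cs.span_minimal subspace_Bop cs.span_superset)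
     (auto simp: e_gens_def univ_e_in_Bop)

lemma unital_cstar_subalgebra_Bop: "unital_cstar_subalgebra I (Bop I I)"
  by (auto simp: unital_cstar_subalgebra_def id_op_in_Bop Bop_add Bop_comp Bop_cscale adj_in_Bop op_closure_def)

lemma gen_system_C_alg: "gen_system (C_alg :: (('x::finite, 'k) univ_index, _) op set)"
proof -
  let ?D = "univ_dom :: ('x, 'k) univ_index set"
  let ?C = "C_alg :: (('x, 'k) univ_index, _) op set"
  let ?G = "e_gens :: (('x, 'k) univ_index, _) op set"
  let ?F = "{A. unital_cstar_subalgebra ?D A \<and> ?G \<subseteq> A}"
  have C: "?C = \<Inter>?F" unfolding C_alg_def cstar_generated_def ..
  have cl: "S + T \<in> A" "cscale c S \<in> A" "id_op ?D \<in> A"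
    if "unital_cstar_subalgebra ?D A" "S \<in> A" "T \<in> A" for A S T c
    using that by (simp_all add: unital_cstar_subalgebra_def)
  have e: "?G \<subseteq> Bop ?D ?D" by (auto simp: e_gens_def univ_e_in_Bop)
  have add: "S + T \<in> ?C" if "S \<in> ?C" "T \<in> ?C" for S T
    using that unfolding C by (auto intro: cl(1))
  have sc: "cscale c S \<in> ?C" if "S \<in> ?C" for c S
    using that unfolding C by (auto intro: cl(2))
  have gens: "?G \<subseteq> ?C" unfolding C by auto
  then have "univ_e x x' a a' \<in> ?C" for x x' a a' unfolding e_gens_def by blast
  from sc[OF this, of 0] have "0 \<in> ?C" by simp
  moreover have "?C \<subseteq> Bop ?D ?D"
    unfolding C using unital_cstar_subalgebra_Bop e by (intro Inter_lower) simp
  ultimately show ?thesis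
    unfolding gen_system_def using add sc gens by (intro conjI cs.subspaceI) auto
qed

lemma ucp_psd:
  fixes n :: nat
  assumes \<phi>: "ucp I A k \<phi>" and R: "\<And>i j. i < n \<Longrightarrow> j < n \<Longrightarrow> R i j \<in> A" and pos: "op_block_pos I {..<n} R"
  shows "psd_on ({..<n} \<times> {..<k}) (\<lambda>(i, p) (j, q). \<phi> (R i j) p q)"
proof -
  have "\<forall>(n::nat) R. (\<forall>i<n. \<forall>j<n. R i j \<in> A) \<and> op_block_pos I {..<n} R \<longrightarrow>
        psd_on ({..<n} \<times> {..<k}) (\<lambda>(i, p) (j, q). \<phi> (R i j) p q)"
    using \<phi> unfolding ucp_def by (elim conjE)
  from this[THEN spec[of _ n], THEN spec[of _ R]] show ?thesis using R pos by (elim impE) blast+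
qed

text \<open>The bistochastic identities are linear relations between the generators and the unit, and the
positivity of the block matrix of generators is preserved by complete positivity.\<close>

lemma ucp_bistoch_mat:
  fixes A :: "(('x::finite, 'k) univ_index, ('x, 'k) univ_index) op set"
  assumes A: "gen_system A" and \<phi>: "ucp univ_dom A k \<phi>"
  shows "bistoch_mat k (\<lambda>p q. \<phi> (univ_e (fst p) (fst q) (snd p) (snd q)))"
  unfolding bistoch_mat_def
proof (intro conjI allI impI)
  have lin: "clinear_on A \<phi>" and one: "\<phi> (id_op univ_dom) = (\<lambda>i j. if i = j \<and> i < k then 1 else 0)"
    using \<phi> by (auto simp: ucp_def)
  note A' = gen_systemD[OF A]
  have zero: "\<phi> 0 = 0" using clinear_onD(2)[OF lin cs.subspace_0[OF A'(1)], of 0] by simp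
  have sum: "\<phi> (\<Sum>b\<in>B. f b) = (\<Sum>b\<in>B. \<phi> (f b))" if "\<And>b. b \<in> B \<Longrightarrow> f b \<in> A" for B :: "'x set" and f
    using that by (induction B rule: infinite_finite_induct)
      (auto simp: zero clinear_onD(1)[OF lin] cs.subspace_sum[OF A'(1)])
  have d: "\<phi> (if P then id_op univ_dom else 0) i j = (if P \<and> i = j then 1 else 0)" if "i < k" for P i j
    using that by (simp add: one zero)
  show "(\<Sum>a\<in>UNIV. \<phi> (univ_e (fst (x, a)) (fst (x', a)) (snd (x, a)) (snd (x', a))) i j) = (if x = x' \<and> i = j then 1 else 0)"
    if "i < k" "j < k" for x x' i j
    using sum[of UNIV "\<lambda>a. univ_e x x' a a"] A'(3) d[OF that(1), of "x = x'" j]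
    by (simp add: sum_univ_e_outputs sum_fun_eval)
  show "(\<Sum>x\<in>UNIV. \<phi> (univ_e (fst (x, a)) (fst (x, a')) (snd (x, a)) (snd (x, a'))) i j) = (if a = a' \<and> i = j then 1 else 0)"
    if "i < k" "j < k" for a a' i j
    using sum[of UNIV "\<lambda>x. univ_e x x a a'"] A'(3) d[OF that(1), of "a = a'" j]
    by (simp add: sum_univ_e_inputs sum_fun_eval)
  obtain n :: nat and h :: "'x \<times> 'x \<Rightarrow> nat" where h: "h ` UNIV = {..<n}" "inj h"
    using finite_imp_inj_to_nat_seg[of "UNIV :: ('x \<times> 'x) set"] by (auto simp: lessThan_def)
  let ?g = "inv h"
  have "psd_on ({..<n} \<times> {..<k}) (\<lambda>(i, p) (j, q). \<phi> (univ_e (fst (?g i)) (fst (?g j)) (snd (?g i)) (snd (?g j))) p q)"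
    by (rule ucp_psd[OF \<phi> A'(3) op_block_pos_univ_e])
  moreover have "(\<lambda>z. (h (fst z), snd z)) ` (UNIV \<times> {..<k}) = {..<n} \<times> {..<k}"
    unfolding h(1)[symmetric] by force
  ultimately have "psd_on ((\<lambda>z. (h (fst z), snd z)) ` (UNIV \<times> {..<k}))
     (\<lambda>(i, p) (j, q). \<phi> (univ_e (fst (?g i)) (fst (?g j)) (snd (?g i)) (snd (?g j))) p q)" by simp
  moreover have "inj_on (\<lambda>z. (h (fst z), snd z)) (UNIV \<times> {..<k})"
    using h(2) by (auto simp: inj_on_def)
  ultimately have "psd_on (UNIV \<times> {..<k}) (\<lambda>z w. (\<lambda>(i, p) (j, q). \<phi> (univ_e (fst (?g i)) (fst (?g j)) (snd (?g i)) (snd (?g j))) p q)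
      (h (fst z), snd z) (h (fst w), snd w))"
    by (rule psd_on_reindex[rotated])
  then show "psd_on (UNIV \<times> {..<k}) (\<lambda>z w. \<phi> (univ_e (fst (fst z)) (fst (fst w)) (snd (fst z)) (snd (fst w))) (snd z) (snd w))"
    using h(2) by simp
qed

section \<open>Finite-dimensional compressions of the universal bi-isometry\<close>

definition mat_op :: "'i set \<Rightarrow> 'j set \<Rightarrow> ('j \<Rightarrow> 'i \<Rightarrow> complex) \<Rightarrow> ('i, 'j) op" where
  "mat_op I J m = (\<lambda>f. if f \<in> ell2 I then (\<lambda>j. if j \<in> J then \<Sum>i\<in>I. m j i * f i else 0) else 0)"

lemma mat_op_in_Bop:
  assumes "finite I" "finite J"
  shows "mat_op I J m \<in> Bop I J"
proof -
  let ?C = "\<Sum>j\<in>J. \<Sum>i\<in>I. cmod (m j i)"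
  have C: "?C \<ge> 0" by (intro sum_nonneg) auto
  have b: "mat_op I J m f \<in> ell2 J" "norm2 (mat_op I J m f) \<le> ?C * norm2 f" if f: "f \<in> ell2 I" for f
  proof -
    let ?g = "mat_op I J m f"
    have g: "cmod (?g j) \<le> (\<Sum>i\<in>I. cmod (m j i)) * norm2 f" if "j \<in> J" for j
    proof -
      have "cmod (?g j) \<le> (\<Sum>i\<in>I. cmod (m j i * f i))"
        using that f by (auto simp: mat_op_def intro: norm_sum)
      also have "\<dots> \<le> (\<Sum>i\<in>I. cmod (m j i) * norm2 f)"
        by (intro sum_mono) (auto simp: norm_mult intro!: mult_left_mono cmod_le_norm2[OF f])
      finally show ?thesis by (simp add: sum_distrib_right)
    qed
    have "(\<Sum>j\<in>F. (cmod (?g j))\<^sup>2) \<le> (?C * norm2 f)\<^sup>2" if F: "finite F" "F \<subseteq> J" for F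
    proof -
      have "(\<Sum>j\<in>F. (cmod (?g j))\<^sup>2) = (L2_set (\<lambda>j. cmod (?g j)) F)\<^sup>2"
        by (simp add: L2_set_def sum_nonneg)
      also have "\<dots> \<le> (\<Sum>j\<in>F. cmod (?g j))\<^sup>2"
        by (intro power_mono L2_set_le_sum) auto
      also have "\<dots> \<le> (?C * norm2 f)\<^sup>2"
      proof (rule power_mono)
        have "(\<Sum>j\<in>F. cmod (?g j)) \<le> (\<Sum>j\<in>J. cmod (?g j))"
          using assms F by (intro sum_mono2) auto
        also have "\<dots> \<le> (\<Sum>j\<in>J. (\<Sum>i\<in>I. cmod (m j i)) * norm2 f)"
          by (intro sum_mono g)
        finally show "(\<Sum>j\<in>F. cmod (?g j)) \<le> ?C * norm2 f" by (simp add: sum_distrib_right)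
      qed (intro sum_nonneg, simp)
      finally show ?thesis .
    qed
    then show "?g \<in> ell2 J" "norm2 ?g \<le> ?C * norm2 f"
      using ell2_boundedI[of J ?g "?C * norm2 f"] C by (auto simp: mat_op_def)
  qed
  show ?thesis
    by (rule BopI[OF b(1) _ _ b(2)])
       (auto simp: mat_op_def fun_eq_iff ell2_add ell2_scale algebra_simps sum.distrib sum_distrib_left)
qed

lemma mat_op_ket:
  assumes "finite I" "i \<in> I"
  shows "mat_op I J m (ket i) = (\<lambda>j. if j \<in> J then m j i else 0)"
  using assms by (auto simp: mat_op_def ket_in_ell2 fun_eq_iff) (simp add: ket_def if_distrib cong: if_cong)

lemma inner2_Bop_lincomb:
  assumes R: "R \<in> Bop K L" and v: "\<And>z. z \<in> Z \<Longrightarrow> v z \<in> ell2 K" and u: "\<And>z. z \<in> Y \<Longrightarrow> u z \<in> ell2 L"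
  shows "inner2 (R (\<Sum>w\<in>Z. (\<lambda>i. c w * v w i))) (\<Sum>z\<in>Y. (\<lambda>i. d z * u z i))
    = (\<Sum>z\<in>Y. \<Sum>w\<in>Z. cnj (d z) * inner2 (R (v w)) (u z) * c w)"
proof -
  have "R (\<Sum>w\<in>Z. (\<lambda>i. c w * v w i)) = (\<Sum>w\<in>Z. (\<lambda>j. c w * R (v w) j))"
    using v by (subst Bop_sum[OF R]) (auto intro!: ell2_scale sum.cong BopD(3)[OF R])
  then have "inner2 (R (\<Sum>w\<in>Z. (\<lambda>i. c w * v w i))) (\<Sum>z\<in>Y. (\<lambda>i. d z * u z i))
     = inner2 (\<Sum>w\<in>Z. (\<lambda>j. c w * R (v w) j)) (\<Sum>z\<in>Y. (\<lambda>i. d z * u z i))" by simp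
  also have "\<dots> = (\<Sum>z\<in>Y. inner2 (\<Sum>w\<in>Z. (\<lambda>j. c w * R (v w) j)) (\<lambda>i. d z * u z i))"
    using u v by (intro inner2_sum_right[where I = L and J = L]) (auto intro!: ell2_scale ell2_sum BopD(1)[OF R])
  also have "\<dots> = (\<Sum>z\<in>Y. \<Sum>w\<in>Z. inner2 (\<lambda>j. c w * R (v w) j) (\<lambda>i. d z * u z i))"
    using u v by (intro sum.cong refl inner2_sum_left[where I = L and J = L]) (auto intro!: ell2_scale BopD(1)[OF R])
  finally show ?thesis by (simp add: inner2_scale_left inner2_scale_right mult_ac)
qed

lemma ell2_finite_eq_sum:
  assumes "finite K" "\<xi> \<in> ell2 K"
  shows "\<xi> = (\<Sum>z\<in>K. (\<lambda>i. \<xi> z * ket z i))"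
  using cut_eq_sum[OF assms(1), of \<xi>] cut_finite[OF assms(2)] by simp

text \<open>In finite dimensions \<open>\<xi>\<close> is the sum of its coordinates times basis vectors, and those are elementary
tensors.\<close>

lemma inner2_op_tensor_finite:
  assumes S: "S \<in> Bop I I" and T: "T \<in> Bop J J" and fin: "finite I" "finite J" and \<xi>: "\<xi> \<in> ell2 (I \<times> J)"
  shows "inner2 (op_tensor I J S T \<xi>) \<xi> = (\<Sum>z\<in>I \<times> J. \<Sum>w\<in>I \<times> J.
    cnj (\<xi> z) * (S (ket (fst w)) (fst z) * T (ket (snd w)) (snd z)) * \<xi> w)"
proof -
  let ?R = "op_tensor I J S T"
  have fin': "finite (I \<times> J)" using fin by simp
  note e = ell2_finite_eq_sum[OF fin' \<xi>]
  have "inner2 (?R \<xi>) \<xi> = inner2 (?R (\<Sum>w\<in>I \<times> J. (\<lambda>i. \<xi> w * ket w i))) (\<Sum>z\<in>I \<times> J. (\<lambda>i. \<xi> z * ket z i))"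
    by (rule arg_cong2[where f = "\<lambda>u v. inner2 (?R u) v", OF e e])
  also have "\<dots> = (\<Sum>z\<in>I \<times> J. \<Sum>w\<in>I \<times> J. cnj (\<xi> z) * inner2 (?R (ket w)) (ket z) * \<xi> w)"
    by (rule inner2_Bop_lincomb[OF op_tensor_in_Bop[OF S T] ket_in_ell2 ket_in_ell2])
  also have "\<dots> = (\<Sum>z\<in>I \<times> J. \<Sum>w\<in>I \<times> J.
    cnj (\<xi> z) * (S (ket (fst w)) (fst z) * T (ket (snd w)) (snd z)) * \<xi> w)"
  proof (intro sum.cong refl)
    fix z w assume zw: "z \<in> I \<times> J" "w \<in> I \<times> J"
    have "?R (ket w) = vec_tensor (S (ket (fst w))) (T (ket (snd w)))"
      using ket_tensor[of "fst w" "snd w"] zw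
      by (auto simp: op_tensor_vec_tensor[OF S T] ket_in_ell2)
    then show "cnj (\<xi> z) * inner2 (?R (ket w)) (ket z) * \<xi> w =
       cnj (\<xi> z) * (S (ket (fst w)) (fst z) * T (ket (snd w)) (snd z)) * \<xi> w"
      by (simp add: inner2_ket_right vec_tensor_def case_prod_beta)
  qed
  finally show ?thesis .
qed

lemma unit_vec_iff_norm2:
  assumes "finite K" "\<xi> \<in> ell2 K"
  shows "unit_vec K \<xi> \<longleftrightarrow> norm2 \<xi> = 1"
proof -
  have "(\<Sum>z\<in>K. cnj (\<xi> z) * \<xi> z) = of_real ((norm2 \<xi>)\<^sup>2)"
    using inner2_finite[OF assms, of \<xi>] by (simp only: inner2_self[symmetric] mult.commute)
  then have "unit_vec K \<xi> \<longleftrightarrow> (norm2 \<xi>)\<^sup>2 = 1"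
    unfolding unit_vec_def by (metis of_real_eq_1_iff)
  then show ?thesis using norm2_nonneg[of \<xi>] by (auto simp: power2_eq_1_iff)
qed

lemma bistochastic_op_matrix_mat_op:
  fixes E :: "'x::finite \<times> 'x \<Rightarrow> 'x \<times> 'x \<Rightarrow> nat \<Rightarrow> nat \<Rightarrow> complex"
  assumes E: "bistoch_mat k E"
  shows "bistochastic_op_matrix {..<k} (\<lambda>x x' a a'. mat_op {..<k} {..<k} (E (x, a) (x', a')))"
proof -
  let ?M = "\<lambda>p q. mat_op {..<k} {..<k} (E p q)"
  have B: "?M p q \<in> Bop {..<k} {..<k}" for p q by (rule mat_op_in_Bop) auto
  have "op_block_pos {..<k} UNIV ?M"
    unfolding op_block_pos_def
  proof (intro allI impI)
    fix \<eta> :: "'x \<times> 'x \<Rightarrow> nat \<Rightarrow> complex" assume \<eta>: "\<forall>p\<in>UNIV. \<eta> p \<in> ell2 {..<k}"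
    have "inner2 (?M p q (\<eta> q)) (\<eta> p) = (\<Sum>i<k. \<Sum>j<k. cnj (\<eta> p i) * E p q i j * \<eta> q j)" for p q
    proof -
      have q: "\<eta> q \<in> ell2 {..<k}" using \<eta> by blast
      have "inner2 (?M p q (\<eta> q)) (\<eta> p) = (\<Sum>i<k. ?M p q (\<eta> q) i * cnj (\<eta> p i))"
        by (rule inner2_finite[OF _ BopD(1)[OF B q]]) simp
      also have "\<dots> = (\<Sum>i<k. \<Sum>j<k. cnj (\<eta> p i) * E p q i j * \<eta> q j)"
        by (intro sum.cong refl) (simp add: mat_op_def q sum_distrib_left mult_ac)
      finally show ?thesis .
    qed
    then have "(\<Sum>p\<in>UNIV. \<Sum>q\<in>UNIV. inner2 (?M p q (\<eta> q)) (\<eta> p))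
       = (\<Sum>p\<in>UNIV. \<Sum>q\<in>UNIV. \<Sum>i<k. \<Sum>j<k. cnj (\<eta> p i) * E p q i j * \<eta> q j)" by simp
    also have "\<dots> = (\<Sum>p\<in>UNIV. \<Sum>i<k. \<Sum>q\<in>UNIV. \<Sum>j<k. cnj (\<eta> p i) * E p q i j * \<eta> q j)"
      by (intro sum.cong refl sum.swap)
    also have "\<dots> = (\<Sum>z\<in>UNIV \<times> {..<k}. \<Sum>w\<in>UNIV \<times> {..<k}. cnj (\<eta> (fst z) (snd z)) * E (fst z) (fst w) (snd z) (snd w) * \<eta> (fst w) (snd w))"
      by (simp add: sum.cartesian_product')
    also have "\<dots> \<in> \<real>\<^sub>\<ge>\<^sub>0"
      using E unfolding bistoch_mat_def
      by (elim conjE) (erule psd_onD[where c = "\<lambda>z. \<eta> (fst z) (snd z)"])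
    finally show "(\<Sum>p\<in>UNIV. \<Sum>q\<in>UNIV. inner2 (?M p q (\<eta> q)) (\<eta> p)) \<in> \<real>\<^sub>\<ge>\<^sub>0" .
  qed
  moreover have sm: "(\<Sum>a\<in>A. ?M (p a) (q a)) = (if P then id_op {..<k} else 0)"
    if "\<And>i j. i < k \<Longrightarrow> j < k \<Longrightarrow> (\<Sum>a\<in>A. E (p a) (q a) i j) = (if P \<and> i = j then 1 else 0)" for A :: "'a set" and p q P
  proof (rule Bop_weak_eqI)
    show "(\<Sum>a\<in>A. ?M (p a) (q a)) \<in> Bop {..<k} {..<k}" by (intro Bop_sum_in B)
    show "(if P then id_op {..<k} else 0) \<in> Bop {..<k} {..<k}" by (simp add: id_op_in_Bop zero_in_Bop)
    fix i j assume "i \<in> {..<k}" "j \<in> {..<k}"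
    then show "inner2 ((\<Sum>a\<in>A. ?M (p a) (q a)) (ket i)) (ket j) = inner2 ((if P then id_op {..<k} else 0) (ket i)) (ket j)"
      using that[of j i]
      by (auto simp: inner2_ket_right sum_fun_eval mat_op_ket id_op_def ket_in_ell2) (auto simp: ket_def)
  qed
  moreover have "(\<Sum>a\<in>UNIV. ?M (x, a) (x', a)) = (if x = x' then id_op {..<k} else 0)" for x x'
    using E by (intro sm) (simp add: bistoch_mat_def)
  moreover have "(\<Sum>x\<in>UNIV. ?M (x, a) (x, a')) = (if a = a' then id_op {..<k} else 0)" for a a'
    using E by (intro sm) (simp add: bistoch_mat_def)
  ultimately show ?thesis
    using B unfolding bistochastic_op_matrix_def by (simp add: case_prod_unfold)
qed

text \<open>Positivity of the coordinate matrix is positivity of the block operator matrix at vectors written in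
the basis.\<close>

lemma bistoch_mat_of_op_matrix:
  fixes E :: "'x::finite \<Rightarrow> 'x \<Rightarrow> 'x \<Rightarrow> 'x \<Rightarrow> ('i, 'i) op"
  assumes E: "bistochastic_op_matrix I E" and h: "bij_betw h {..<k} I"
  shows "bistoch_mat k (\<lambda>p q i j. E (fst p) (fst q) (snd p) (snd q) (ket (h j)) (h i))"
  unfolding bistoch_mat_def
proof (intro conjI allI impI)
  have hI: "h i \<in> I" if "i < k" for i using h that by (auto simp: bij_betw_def)
  have inj: "h i = h j \<longleftrightarrow> i = j" if "i < k" "j < k" for i j using h that by (auto simp: bij_betw_def inj_on_def)
  have B: "E x x' a a' \<in> Bop I I" for x x' a a' using E by (simp add: bistochastic_op_matrix_def)
  have d: "(if P then id_op I else 0) (ket (h j)) (h i) = (if P \<and> i = j then 1 else 0)" if "i < k" "j < k" for P i j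
    using that by (auto simp: id_op_def ket_in_ell2 hI) (auto simp: ket_def inj)
  show "(\<Sum>a\<in>UNIV. E (fst (x, a)) (fst (x', a)) (snd (x, a)) (snd (x', a)) (ket (h j)) (h i)) = (if x = x' \<and> i = j then 1 else 0)"
    if "i < k" "j < k" for x x' i j
  proof -
    have "(\<Sum>a\<in>UNIV. E x x' a a) = (if x = x' then id_op I else 0)" using E by (simp add: bistochastic_op_matrix_def)
    then have "(\<Sum>a\<in>UNIV. E x x' a a) (ket (h j)) (h i) = (if x = x' then id_op I else 0) (ket (h j)) (h i)" by simp
    then show ?thesis unfolding d[OF that] by (simp add: sum_fun_eval)
  qed
  show "(\<Sum>x\<in>UNIV. E (fst (x, a)) (fst (x, a')) (snd (x, a)) (snd (x, a')) (ket (h j)) (h i)) = (if a = a' \<and> i = j then 1 else 0)"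
    if "i < k" "j < k" for a a' i j
  proof -
    have "(\<Sum>x\<in>UNIV. E x x a a') = (if a = a' then id_op I else 0)" using E by (simp add: bistochastic_op_matrix_def)
    then have "(\<Sum>x\<in>UNIV. E x x a a') (ket (h j)) (h i) = (if a = a' then id_op I else 0) (ket (h j)) (h i)" by simp
    then show ?thesis unfolding d[OF that] by (simp add: sum_fun_eval)
  qed
  show "psd_on (UNIV \<times> {..<k}) (\<lambda>z w. E (fst (fst z)) (fst (fst w)) (snd (fst z)) (snd (fst w)) (ket (h (snd w))) (h (snd z)))"
    unfolding psd_on_def
  proof
    fix c :: "('x \<times> 'x) \<times> nat \<Rightarrow> complex"
    let ?E = "\<lambda>p q. E (fst p) (fst q) (snd p) (snd q)"
    let ?\<eta> = "\<lambda>p. \<Sum>j<k. (\<lambda>l. c (p, j) * ket (h j) l)"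
    have \<eta>: "?\<eta> p \<in> ell2 I" for p by (intro ell2_sum ell2_scale ket_in_ell2 hI) simp
    have "op_block_pos I UNIV ?E"
      using E by (simp add: bistochastic_op_matrix_def case_prod_unfold)
    then have "(\<forall>p\<in>UNIV. ?\<eta> p \<in> ell2 I) \<longrightarrow> (\<Sum>p\<in>UNIV. \<Sum>q\<in>UNIV. inner2 (?E p q (?\<eta> q)) (?\<eta> p)) \<in> \<real>\<^sub>\<ge>\<^sub>0"
      unfolding op_block_pos_def by (rule spec)
    then have "(\<Sum>p\<in>UNIV. \<Sum>q\<in>UNIV. inner2 (?E p q (?\<eta> q)) (?\<eta> p)) \<in> \<real>\<^sub>\<ge>\<^sub>0"
      using \<eta> by blast
    also have "(\<Sum>p\<in>UNIV. \<Sum>q\<in>UNIV. inner2 (?E p q (?\<eta> q)) (?\<eta> p))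
      = (\<Sum>p\<in>UNIV. \<Sum>q\<in>UNIV. \<Sum>i<k. \<Sum>j<k. cnj (c (p, i)) * ?E p q (ket (h j)) (h i) * c (q, j))"
      by (intro sum.cong refl) (subst inner2_Bop_lincomb[OF B], auto simp: ket_in_ell2 hI inner2_ket_right)
    also have "\<dots> = (\<Sum>p\<in>UNIV. \<Sum>i<k. \<Sum>q\<in>UNIV. \<Sum>j<k. cnj (c (p, i)) * ?E p q (ket (h j)) (h i) * c (q, j))"
      by (intro sum.cong refl sum.swap)
    also have "\<dots> = (\<Sum>z\<in>UNIV \<times> {..<k}. \<Sum>w\<in>UNIV \<times> {..<k}. cnj (c z) * ?E (fst z) (fst w) (ket (h (snd w))) (h (snd z)) * c w)"
      by (simp only: sum.cartesian_product' fst_conv snd_conv)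
    finally show "\<dots> \<in> \<real>\<^sub>\<ge>\<^sub>0" .
  qed
qed

text \<open>The Gram vectors of \<open>E\<close> are the columns of \<open>V\<close>. The finite index sets of both Hilbert spaces are moved
into \<open>'k\<close> by injections, which exist because \<open>'k\<close> is infinite.\<close>

lemma finite_bi_isometry_exists:
  fixes E :: "'x::finite \<times> 'x \<Rightarrow> 'x \<times> 'x \<Rightarrow> nat \<Rightarrow> nat \<Rightarrow> complex"
  assumes E: "bistoch_mat k E" and inf: "infinite (UNIV :: 'k set)"
  shows "\<exists>I J V (b :: nat \<Rightarrow> 'k). ((I, J, V) :: ('x, 'k) block) \<in> bi_isometries \<and> inj b \<and> I = b ` {..<k} \<and>
    (\<forall>p q. \<forall>i<k. \<forall>j<k. inner2 (V (snd q) (fst q) (ket (b j))) (V (snd p) (fst p) (ket (b i))) = E p q i j)"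
proof -
  obtain b :: "nat \<Rightarrow> 'k" where b: "inj b"
    using infinite_countable_subset[OF inf] by blast
  let ?R = "(UNIV :: ('x \<times> 'x) set) \<times> {..<k}"
  obtain t :: "('x \<times> 'x) \<times> nat \<Rightarrow> nat" where t: "inj_on t ?R"
    using finite_imp_inj_to_nat_seg[of ?R] by auto
  let ?c = "b \<circ> t"
  have c: "inj_on ?c ?R" by (rule comp_inj_on[OF t inj_on_subset[OF b]]) simp
  obtain g :: "('x \<times> 'x) \<times> nat \<Rightarrow> _" where g: "\<forall>z\<in>?R. \<forall>w\<in>?R. E (fst z) (fst w) (snd z) (snd w) = (\<Sum>r\<in>?R. cnj (g r z) * g r w)"
    using psd_on_imp_gram[of ?R "\<lambda>z w. E (fst z) (fst w) (snd z) (snd w)"] E by (auto simp: bistoch_mat_def)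
  define I where "I = b ` {..<k}"
  define J where "J = ?c ` ?R"
  define V where "V a x = mat_op I J (\<lambda>j i. g (inv_into ?R ?c j) ((x, a), inv b i))" for a x
  have fin: "finite I" "finite J" by (simp_all add: I_def J_def)
  have VB: "V a x \<in> Bop I J" for a x unfolding V_def by (rule mat_op_in_Bop[OF fin])
  have Vk: "V a x (ket (b i)) = (\<lambda>j. if j \<in> J then g (inv_into ?R ?c j) ((x, a), i) else 0)" if "i < k" for a x i
    unfolding V_def using that b by (subst mat_op_ket[OF fin(1)]) (auto simp: I_def)
  have inn: "inner2 (V a' x' (ket (b j))) (V a x (ket (b i))) = E (x, a) (x', a') i j" if "i < k" "j < k" for a a' x x' i j
  proof -
    have "V a' x' (ket (b j)) \<in> ell2 J" using that by (intro BopD(1)[OF VB] ket_in_ell2) (simp add: I_def)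
    then have "inner2 (V a' x' (ket (b j))) (V a x (ket (b i))) = (\<Sum>l\<in>J. g (inv_into ?R ?c l) ((x', a'), j) * cnj (g (inv_into ?R ?c l) ((x, a), i)))"
      using that by (subst inner2_finite[OF fin(2)]) (auto simp: Vk intro!: sum.cong)
    also have "\<dots> = (\<Sum>r\<in>?R. g r ((x', a'), j) * cnj (g r ((x, a), i)))"
    proof -
      have ir: "inv_into ?R ?c (b (t r)) = r" if "r \<in> ?R" for r
        using inv_into_f_f[OF c that] by (simp only: o_apply)
      show ?thesis
        unfolding J_def sum.reindex[OF c] by (intro sum.cong refl) (simp only: o_apply ir)
    qed
    also have "\<dots> = E (x, a) (x', a') i j"
      using bspec[OF bspec[OF g], of "((x, a), i)" "((x', a'), j)"] that by (simp add: mult.commute)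
    finally show ?thesis .
  qed
  have Es: "(\<Sum>a\<in>UNIV. E (x, a) (x', a) i j) = (if x = x' \<and> i = j then 1 else 0)"
      "(\<Sum>y\<in>UNIV. E (y, x) (y, x') i j) = (if x = x' \<and> i = j then 1 else 0)" if "i < k" "j < k" for x x' i j
    using E that by (simp_all add: bistoch_mat_def)
  have "(I, J, V) \<in> bi_isometries"
    unfolding bi_isometry_iff
  proof (intro conjI allI ballI)
    show "V a x \<in> Bop I J" for a x by (rule VB)
    fix i j assume "i \<in> I" "j \<in> I"
    then obtain i' j' where ij: "i = b i'" "i' < k" "j = b j'" "j' < k" by (auto simp: I_def)
    have eq: "b i' = b j' \<longleftrightarrow> i' = j'" using b by (auto dest: injD)
    show "(\<Sum>a\<in>UNIV. inner2 (V a x' (ket i)) (V a x (ket j))) = (if x = x' \<and> i = j then 1 else 0)" for x x'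
      using ij(2,4) unfolding ij(1,3) eq by (auto simp: inn Es)
    show "(\<Sum>x\<in>UNIV. inner2 (V a' x (ket i)) (V a x (ket j))) = (if a = a' \<and> i = j then 1 else 0)" for a a'
      using ij(2,4) unfolding ij(1,3) eq by (auto simp: inn Es)
  qed
  then show ?thesis using b I_def inn by (intro exI[of _ I] exI[of _ J] exI[of _ V] exI[of _ b]) auto
qed

text \<open>The finite bi-isometry is unitarily equivalent to one of the summands of the universal one. Its basis
vectors, transported to that summand, form the family \<open>u\<close>; inner products are not changed by the
unitaries.\<close>

lemma univ_compression_exists:
  fixes E :: "'x::finite \<times> 'x \<Rightarrow> 'x \<times> 'x \<Rightarrow> nat \<Rightarrow> nat \<Rightarrow> complex"
  assumes E: "bistoch_mat k E" and inf: "infinite (UNIV :: 'k set)"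
  shows "\<exists>u :: nat \<Rightarrow> ('x, 'k) univ_index \<Rightarrow> complex. (\<forall>i<k. u i \<in> ell2 univ_dom) \<and>
    (\<forall>i<k. \<forall>j<k. inner2 (u i) (u j) = (if i = j then 1 else 0)) \<and>
    (\<forall>p q. \<forall>i<k. \<forall>j<k. inner2 (univ_e (fst p) (fst q) (snd p) (snd q) (u j)) (u i) = E p q i j)"
proof -
  obtain I J V and b :: "nat \<Rightarrow> 'k" where V: "((I, J, V) :: ('x, 'k) block) \<in> bi_isometries" "inj b" "I = b ` {..<k}"
    "\<forall>p q. \<forall>i<k. \<forall>j<k. inner2 (V (snd q) (fst q) (ket (b j))) (V (snd p) (fst p) (ket (b i))) = E p q i j"
    using finite_bi_isometry_exists[OF assms] by (elim exE conjE)
  obtain r where r: "r \<in> bi_isometry_reps" "((I, J, V), r) \<in> unitarily_equivalent"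
    using bi_isometry_rep_exists[OF V(1)] by blast
  obtain I' J' W where rW: "r = (I', J', W)" by (cases r)
  have "\<exists>U U'. unitary_op I I' U \<and> unitary_op J J' U' \<and> (\<forall>a x. U' \<circ> V a x = W a x \<circ> U)"
    using r(2) unfolding rW unitarily_equivalent_def by simp
  then obtain U U' where U: "unitary_op I I' U" "unitary_op J J' U'" "\<And>a x. U' \<circ> V a x = W a x \<circ> U"
    by (elim exE conjE) blast
  have iso: "inner2 (T f) (T g) = inner2 f g" if T: "unitary_op K K' T" and fg: "f \<in> ell2 K" "g \<in> ell2 K" for K K' :: "'k set" and T f g
  proof -
    have TB: "T \<in> Bop K K'" and c: "adj K K' T \<circ> T = id_op K" using T by (auto simp: unitary_op_def)
    have "inner2 (T f) (T g) = inner2 f ((adj K K' T \<circ> T) g)"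
      using inner2_adj[OF TB fg(1) BopD(1)[OF TB fg(2)]] by simp
    then show ?thesis unfolding c using fg by (simp add: id_op_def)
  qed
  have UB: "U \<in> Bop I I'" using U(1) by (simp add: unitary_op_def)
  have VB: "V a x \<in> Bop I J" for a x using V(1) by (simp add: bi_isometries_def)
  define u where "u i = emb r (U (ket (b i)))" for i
  have k: "ket (b i) \<in> ell2 I" if "i < k" for i using that V(3) by (auto intro: ket_in_ell2)
  have Uk: "U (ket (b i)) \<in> ell2 I'" if "i < k" for i by (rule BopD(1)[OF UB k[OF that]])
  have u1: "u i \<in> ell2 univ_dom" if "i < k" for i
    unfolding u_def univ_dom_def using r(1) Uk[OF that] by (intro emb_in_ell2) (auto simp: rW)
  have u2: "inner2 (u i) (u j) = (if i = j then 1 else 0)" if "i < k" "j < k" for i j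
    unfolding u_def inner2_emb using iso[OF U(1) k[OF that(1)] k[OF that(2)]] injD[OF V(2), of j i]
    by (auto simp: inner2_ket_right) (auto simp: ket_def)
  have vu: "univ_bi_isometry a x (u i) = emb r (U' (V a x (ket (b i))))" if "i < k" for a x i
    unfolding u_def using univ_bi_isometry_emb[OF r(1), of "U (ket (b i))" a x] Uk[OF that] fun_cong[OF U(3), of a x "ket (b i)"]
    by (simp add: rW)
  have u3: "inner2 (univ_e (fst p) (fst q) (snd p) (snd q) (u j)) (u i) = E p q i j" if "i < k" "j < k" for p q i j
    unfolding inner2_univ_e[OF u1[OF that(2)] u1[OF that(1)]] vu[OF that(1)] vu[OF that(2)] inner2_emb
    using iso[OF U(2) BopD(1)[OF VB k[OF that(2)]] BopD(1)[OF VB k[OF that(1)]]] V(4) that by simp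
  show ?thesis by (intro exI[of _ u] conjI allI impI u1 u2 u3)
qed

section \<open>Vector states and the minimal tensor product\<close>

definition compression :: "nat \<Rightarrow> (nat \<Rightarrow> 'i \<Rightarrow> complex) \<Rightarrow> ('i, 'i) op \<Rightarrow> nat \<Rightarrow> nat \<Rightarrow> complex" where
  "compression k u S = (\<lambda>i j. if i < k \<and> j < k then inner2 (S (u j)) (u i) else 0)"

definition orthonormal_upto :: "'i set \<Rightarrow> nat \<Rightarrow> (nat \<Rightarrow> 'i \<Rightarrow> complex) \<Rightarrow> bool" where
  "orthonormal_upto I k u \<longleftrightarrow> (\<forall>i<k. u i \<in> ell2 I) \<and>
     (\<forall>i<k. \<forall>j<k. inner2 (u i) (u j) = (if i = j then 1 else 0))"

lemma compression_clinear:
  assumes "A \<subseteq> Bop I I" "\<And>i. i < k \<Longrightarrow> u i \<in> ell2 I"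
  shows "clinear_on A (compression k u)"
proof -
  have "inner2 ((S + T) (u j)) (u i) = inner2 (S (u j)) (u i) + inner2 (T (u j)) (u i)"
    if "S \<in> A" "T \<in> A" "i < k" "j < k" for S T i j
  proof -
    have "S \<in> Bop I I" "T \<in> Bop I I" using assms(1) that by auto
    then show ?thesis
      using inner2_add_left[where I = I and J = I, OF BopD(1)[of S I I] BopD(1)[of T I I]] assms(2) that by simp
  qed
  then show ?thesis
    by (auto simp: clinear_on_def compression_def fun_eq_iff cscale_apply inner2_scale_left)
qed

text \<open>Matrix coefficients with respect to an orthonormal family: a block vector with coefficients \<open>c\<close> corresponds
to the vectors \<open>\<Sum> c u\<close>, at which the block positivity of \<open>R\<close> is applied.\<close>

lemma ucp_compression:
  assumes A: "A \<subseteq> Bop I I" and u: "orthonormal_upto I k u"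
  shows "ucp I A k (compression k u)"
  unfolding ucp_def
proof (intro conjI allI ballI impI)
  have uI: "u i \<in> ell2 I" if "i < k" for i using u that by (simp add: orthonormal_upto_def)
  show "clinear_on A (compression k u)" using A uI by (rule compression_clinear)
  show "compression k u T i j = 0" if "\<not> (i < k \<and> j < k)" for T i j
    using that by (auto simp: compression_def)
  show "compression k u (id_op I) = (\<lambda>i j. if i = j \<and> i < k then 1 else 0)"
    using u uI by (auto simp: compression_def fun_eq_iff id_op_def orthonormal_upto_def)
  fix n :: nat and R :: "nat \<Rightarrow> nat \<Rightarrow> ('a, 'a) op"
  assume R: "(\<forall>i<n. \<forall>j<n. R i j \<in> A) \<and> op_block_pos I {..<n} R"
  then have RB: "R i j \<in> Bop I I" if "i < n" "j < n" for i j using A that by auto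
  show "psd_on ({..<n} \<times> {..<k}) (\<lambda>(i, p) (j, q). compression k u (R i j) p q)"
    unfolding psd_on_def
  proof
    fix c :: "nat \<times> nat \<Rightarrow> complex"
    let ?\<eta> = "\<lambda>i. \<Sum>p<k. (\<lambda>l. c (i, p) * u p l)"
    have \<eta>: "?\<eta> i \<in> ell2 I" for i by (intro ell2_sum ell2_scale uI) simp
    have "(\<forall>p\<in>{..<n}. ?\<eta> p \<in> ell2 I) \<longrightarrow> (\<Sum>i<n. \<Sum>j<n. inner2 (R i j (?\<eta> j)) (?\<eta> i)) \<in> \<real>\<^sub>\<ge>\<^sub>0"
      using conjunct2[OF R] unfolding op_block_pos_def by (rule spec)
    then have "(\<Sum>i<n. \<Sum>j<n. inner2 (R i j (?\<eta> j)) (?\<eta> i)) \<in> \<real>\<^sub>\<ge>\<^sub>0" using \<eta> by blast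
    also have "(\<Sum>i<n. \<Sum>j<n. inner2 (R i j (?\<eta> j)) (?\<eta> i))
      = (\<Sum>i<n. \<Sum>j<n. \<Sum>p<k. \<Sum>q<k. cnj (c (i, p)) * compression k u (R i j) p q * c (j, q))"
    proof (intro sum.cong refl)
      fix i j assume "i \<in> {..<n}" "j \<in> {..<n}"
      then have "inner2 (R i j (?\<eta> j)) (?\<eta> i) = (\<Sum>p<k. \<Sum>q<k. cnj (c (i, p)) * inner2 (R i j (u q)) (u p) * c (j, q))"
        by (intro inner2_Bop_lincomb[where K = I and L = I]) (auto simp: RB uI)
      also have "\<dots> = (\<Sum>p<k. \<Sum>q<k. cnj (c (i, p)) * compression k u (R i j) p q * c (j, q))"
        by (intro sum.cong refl) (simp add: compression_def)
      finally show "inner2 (R i j (?\<eta> j)) (?\<eta> i) = (\<Sum>p<k. \<Sum>q<k. cnj (c (i, p)) * compression k u (R i j) p q * c (j, q))" .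
    qed
    also have "\<dots> = (\<Sum>i<n. \<Sum>p<k. \<Sum>j<n. \<Sum>q<k. cnj (c (i, p)) * compression k u (R i j) p q * c (j, q))"
      by (intro sum.cong refl sum.swap)
    also have "\<dots> = (\<Sum>z\<in>{..<n} \<times> {..<k}. \<Sum>w\<in>{..<n} \<times> {..<k}. cnj (c z) * (\<lambda>(i, p) (j, q). compression k u (R i j) p q) z w * c w)"
      by (simp only: sum.cartesian_product' prod.case)
    finally show "\<dots> \<in> \<real>\<^sub>\<ge>\<^sub>0" .
  qed
qed

text \<open>Both sides are linear in \<open>w\<close> and agree on elementary tensors.\<close>

lemma map_tensor_compression:
  assumes A: "cs.subspace A" "A \<subseteq> Bop I I" and B: "cs.subspace B" "B \<subseteq> Bop J J"
    and u: "\<And>i. i < k \<Longrightarrow> u i \<in> ell2 I" and v: "\<And>j. j < m \<Longrightarrow> v j \<in> ell2 J"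
    and w: "w \<in> alg_tensor I J A B" and ind: "p < k" "q < m" "p' < k" "q' < m"
  shows "map_tensor I J A B (compression k u) (compression m v) w (p, q) (p', q')
    = inner2 (w (vec_tensor (u p') (v q'))) (vec_tensor (u p) (v q))"
proof -
  let ?\<Phi> = "map_tensor I J A B (compression k u) (compression m v)"
  have cl: "clinear_on A (compression k u)" "clinear_on B (compression m v)"
    using compression_clinear[where u = u and k = k, OF A(2)] compression_clinear[where u = v and k = m, OF B(2)] u v by auto
  note mt = map_tensor_props[OF A B cl]
  let ?f = "vec_tensor (u p') (v q')" and ?g = "vec_tensor (u p) (v q)"
  have fg: "?f \<in> ell2 (I \<times> J)" "?g \<in> ell2 (I \<times> J)" using u v ind by (auto intro: vec_tensor_in_ell2)
  \<comment> \<open>The uniqueness statement concerns maps with values in functions of two indices, so both scalars are turned into constant functions.\<close>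
  have "(\<lambda>_ _. ?\<Phi> w (p, q) (p', q')) = (\<lambda>(_::unit) (_::unit). inner2 (w ?f) ?g)"
  proof (rule clinear_on_alg_tensor_eqI[OF _ _ _ w, where \<Phi> = "\<lambda>w _ _. ?\<Phi> w (p, q) (p', q')"])
    show "clinear_on (alg_tensor I J A B) (\<lambda>w (_::unit) (_::unit). ?\<Phi> w (p, q) (p', q'))"
      using mt(1) by (auto simp: clinear_on_def fun_eq_iff cscale_apply)
    show "clinear_on (alg_tensor I J A B) (\<lambda>w _ _. inner2 (w ?f) ?g)"
      unfolding clinear_on_def
    proof (intro conjI ballI allI)
      fix S T assume "S \<in> alg_tensor I J A B" "T \<in> alg_tensor I J A B"
      then have ST: "S \<in> Bop (I \<times> J) (I \<times> J)" "T \<in> Bop (I \<times> J) (I \<times> J)"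
        using alg_tensor_subset_Bop[OF A(2) B(2)] by auto
      have "inner2 ((S + T) ?f) ?g = inner2 (S ?f) ?g + inner2 (T ?f) ?g"
        using inner2_add_left[OF BopD(1)[OF ST(1) fg(1)] BopD(1)[OF ST(2) fg(1)] fg(2)] by simp
      then show "(\<lambda>_ _. inner2 ((S + T) ?f) ?g) = (\<lambda>_ _. inner2 (S ?f) ?g) + (\<lambda>_ _. inner2 (T ?f) ?g)"
        by (simp only: fun_eq_iff plus_fun_apply simp_thms)
    qed (simp add: fun_eq_iff cscale_apply inner2_scale_left)
    show "(\<lambda>_ _. ?\<Phi> (op_tensor I J S T) (p, q) (p', q')) = (\<lambda>_ _. inner2 (op_tensor I J S T ?f) ?g)"
      if "S \<in> A" "T \<in> B" for S T
    proof -
      have "S \<in> Bop I I" "T \<in> Bop J J" using that A B by auto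
      then have "inner2 (op_tensor I J S T ?f) ?g = inner2 (S (u p')) (u p) * inner2 (T (v q')) (v q)"
        using ind u v by (intro inner2_op_tensor) auto
      then show ?thesis using mt(2)[OF that] ind by (simp add: compression_def)
    qed
  qed
  then show ?thesis by (simp add: fun_eq_iff)
qed

lemma min_cone_subset: "min_cone I J A B \<subseteq> alg_tensor I J A B"
  by (auto simp: min_cone_def min_pos_def)

text \<open>Positivity in the minimal tensor product is tested with the two compressions, at the coefficient vector
\<open>c\<close> of \<open>\<zeta>\<close>.\<close>

lemma min_cone_vector_nonneg:
  assumes A: "cs.subspace A" "A \<subseteq> Bop I I" and B: "cs.subspace B" "B \<subseteq> Bop J J"
    and u: "orthonormal_upto I k u" and v: "orthonormal_upto J m v"
    and w: "w \<in> min_cone I J A B"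
    and \<zeta>: "\<zeta> = (\<Sum>z\<in>{..<k} \<times> {..<m}. (\<lambda>l. c z * vec_tensor (u (fst z)) (v (snd z)) l))"
  shows "inner2 (w \<zeta>) \<zeta> \<in> \<real>\<^sub>\<ge>\<^sub>0"
proof -
  have uI: "u i \<in> ell2 I" if "i < k" for i using u that by (simp add: orthonormal_upto_def)
  have vJ: "v i \<in> ell2 J" if "i < m" for i using v that by (simp add: orthonormal_upto_def)
  have wT: "w \<in> alg_tensor I J A B" using w min_cone_subset by blast
  have wB: "w \<in> Bop (I \<times> J) (I \<times> J)" using wT alg_tensor_subset_Bop[OF A(2) B(2)] by blast
  let ?\<Phi> = "map_tensor I J A B (compression k u) (compression m v)"
  have "psd_on ({..<1::nat} \<times> {..<k} \<times> {..<m}) (\<lambda>(i, p) (j, q). ?\<Phi> w p q)"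
    using w ucp_compression[OF A(2) u] ucp_compression[OF B(2) v]
    unfolding min_cone_def min_pos_def mem_Collect_eq by blast
  then have "(\<Sum>z\<in>{..<1::nat} \<times> {..<k} \<times> {..<m}. \<Sum>z'\<in>{..<1::nat} \<times> {..<k} \<times> {..<m}.
      cnj (c (snd z)) * (\<lambda>(i, p) (j, q). ?\<Phi> w p q) z z' * c (snd z')) \<in> \<real>\<^sub>\<ge>\<^sub>0"
    by (rule psd_onD[where c = "\<lambda>z. c (snd z)"])
  also have "(\<Sum>z\<in>{..<1::nat} \<times> {..<k} \<times> {..<m}. \<Sum>z'\<in>{..<1::nat} \<times> {..<k} \<times> {..<m}.
      cnj (c (snd z)) * (\<lambda>(i, p) (j, q). ?\<Phi> w p q) z z' * c (snd z'))
    = (\<Sum>z\<in>{..<k} \<times> {..<m}. \<Sum>z'\<in>{..<k} \<times> {..<m}. cnj (c z) * ?\<Phi> w z z' * c z')"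
    by (simp add: sum.cartesian_product' lessThan_Suc)
  also have "\<dots> = (\<Sum>z\<in>{..<k} \<times> {..<m}. \<Sum>z'\<in>{..<k} \<times> {..<m}.
      cnj (c z) * inner2 (w (vec_tensor (u (fst z')) (v (snd z')))) (vec_tensor (u (fst z)) (v (snd z))) * c z')"
  proof (intro sum.cong refl)
    fix z z' assume "z \<in> {..<k} \<times> {..<m}" "z' \<in> {..<k} \<times> {..<m}"
    then have "?\<Phi> w (fst z, snd z) (fst z', snd z')
      = inner2 (w (vec_tensor (u (fst z')) (v (snd z')))) (vec_tensor (u (fst z)) (v (snd z)))"
      by (intro map_tensor_compression[OF A B _ _ wT]) (auto intro: uI vJ)
    then show "cnj (c z) * ?\<Phi> w z z' * c z' =
      cnj (c z) * inner2 (w (vec_tensor (u (fst z')) (v (snd z')))) (vec_tensor (u (fst z)) (v (snd z))) * c z'"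
      by simp
  qed
  also have "\<dots> = inner2 (w \<zeta>) \<zeta>"
    unfolding \<zeta>
    by (rule inner2_Bop_lincomb[OF wB, symmetric]) (auto intro!: vec_tensor_in_ell2 uI vJ)
  finally show ?thesis .
qed

text \<open>The vector \<open>\<zeta>\<close> has the coordinates \<open>c\<close> with respect to the elementary tensors of the two
orthonormal families to which the generators compress as \<open>E\<close> and \<open>F\<close>.\<close>

lemma vector_state_exists:
  fixes E :: "'x::finite \<times> 'x \<Rightarrow> 'x \<times> 'x \<Rightarrow> nat \<Rightarrow> nat \<Rightarrow> complex"
    and F :: "'y::finite \<times> 'y \<Rightarrow> 'y \<times> 'y \<Rightarrow> nat \<Rightarrow> nat \<Rightarrow> complex"
  assumes E: "bistoch_mat k E" and F: "bistoch_mat m F" and c: "unit_vec ({..<k} \<times> {..<m}) c"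
    and inf: "infinite (UNIV :: 'k set)"
  shows "\<exists>\<zeta> :: ('x, 'k) univ_index \<times> ('y, 'k) univ_index \<Rightarrow> complex.
     \<zeta> \<in> ell2 (univ_dom \<times> univ_dom) \<and> norm2 \<zeta> = 1 \<and>
     (\<forall>A B w. gen_system A \<longrightarrow> gen_system B \<longrightarrow> w \<in> min_cone univ_dom univ_dom A B \<longrightarrow> inner2 (w \<zeta>) \<zeta> \<in> \<real>\<^sub>\<ge>\<^sub>0) \<and>
     (\<forall>p q. inner2 (op_tensor univ_dom univ_dom
          (univ_e (fst (fst p)) (fst (fst q)) (snd (fst p)) (snd (fst q)))
          (univ_e (fst (snd p)) (fst (snd q)) (snd (snd p)) (snd (snd q))) \<zeta>) \<zeta> = mat_corr {..<k} E {..<m} F c p q)"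
proof -
  let ?D = "univ_dom :: ('x, 'k) univ_index set" and ?D' = "univ_dom :: ('y, 'k) univ_index set"
  obtain u :: "nat \<Rightarrow> ('x, 'k) univ_index \<Rightarrow> complex" where u: "\<forall>i<k. u i \<in> ell2 univ_dom"
    "\<forall>i<k. \<forall>j<k. inner2 (u i) (u j) = (if i = j then 1 else 0)"
    "\<forall>p q. \<forall>i<k. \<forall>j<k. inner2 (univ_e (fst p) (fst q) (snd p) (snd q) (u j)) (u i) = E p q i j"
    using univ_compression_exists[OF E inf] by (elim exE conjE)
  obtain v :: "nat \<Rightarrow> ('y, 'k) univ_index \<Rightarrow> complex" where v: "\<forall>i<m. v i \<in> ell2 univ_dom"
    "\<forall>i<m. \<forall>j<m. inner2 (v i) (v j) = (if i = j then 1 else 0)"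
    "\<forall>p q. \<forall>i<m. \<forall>j<m. inner2 (univ_e (fst p) (fst q) (snd p) (snd q) (v j)) (v i) = F p q i j"
    using univ_compression_exists[OF F inf] by (elim exE conjE)
  have ou: "orthonormal_upto ?D k u" and ov: "orthonormal_upto ?D' m v"
    using u v by (simp_all add: orthonormal_upto_def)
  let ?K = "{..<k} \<times> {..<m}"
  let ?t = "\<lambda>z. vec_tensor (u (fst z)) (v (snd z))"
  define \<zeta> where "\<zeta> = (\<Sum>z\<in>?K. (\<lambda>l. c z * ?t z l))"
  have t: "?t z \<in> ell2 (?D \<times> ?D')" if "z \<in> ?K" for z
    using that u(1) v(1) by (auto intro!: vec_tensor_in_ell2)
  have \<zeta>: "\<zeta> \<in> ell2 (?D \<times> ?D')" unfolding \<zeta>_def by (intro ell2_sum ell2_scale t)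
  have val: "inner2 (op_tensor ?D ?D' S T \<zeta>) \<zeta> = (\<Sum>z\<in>?K. \<Sum>w\<in>?K.
      cnj (c z) * (inner2 (S (u (fst w))) (u (fst z)) * inner2 (T (v (snd w))) (v (snd z))) * c w)"
    if S: "S \<in> Bop ?D ?D" and T: "T \<in> Bop ?D' ?D'" for S T
  proof -
    have "inner2 (op_tensor ?D ?D' S T \<zeta>) \<zeta> = (\<Sum>z\<in>?K. \<Sum>w\<in>?K. cnj (c z) * inner2 (op_tensor ?D ?D' S T (?t w)) (?t z) * c w)"
      unfolding \<zeta>_def by (rule inner2_Bop_lincomb[OF op_tensor_in_Bop[OF S T] t t])
    also have "\<dots> = (\<Sum>z\<in>?K. \<Sum>w\<in>?K.
      cnj (c z) * (inner2 (S (u (fst w))) (u (fst z)) * inner2 (T (v (snd w))) (v (snd z))) * c w)"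
      using u(1) v(1) by (intro sum.cong refl) (auto simp: inner2_op_tensor[OF S T])
    finally show ?thesis .
  qed
  have "inner2 (id_op (?D \<times> ?D') \<zeta>) \<zeta> = (\<Sum>z\<in>?K. \<Sum>w\<in>?K. if w = z then cnj (c z) * c z else 0)"
    unfolding op_tensor_id[symmetric] val[OF id_op_in_Bop id_op_in_Bop]
    using u(1,2) v(1,2) by (intro sum.cong refl) (auto simp: id_op_def prod_eq_iff)
  also have "\<dots> = 1" using c by (simp add: unit_vec_def)
  finally have "of_real ((norm2 \<zeta>)\<^sup>2) = (1 :: complex)"
    using \<zeta> by (simp only: id_op_def inner2_self if_True)
  then have "(norm2 \<zeta>)\<^sup>2 = 1" by (metis of_real_eq_1_iff)
  then have n: "norm2 \<zeta> = 1" using norm2_nonneg[of \<zeta>] by (simp add: power2_eq_1_iff)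
  have cone: "inner2 (w \<zeta>) \<zeta> \<in> \<real>\<^sub>\<ge>\<^sub>0"
    if "gen_system A" "gen_system B" "w \<in> min_cone ?D ?D' A B" for A B w
    by (rule min_cone_vector_nonneg[OF gen_systemD(1,2)[OF that(1)] gen_systemD(1,2)[OF that(2)] ou ov that(3) \<zeta>_def])
  have mc: "inner2 (op_tensor ?D ?D' (univ_e (fst (fst p)) (fst (fst q)) (snd (fst p)) (snd (fst q)))
          (univ_e (fst (snd p)) (fst (snd q)) (snd (snd p)) (snd (snd q))) \<zeta>) \<zeta> = mat_corr {..<k} E {..<m} F c p q" for p q
    unfolding val[OF univ_e_in_Bop univ_e_in_Bop] mat_corr_def
    using u(3) v(3) by (intro sum.cong refl) (auto simp: mem_Times_iff)
  show ?thesis by (intro exI[of _ \<zeta>] conjI allI impI \<zeta> n cone mc)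
qed

section \<open>Limits of vector states\<close>

text \<open>By Tychonoff's theorem the functions bounded by \<open>C\<close> form a compact set, so the image filter of the
sequence clusters at some \<open>s\<close>. The filter \<open>G\<close> refines the sequence so that it converges to \<open>s\<close>; this
replaces a subsequence, which need not exist for uncountable index types.\<close>

lemma pointwise_cluster_point:
  fixes S :: "nat \<Rightarrow> 'w \<Rightarrow> complex"
  assumes bd: "\<And>n w. cmod (S n w) \<le> C w"
  shows "\<exists>s G. G \<noteq> bot \<and> G \<le> sequentially \<and> (\<forall>w. ((\<lambda>n. S n w) \<longlongrightarrow> s w) G)"
proof -
  let ?U = "PiE UNIV (\<lambda>w. cball 0 (C w)) :: ('w \<Rightarrow> complex) set"
  have "compactin (product_topology (\<lambda>_. euclidean) UNIV) ?U"
    unfolding compactin_PiE by simp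
  then have comp: "compact ?U" by (simp add: euclidean_product_topology)
  let ?F = "filtermap S sequentially"
  have "?F \<noteq> bot" by (simp add: filtermap_bot_iff)
  moreover have "eventually (\<lambda>x. x \<in> ?U) ?F"
    using bd by (simp add: eventually_filtermap PiE_UNIV_domain)
  ultimately obtain s where s: "inf (nhds s) ?F \<noteq> bot"
    using comp unfolding compact_filter by blast
  let ?G = "inf (filtercomap S (nhds s)) sequentially"
  have "?G \<noteq> bot"
  proof
    assume "?G = bot"
    then have "eventually (\<lambda>_. False) ?G" by simp
    then obtain Q R where QR: "eventually Q (filtercomap S (nhds s))" "eventually R sequentially" "\<forall>x. Q x \<and> R x \<longrightarrow> False"
      unfolding eventually_inf by blast
    obtain P where P: "eventually P (nhds s)" "\<forall>x. P (S x) \<longrightarrow> Q x"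
      using QR(1) unfolding eventually_filtercomap by blast
    have "eventually (\<lambda>x. \<exists>n. R n \<and> x = S n) ?F"
      using QR(2) unfolding eventually_filtermap by (rule eventually_mono) blast
    then have "eventually (\<lambda>_. False) (inf (nhds s) ?F)"
      unfolding eventually_inf using P QR(3) by blast
    then show False using s by (simp add: eventually_False)
  qed
  moreover have "?G \<le> sequentially" by simp
  moreover have "((\<lambda>n. S n w) \<longlongrightarrow> s w) ?G" for w
  proof -
    have "(S \<longlongrightarrow> s) ?G" unfolding filterlim_iff_le_filtercomap by simp
    then show ?thesis
      using continuous_on_tendsto_compose[OF continuous_on_product_coordinates[of w]] by simp
  qed
  ultimately show ?thesis by blast
qed

lemma vector_functional_norm_le:
  assumes w: "w \<in> Bop K K" and \<zeta>: "\<zeta> \<in> ell2 K" "norm2 \<zeta> = 1"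
  shows "cmod (inner2 (w \<zeta>) \<zeta>) \<le> op_norm K w"
  using Cauchy_Schwarz2[OF BopD(1)[OF w \<zeta>(1)] \<zeta>(1)] op_norm_bound[OF w \<zeta>(1)] \<zeta>(2) by simp

text \<open>Vector functionals are continuous in the operator norm, and the nonnegative reals are closed.\<close>

lemma op_closure_vector_nonneg:
  assumes P: "P \<subseteq> Bop K K" and pos: "\<And>p. p \<in> P \<Longrightarrow> inner2 (p \<zeta>) \<zeta> \<in> \<real>\<^sub>\<ge>\<^sub>0"
    and \<zeta>: "\<zeta> \<in> ell2 K" "norm2 \<zeta> = 1" and w: "w \<in> op_closure K P"
  shows "inner2 (w \<zeta>) \<zeta> \<in> \<real>\<^sub>\<ge>\<^sub>0"
proof -
  have wB: "w \<in> Bop K K" using w by (simp add: op_closure_def)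
  have "inner2 (w \<zeta>) \<zeta> \<in> closure \<real>\<^sub>\<ge>\<^sub>0"
    unfolding closure_approachable
  proof (intro allI impI)
    fix e :: real assume "e > 0"
    then obtain p where p: "p \<in> P" "op_norm K (w - p) < e" using w by (auto simp: op_closure_def)
    have pB: "p \<in> Bop K K" using p P by blast
    have wp: "w - p \<in> Bop K K" by (rule cs.subspace_diff[OF subspace_Bop wB pB])
    have "inner2 ((w - p) \<zeta>) \<zeta> = inner2 (w \<zeta>) \<zeta> - inner2 (p \<zeta>) \<zeta>"
      using inner2_diff_left[OF BopD(1)[OF wB \<zeta>(1)] BopD(1)[OF pB \<zeta>(1)] \<zeta>(1)] by simp
    then have "dist (inner2 (p \<zeta>) \<zeta>) (inner2 (w \<zeta>) \<zeta>) < e"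
      using vector_functional_norm_le[OF wp \<zeta>] p(2) by (simp add: dist_norm norm_minus_commute)
    then show "\<exists>y\<in>\<real>\<^sub>\<ge>\<^sub>0. dist y (inner2 (w \<zeta>) \<zeta>) < e" using pos[OF p(1)] by blast
  qed
  then show ?thesis by simp
qed

lemma subset_op_closure:
  assumes "P \<subseteq> Bop K K"
  shows "P \<subseteq> op_closure K P"
proof
  fix w assume w: "w \<in> P"
  have "op_norm K (w - w) = 0" by (simp add: op_norm_0)
  then show "w \<in> op_closure K P" using assms w by (auto simp: op_closure_def intro!: bexI[of _ w])
qed

text \<open>Additivity, homogeneity, positivity and normalisation are closed conditions. The space \<open>A\<close> and the cone
\<open>P\<close> are left open so that a single functional is a state on both tensor products.\<close>

lemma limit_of_vector_states:
  fixes \<zeta> :: "nat \<Rightarrow> 'i \<Rightarrow> complex"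
  assumes \<zeta>: "\<And>n. \<zeta> n \<in> ell2 K" "\<And>n. norm2 (\<zeta> n) = 1"
  shows "\<exists>s G. G \<noteq> bot \<and> G \<le> sequentially \<and>
     (\<forall>w\<in>Bop K K. ((\<lambda>n. inner2 (w (\<zeta> n)) (\<zeta> n)) \<longlongrightarrow> s w) G) \<and>
     (\<forall>A P. A \<subseteq> Bop K K \<longrightarrow> P \<subseteq> Bop K K \<longrightarrow> (\<forall>n. \<forall>w\<in>P. inner2 (w (\<zeta> n)) (\<zeta> n) \<in> \<real>\<^sub>\<ge>\<^sub>0) \<longrightarrow>
        is_state A P (id_op K) s)"
proof -
  define S where "S n w = (if w \<in> Bop K K then inner2 (w (\<zeta> n)) (\<zeta> n) else 0)" for n and w :: "('i, 'i) op"
  have "cmod (S n w) \<le> (if w \<in> Bop K K then op_norm K w else 0)" for n w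
    using vector_functional_norm_le[of w K "\<zeta> n"] \<zeta> by (simp add: S_def)
  from pointwise_cluster_point[of S "\<lambda>w. if w \<in> Bop K K then op_norm K w else 0", OF this]
  obtain s G where G: "G \<noteq> bot" "G \<le> sequentially" "\<And>w. ((\<lambda>n. S n w) \<longlongrightarrow> s w) G"
    by blast
  have lim: "((\<lambda>n. inner2 (w (\<zeta> n)) (\<zeta> n)) \<longlongrightarrow> s w) G" if "w \<in> Bop K K" for w
    using G(3)[of w] that by (simp add: S_def)
  note uniq = tendsto_unique[OF G(1)]
  have "is_state A P (id_op K) s"
    if A: "A \<subseteq> Bop K K" and P: "P \<subseteq> Bop K K" "\<And>n w. w \<in> P \<Longrightarrow> inner2 (w (\<zeta> n)) (\<zeta> n) \<in> \<real>\<^sub>\<ge>\<^sub>0" for A P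
    unfolding is_state_def
  proof (intro conjI ballI allI)
    fix w assume w: "w \<in> A" then have wB: "w \<in> Bop K K" using A by blast
    show "s (cscale c w) = c * s w" for c
    proof (rule uniq[OF lim[OF Bop_cscale[OF wB]]])
      show "((\<lambda>n. inner2 (cscale c w (\<zeta> n)) (\<zeta> n)) \<longlongrightarrow> c * s w) G"
        unfolding cscale_apply inner2_scale_left by (intro tendsto_intros lim wB)
    qed
    fix w' assume w': "w' \<in> A" then have wB': "w' \<in> Bop K K" using A by blast
    show "s (w + w') = s w + s w'"
    proof (rule uniq[OF lim[OF Bop_add[OF wB wB']]])
      have eq: "inner2 ((w + w') (\<zeta> n)) (\<zeta> n) = inner2 (w (\<zeta> n)) (\<zeta> n) + inner2 (w' (\<zeta> n)) (\<zeta> n)" for n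
        using inner2_add_left[OF BopD(1)[OF wB \<zeta>(1)] BopD(1)[OF wB' \<zeta>(1)] \<zeta>(1)] by simp
      show "((\<lambda>n. inner2 ((w + w') (\<zeta> n)) (\<zeta> n)) \<longlongrightarrow> s w + s w') G"
        unfolding eq by (intro tendsto_add lim wB wB')
    qed
  next
    fix w assume w: "w \<in> P"
    show "s w \<in> \<real>\<^sub>\<ge>\<^sub>0"
      by (rule Lim_in_closed_set[OF closed_nonneg_Reals_complex _ G(1) lim]) (use w P in auto)
  next
    have "inner2 (id_op K (\<zeta> n)) (\<zeta> n) = 1" for n
      using \<zeta> by (simp add: id_op_def inner2_self)
    then show "s (id_op K) = 1" using uniq[OF lim[OF id_op_in_Bop]] by simp
  qed
  then show ?thesis
    by (intro exI[of _ s] exI[of _ G] conjI G(1,2) ballI lim allI impI) simp_all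
qed

section \<open>From approximately quantum bicorrelations to states\<close>

text \<open>The elementary tensors of generators, indexed like Choi matrices.\<close>

definition univ_tensor :: "('x::finite \<times> 'x) \<times> ('y::finite \<times> 'y) \<Rightarrow> ('x \<times> 'x) \<times> ('y \<times> 'y) \<Rightarrow>
    (('x, 'k) univ_index \<times> ('y, 'k) univ_index, ('x, 'k) univ_index \<times> ('y, 'k) univ_index) op" where
  "univ_tensor p q = op_tensor univ_dom univ_dom
     (univ_e (fst (fst p)) (fst (fst q)) (snd (fst p)) (snd (fst q)))
     (univ_e (fst (snd p)) (fst (snd q)) (snd (snd p)) (snd (snd q)))"

lemma Gamma_of_eq_chan: "Gamma_of s = chan (\<lambda>p q. s (univ_tensor p q))"
proof
  fix M :: "('a \<times> 'b) cmat"
  show "Gamma_of s M = chan (\<lambda>p q. s (univ_tensor p q)) M"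
    unfolding vec_eq_iff
  proof (intro allI)
    fix p p'
    let ?f = "\<lambda>x x' y y'. M $ (x, y) $ (x', y') * s (univ_tensor ((x, fst p), (y, snd p)) ((x', fst p'), (y', snd p')))"
    have "Gamma_of s M $ p $ p' = (\<Sum>x\<in>UNIV. \<Sum>x'\<in>UNIV. \<Sum>y\<in>UNIV. \<Sum>y'\<in>UNIV. ?f x x' y y')"
      unfolding Gamma_of_def sum_mscale_matrix_units by (simp add: mscale_def univ_tensor_def)
    also have "\<dots> = (\<Sum>x\<in>UNIV. \<Sum>y\<in>UNIV. \<Sum>x'\<in>UNIV. \<Sum>y'\<in>UNIV. ?f x x' y y')"
      by (intro sum.cong refl sum.swap)
    also have "\<dots> = chan (\<lambda>p q. s (univ_tensor p q)) M $ p $ p'"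
      by (simp add: chan_def sum_UNIV_prod)
    finally show "Gamma_of s M $ p $ p' = chan (\<lambda>p q. s (univ_tensor p q)) M $ p $ p'" .
  qed
qed

lemma quantum_bicorrelation_chan_mat_corr:
  fixes E :: "'x::finite \<times> 'x \<Rightarrow> 'x \<times> 'x \<Rightarrow> nat \<Rightarrow> nat \<Rightarrow> complex"
    and F :: "'y::finite \<times> 'y \<Rightarrow> 'y \<times> 'y \<Rightarrow> nat \<Rightarrow> nat \<Rightarrow> complex"
  assumes E: "bistoch_mat k E" and F: "bistoch_mat m F" and c: "unit_vec ({..<k} \<times> {..<m}) c"
  shows "quantum_bicorrelation (chan (mat_corr {..<k} E {..<m} F c))"
proof -
  let ?K = "{..<k} \<times> {..<m}"
  let ?E = "\<lambda>x x' a a'. mat_op {..<k} {..<k} (E (x, a) (x', a'))"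
  let ?F = "\<lambda>x x' a a'. mat_op {..<m} {..<m} (F (x, a) (x', a'))"
  have fin: "finite ?K" by simp
  have \<xi>: "cut ?K c \<in> ell2 ?K" by (rule ell2_finite_support[OF fin]) (auto simp: cut_def)
  have "unit_vec ?K (cut ?K c)" using c by (simp add: unit_vec_def cut_def cong: sum.cong)
  then have n: "norm2 (cut ?K c) = 1" using unit_vec_iff_norm2[OF fin \<xi>] by simp
  have val: "inner2 (op_tensor {..<k} {..<m} (?E x x' a a') (?F y y' b b') (cut ?K c)) (cut ?K c)
     = mat_corr {..<k} E {..<m} F c ((x, a), (y, b)) ((x', a'), (y', b'))" for x x' a a' y y' b b'
  proof -
    have "inner2 (op_tensor {..<k} {..<m} (?E x x' a a') (?F y y' b b') (cut ?K c)) (cut ?K c)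
       = (\<Sum>z\<in>?K. \<Sum>w\<in>?K. cnj (cut ?K c z) * (?E x x' a a' (ket (fst w)) (fst z) * ?F y y' b b' (ket (snd w)) (snd z)) * cut ?K c w)"
      by (rule inner2_op_tensor_finite[OF mat_op_in_Bop mat_op_in_Bop _ _ \<xi>]) auto
    also have "\<dots> = mat_corr {..<k} E {..<m} F c ((x, a), (y, b)) ((x', a'), (y', b'))"
      unfolding mat_corr_def by (intro sum.cong refl) (auto simp: cut_def mat_op_ket)
    finally show ?thesis .
  qed
  have "chan (mat_corr {..<k} E {..<m} F c) (kron (matrix_unit x x') (matrix_unit y y')) =
      (\<Sum>a\<in>UNIV. \<Sum>a'\<in>UNIV. \<Sum>b\<in>UNIV. \<Sum>b'\<in>UNIV.
        mscale (inner2 (op_tensor {..<k} {..<m} (?E x x' a a') (?F y y' b b') (cut ?K c)) (cut ?K c))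
          (kron (matrix_unit a a') (matrix_unit b b')))" for x x' y y'
    unfolding val sum_mscale_matrix_units chan_matrix_unit ..
  then show ?thesis
    unfolding quantum_bicorrelation_def
    using QNS_bicorrelation_mat_corr[OF E F c] \<xi> n
      bistochastic_op_matrix_mat_op[OF E] bistochastic_op_matrix_mat_op[OF F]
    by (intro conjI exI[of _ "{..<k}"] exI[of _ "{..<m}"] exI[of _ "cut ?K c"] exI[of _ ?E] exI[of _ ?F]) auto
qed

text \<open>The finite index sets are enumerated, and the operators are replaced by their matrices.\<close>

lemma quantum_bicorrelation_mat_corr:
  fixes \<Gamma> :: "('x::finite \<times> 'y::finite) cmat \<Rightarrow> ('x \<times> 'y) cmat"
  assumes "quantum_bicorrelation \<Gamma>"
  shows "\<exists>k E m F c. bistoch_mat k E \<and> bistoch_mat m F \<and> unit_vec ({..<k} \<times> {..<m}) c \<and>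
    (\<forall>x x' y y' p p'. \<Gamma> (kron (matrix_unit x x') (matrix_unit y y')) $ p $ p' =
       mat_corr {..<k} E {..<m} F c ((x, fst p), (y, snd p)) ((x', fst p'), (y', snd p')))"
proof -
  obtain I J :: "nat set" and \<xi> E F where q: "finite I" "finite J" "\<xi> \<in> ell2 (I \<times> J)" "norm2 \<xi> = 1"
     "bistochastic_op_matrix I E" "bistochastic_op_matrix J F"
     "\<forall>x x' y y'. \<Gamma> (kron (matrix_unit x x') (matrix_unit y y')) =
           (\<Sum>a\<in>UNIV. \<Sum>a'\<in>UNIV. \<Sum>b\<in>UNIV. \<Sum>b'\<in>UNIV.
              mscale (inner2 (op_tensor I J (E x x' a a') (F y y' b b') \<xi>) \<xi>)
                (kron (matrix_unit a a') (matrix_unit b b')))"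
    using assms unfolding quantum_bicorrelation_def by (elim conjE exE)
  obtain h where h: "bij_betw h {..<card I} I" using q(1) ex_bij_betw_nat_finite[of I] by (auto simp: atLeast0LessThan)
  obtain g where g: "bij_betw g {..<card J} J" using q(2) ex_bij_betw_nat_finite[of J] by (auto simp: atLeast0LessThan)
  let ?k = "card I" and ?m = "card J"
  let ?E = "\<lambda>p q i j. E (fst p) (fst q) (snd p) (snd q) (ket (h j)) (h i)"
  let ?F = "\<lambda>p q i j. F (fst p) (fst q) (snd p) (snd q) (ket (g j)) (g i)"
  let ?c = "\<lambda>z. \<xi> (h (fst z), g (snd z))"
  have "bij_betw (map_prod h g) ({..<?k} \<times> {..<?m}) (I \<times> J)" by (rule bij_betw_map_prod[OF h g])
  then have re: "(\<Sum>z\<in>I \<times> J. f z) = (\<Sum>z\<in>{..<?k} \<times> {..<?m}. f (h (fst z), g (snd z)))" for f :: "nat \<times> nat \<Rightarrow> complex"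
    using sum.reindex_bij_betw[of "map_prod h g" "{..<?k} \<times> {..<?m}" "I \<times> J" f] by (simp add: map_prod_def case_prod_unfold)
  have "unit_vec (I \<times> J) \<xi>" using unit_vec_iff_norm2[of "I \<times> J" \<xi>] q by simp
  then have c: "unit_vec ({..<?k} \<times> {..<?m}) ?c" unfolding unit_vec_def re .
  have EB: "E x x' a a' \<in> Bop I I" for x x' a a' using q(5) by (simp add: bistochastic_op_matrix_def)
  have FB: "F x x' a a' \<in> Bop J J" for x x' a a' using q(6) by (simp add: bistochastic_op_matrix_def)
  have val: "inner2 (op_tensor I J (E x x' a a') (F y y' b b') \<xi>) \<xi> = mat_corr {..<?k} ?E {..<?m} ?F ?c ((x, a), (y, b)) ((x', a'), (y', b'))"
    for x x' a a' y y' b b'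
    unfolding inner2_op_tensor_finite[OF EB FB q(1,2,3)] mat_corr_def re by simp
  have "\<Gamma> (kron (matrix_unit x x') (matrix_unit y y')) $ p $ p' =
       mat_corr {..<?k} ?E {..<?m} ?F ?c ((x, fst p), (y, snd p)) ((x', fst p'), (y', snd p'))" for x x' y y' p p'
    unfolding q(7)[rule_format] sum_mscale_matrix_units by (simp add: val)
  then show ?thesis
    using bistoch_mat_of_op_matrix[OF q(5) h] bistoch_mat_of_op_matrix[OF q(6) g] c
    by (intro exI[of _ ?k] exI[of _ ?E] exI[of _ ?m] exI[of _ ?F] exI[of _ ?c]) simp
qed

text \<open>Both maps are linear, so they are compared on matrix units. There the entries of both are limits of
the same numbers, the values of the vector states at the elementary tensors of generators.\<close>

lemma states_of_approximately_quantum: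
  fixes \<Gamma> :: "('x::finite \<times> 'y::finite) cmat \<Rightarrow> ('x \<times> 'y) cmat"
  assumes lin: "mat_linear \<Gamma>" and inf: "infinite (UNIV :: 'k set)" and \<Gamma>: "\<Gamma> \<in> Q_qa_bi"
  shows "\<exists>s :: (('x, 'k) univ_index \<times> ('y, 'k) univ_index, ('x, 'k) univ_index \<times> ('y, 'k) univ_index) op \<Rightarrow> complex.
     min_state univ_dom univ_dom T_sys T_sys s \<and> cstar_min_state univ_dom univ_dom C_alg C_alg s \<and> \<Gamma> = Gamma_of s"
proof -
  let ?D = "univ_dom :: ('x, 'k) univ_index set" and ?D' = "univ_dom :: ('y, 'k) univ_index set"
  let ?K = "?D \<times> ?D'"
  obtain G where G: "\<And>n::nat. quantum_bicorrelation (G n)" "\<And>M. (\<lambda>n. G n M) \<longlonglongrightarrow> \<Gamma> M"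
    using \<Gamma> unfolding Q_qa_bi_def by blast
  have ex: "\<exists>\<zeta> :: ('x, 'k) univ_index \<times> ('y, 'k) univ_index \<Rightarrow> complex. \<zeta> \<in> ell2 ?K \<and> norm2 \<zeta> = 1 \<and>
     (\<forall>A B w. gen_system A \<longrightarrow> gen_system B \<longrightarrow> w \<in> min_cone ?D ?D' A B \<longrightarrow> inner2 (w \<zeta>) \<zeta> \<in> \<real>\<^sub>\<ge>\<^sub>0) \<and>
     (\<forall>x x' y y' p p'. G n (kron (matrix_unit x x') (matrix_unit y y')) $ p $ p' =
        inner2 (univ_tensor ((x, fst p), (y, snd p)) ((x', fst p'), (y', snd p')) \<zeta>) \<zeta>)" for n
  proof -
    obtain k E m F c where q: "bistoch_mat k E" "bistoch_mat m F" "unit_vec ({..<k} \<times> {..<m}) c"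
      "\<forall>x x' y y' p p'. G n (kron (matrix_unit x x') (matrix_unit y y')) $ p $ p' =
       mat_corr {..<k} E {..<m} F c ((x, fst p), (y, snd p)) ((x', fst p'), (y', snd p'))"
      using quantum_bicorrelation_mat_corr[OF G(1)[of n]] by (elim exE conjE)
    obtain \<zeta> :: "('x, 'k) univ_index \<times> ('y, 'k) univ_index \<Rightarrow> complex" where
      \<zeta>: "\<zeta> \<in> ell2 ?K" "norm2 \<zeta> = 1"
     "\<forall>A B w. gen_system A \<longrightarrow> gen_system B \<longrightarrow> w \<in> min_cone ?D ?D' A B \<longrightarrow> inner2 (w \<zeta>) \<zeta> \<in> \<real>\<^sub>\<ge>\<^sub>0"
     "\<forall>p q. inner2 (op_tensor ?D ?D'
          (univ_e (fst (fst p)) (fst (fst q)) (snd (fst p)) (snd (fst q)))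
          (univ_e (fst (snd p)) (fst (snd q)) (snd (snd p)) (snd (snd q))) \<zeta>) \<zeta> = mat_corr {..<k} E {..<m} F c p q"
      using vector_state_exists[OF q(1-3) inf] by (elim exE conjE)
    show ?thesis
      using q(4) \<zeta>(4) by (intro exI[of _ \<zeta>] conjI \<zeta>(1-3)) (simp add: univ_tensor_def)
  qed
  obtain \<zeta> :: "nat \<Rightarrow> ('x, 'k) univ_index \<times> ('y, 'k) univ_index \<Rightarrow> complex" where
     \<zeta>: "\<forall>n. \<zeta> n \<in> ell2 ?K \<and> norm2 (\<zeta> n) = 1 \<and>
     (\<forall>A B w. gen_system A \<longrightarrow> gen_system B \<longrightarrow> w \<in> min_cone ?D ?D' A B \<longrightarrow> inner2 (w (\<zeta> n)) (\<zeta> n) \<in> \<real>\<^sub>\<ge>\<^sub>0) \<and>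
     (\<forall>x x' y y' p p'. G n (kron (matrix_unit x x') (matrix_unit y y')) $ p $ p' =
        inner2 (univ_tensor ((x, fst p), (y, snd p)) ((x', fst p'), (y', snd p')) (\<zeta> n)) (\<zeta> n))"
    using choice[OF allI[OF ex]] ..
  have \<zeta>1: "\<zeta> n \<in> ell2 ?K" "norm2 (\<zeta> n) = 1" for n using \<zeta> by auto
  have cone: "inner2 (w (\<zeta> n)) (\<zeta> n) \<in> \<real>\<^sub>\<ge>\<^sub>0" if "gen_system A" "gen_system B" "w \<in> min_cone ?D ?D' A B" for n A B w
    using spec[OF \<zeta>, of n] that by blast
  have val: "G n (kron (matrix_unit x x') (matrix_unit y y')) $ p $ p' =
        inner2 (univ_tensor ((x, fst p), (y, snd p)) ((x', fst p'), (y', snd p')) (\<zeta> n)) (\<zeta> n)" for n x x' y y' p p'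
    using spec[OF \<zeta>, of n] by blast
  obtain s U where s: "U \<noteq> bot" "U \<le> sequentially"
     "\<forall>w\<in>Bop ?K ?K. ((\<lambda>n. inner2 (w (\<zeta> n)) (\<zeta> n)) \<longlongrightarrow> s w) U"
     "\<forall>A P. A \<subseteq> Bop ?K ?K \<longrightarrow> P \<subseteq> Bop ?K ?K \<longrightarrow> (\<forall>n. \<forall>w\<in>P. inner2 (w (\<zeta> n)) (\<zeta> n) \<in> \<real>\<^sub>\<ge>\<^sub>0) \<longrightarrow>
        is_state A P (id_op ?K) s"
    using limit_of_vector_states[of \<zeta> ?K, OF \<zeta>1] by (elim exE conjE)
  have st: "is_state A P (id_op ?K) s"
    if "A \<subseteq> Bop ?K ?K" "P \<subseteq> Bop ?K ?K" "\<And>n w. w \<in> P \<Longrightarrow> inner2 (w (\<zeta> n)) (\<zeta> n) \<in> \<real>\<^sub>\<ge>\<^sub>0" for A P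
    by (rule s(4)[rule_format, OF that(1,2)]) (rule that(3))
  have sub: "alg_tensor ?D ?D' A B \<subseteq> Bop ?K ?K" "min_cone ?D ?D' A B \<subseteq> Bop ?K ?K" if "gen_system A" "gen_system B" for A B
    using alg_tensor_subset_Bop[OF gen_systemD(2)[OF that(1)] gen_systemD(2)[OF that(2)]]
      min_cone_subset[of ?D ?D' A B] by auto
  have "min_state ?D ?D' T_sys T_sys s"
    unfolding min_state_def using sub[OF gen_system_T_sys gen_system_T_sys] cone[OF gen_system_T_sys gen_system_T_sys]
    by (intro st) auto
  moreover have "cstar_min_state ?D ?D' C_alg C_alg s"
    unfolding cstar_min_state_def
  proof (rule st)
    show "op_closure ?K (alg_tensor ?D ?D' C_alg C_alg) \<subseteq> Bop ?K ?K"
      "op_closure ?K (min_cone ?D ?D' C_alg C_alg) \<subseteq> Bop ?K ?K" by (auto simp: op_closure_def)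
    show "inner2 (w (\<zeta> n)) (\<zeta> n) \<in> \<real>\<^sub>\<ge>\<^sub>0" if "w \<in> op_closure ?K (min_cone ?D ?D' C_alg C_alg)" for n w
      by (rule op_closure_vector_nonneg[OF sub(2)[OF gen_system_C_alg gen_system_C_alg] _ \<zeta>1 that])
         (rule cone[OF gen_system_C_alg gen_system_C_alg])
  qed
  moreover have "\<Gamma> = Gamma_of s"
    unfolding Gamma_of_eq_chan
  proof (rule mat_linear_eqI[OF lin chan_mat_linear])
    fix x x' y y'
    let ?M = "kron (matrix_unit x x') (matrix_unit y y') :: ('x \<times> 'y) cmat"
    have "\<Gamma> ?M $ p $ p' = s (univ_tensor ((x, fst p), (y, snd p)) ((x', fst p'), (y', snd p')))" for p p'
    proof (rule tendsto_unique[OF s(1)])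
      have "((\<lambda>n. G n ?M $ p $ p') \<longlongrightarrow> \<Gamma> ?M $ p $ p') sequentially"
        by (intro tendsto_vec_nth G(2))
      then show "((\<lambda>n. G n ?M $ p $ p') \<longlongrightarrow> \<Gamma> ?M $ p $ p') U" by (rule tendsto_mono[OF s(2)])
      show "((\<lambda>n. G n ?M $ p $ p') \<longlongrightarrow> s (univ_tensor ((x, fst p), (y, snd p)) ((x', fst p'), (y', snd p')))) U"
        unfolding val using s(3) by (auto simp: univ_tensor_def intro: op_tensor_in_Bop univ_e_in_Bop)
    qed
    then show "\<Gamma> ?M = chan (\<lambda>p q. s (univ_tensor p q)) ?M"
      by (simp add: chan_matrix_unit vec_eq_iff)
  qed
  ultimately show ?thesis by blast
qed

section \<open>From states to approximately quantum bicorrelations\<close>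

lemma mat_corr_scale:
  "mat_corr K E L F (\<lambda>z. t * c z) p q = cnj t * t * mat_corr K E L F c p q"
  unfolding mat_corr_def by (simp add: sum_distrib_left mult_ac)

lemma univ_tensor_in_alg_tensor:
  "gen_system A \<Longrightarrow> gen_system B \<Longrightarrow> univ_tensor p q \<in> alg_tensor univ_dom univ_dom A B"
  unfolding univ_tensor_def by (intro op_tensor_in_alg_tensor gen_systemD(3))

definition gen_combination :: "(('x::finite \<times> 'x) \<times> ('y::finite \<times> 'y) \<Rightarrow> ('x \<times> 'x) \<times> ('y \<times> 'y) \<Rightarrow> complex) \<Rightarrow> complex \<Rightarrow>
    (('x, 'k) univ_index \<times> ('y, 'k) univ_index, ('x, 'k) univ_index \<times> ('y, 'k) univ_index) op" where
  "gen_combination a b = (\<Sum>z\<in>UNIV. cscale (a (fst z) (snd z)) (univ_tensor (fst z) (snd z))) + cscale b (id_op (univ_dom \<times> univ_dom))"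

lemma id_op_in_alg_tensor:
  "gen_system A \<Longrightarrow> gen_system B \<Longrightarrow> id_op (univ_dom \<times> univ_dom) \<in> alg_tensor univ_dom univ_dom A B"
  unfolding op_tensor_id[symmetric] by (intro op_tensor_in_alg_tensor gen_systemD(4))

lemma gen_combination_in_alg_tensor:
  assumes "gen_system A" "gen_system B"
  shows "gen_combination a b \<in> alg_tensor univ_dom univ_dom A B"
  unfolding gen_combination_def
  by (intro cs.subspace_add[OF subspace_alg_tensor] cs.subspace_sum[OF subspace_alg_tensor]
      cs.subspace_scale[OF subspace_alg_tensor] univ_tensor_in_alg_tensor id_op_in_alg_tensor assms)

lemma linear_gen_combination:
  fixes f :: "(('x::finite, 'k) univ_index \<times> ('y::finite, 'k) univ_index, ('x, 'k) univ_index \<times> ('y, 'k) univ_index) op \<Rightarrow> complex"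
  assumes AB: "gen_system A" "gen_system B"
    and add: "\<And>S T. S \<in> alg_tensor univ_dom univ_dom A B \<Longrightarrow> T \<in> alg_tensor univ_dom univ_dom A B \<Longrightarrow> f (S + T) = f S + f T"
    and sc: "\<And>c S. S \<in> alg_tensor univ_dom univ_dom A B \<Longrightarrow> f (cscale c S) = c * f S"
  shows "f (gen_combination a b) = (\<Sum>p\<in>UNIV. \<Sum>q\<in>UNIV. a p q * f (univ_tensor p q)) + b * f (id_op (univ_dom \<times> univ_dom))"
proof -
  let ?W = "alg_tensor univ_dom univ_dom A B"
  note W = subspace_alg_tensor[of univ_dom univ_dom A B]
  have e: "cscale (a (fst z) (snd z)) (univ_tensor (fst z) (snd z)) \<in> ?W" for z
    by (intro cs.subspace_scale[OF W] univ_tensor_in_alg_tensor AB)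
  have 0: "f 0 = 0" using sc[OF cs.subspace_0[OF W], of 0] by simp
  have sum: "f (\<Sum>z\<in>Z. cscale (a (fst z) (snd z)) (univ_tensor (fst z) (snd z))) = (\<Sum>z\<in>Z. a (fst z) (snd z) * f (univ_tensor (fst z) (snd z)))"
    if "finite Z" for Z
    using that
  proof (induction Z rule: finite_induct)
    case (insert z Z)
    let ?g = "\<lambda>z. cscale (a (fst z) (snd z)) (univ_tensor (fst z) (snd z))"
    have "f (sum ?g (insert z Z)) = f (?g z + sum ?g Z)"
      by (simp only: sum.insert[OF insert.hyps])
    also have "\<dots> = f (?g z) + f (sum ?g Z)"
      by (rule add[OF e cs.subspace_sum[OF W]]) (rule e)
    also have "f (?g z) = a (fst z) (snd z) * f (univ_tensor (fst z) (snd z))"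
      by (rule sc[OF univ_tensor_in_alg_tensor[OF AB]])
    finally show ?case by (simp only: insert.IH sum.insert[OF insert.hyps])
  qed (simp only: sum.empty 0)
  have "f (gen_combination a b) = (\<Sum>z\<in>UNIV. a (fst z) (snd z) * f (univ_tensor (fst z) (snd z))) + b * f (id_op (univ_dom \<times> univ_dom))"
    unfolding gen_combination_def
    by (subst add) (auto intro!: cs.subspace_sum[OF W] e cs.subspace_scale[OF W] id_op_in_alg_tensor AB simp: sum sc id_op_in_alg_tensor[OF AB])
  then show ?thesis by (simp add: sum_UNIV_prod)
qed

text \<open>Every pair of unital completely positive maps produces two bistochastic matrices, and the form of the
image of the combination at a vector \<open>c\<close> is the expression in the hypothesis.\<close>

lemma gen_combination_in_min_cone:
  assumes AB: "gen_system A" "gen_system B"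
    and pos: "\<And>k E m F c. bistoch_mat k E \<Longrightarrow> bistoch_mat m F \<Longrightarrow>
      (\<Sum>p\<in>UNIV. \<Sum>q\<in>UNIV. a p q * mat_corr {..<k} E {..<m} F c p q)
        + b * (\<Sum>z\<in>{..<k} \<times> {..<m}. cnj (c z) * c z) \<in> \<real>\<^sub>\<ge>\<^sub>0"
  shows "gen_combination a b \<in> min_cone univ_dom univ_dom A B"
  unfolding min_cone_def min_pos_def mem_Collect_eq
proof (intro conjI allI impI gen_combination_in_alg_tensor[OF AB])
  fix k m \<phi> \<psi> assume "ucp univ_dom A k \<phi> \<and> ucp univ_dom B m \<psi>"
  then have \<phi>: "ucp univ_dom A k \<phi>" and \<psi>: "ucp univ_dom B m \<psi>" by auto
  let ?\<Phi> = "map_tensor univ_dom univ_dom A B \<phi> \<psi>"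
  let ?E = "\<lambda>p q. \<phi> (univ_e (fst p) (fst q) (snd p) (snd q))" and ?F = "\<lambda>p q. \<psi> (univ_e (fst p) (fst q) (snd p) (snd q))"
  have lin: "clinear_on A \<phi>" "clinear_on B \<psi>" and one: "\<phi> (id_op univ_dom) = (\<lambda>i j. if i = j \<and> i < k then 1 else 0)"
     "\<psi> (id_op univ_dom) = (\<lambda>i j. if i = j \<and> i < m then 1 else 0)"
    using \<phi> \<psi> by (simp_all add: ucp_def)
  note mt = map_tensor_props[OF gen_systemD(1,2)[OF AB(1)] gen_systemD(1,2)[OF AB(2)] lin]
  have \<Phi>: "?\<Phi> (gen_combination a b) z w = (\<Sum>p\<in>UNIV. \<Sum>q\<in>UNIV. a p q * (?E (fst p) (fst q) (fst z) (fst w) * ?F (snd p) (snd q) (snd z) (snd w)))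
      + b * (if z = w then 1 else 0)" if "z \<in> {..<k} \<times> {..<m}" "w \<in> {..<k} \<times> {..<m}" for z w
  proof -
    have "?\<Phi> (gen_combination a b) z w = (\<Sum>p\<in>UNIV. \<Sum>q\<in>UNIV. a p q * ?\<Phi> (univ_tensor p q) z w) + b * ?\<Phi> (id_op (univ_dom \<times> univ_dom)) z w"
      by (rule linear_gen_combination[OF AB, where f = "\<lambda>S. ?\<Phi> S z w"]) (simp_all add: clinear_onD[OF mt(1)] cscale_apply)
    moreover have "?\<Phi> (univ_tensor p q) z w = ?E (fst p) (fst q) (fst z) (fst w) * ?F (snd p) (snd q) (snd z) (snd w)" for p q
      using mt(2)[OF gen_systemD(3)[OF AB(1)] gen_systemD(3)[OF AB(2)], of _ _ _ _ _ _ _ _ "fst z" "snd z" "fst w" "snd w"]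
      by (simp add: univ_tensor_def)
    moreover have "?\<Phi> (id_op (univ_dom \<times> univ_dom)) z w = (if z = w then 1 else 0)"
      using mt(2)[OF gen_systemD(4)[OF AB(1)] gen_systemD(4)[OF AB(2)], of "fst z" "snd z" "fst w" "snd w"] that
      unfolding op_tensor_id by (auto simp: one prod_eq_iff)
    ultimately show ?thesis by simp
  qed
  show "psd_on ({..<1::nat} \<times> {..<k} \<times> {..<m}) (\<lambda>(i, p) (j, q). ?\<Phi> (gen_combination a b) p q)"
    unfolding psd_on_def
  proof
    fix c :: "nat \<times> nat \<times> nat \<Rightarrow> complex"
    let ?c = "\<lambda>z. c (0, z)" and ?K = "{..<k} \<times> {..<m}"
    have "(\<Sum>z\<in>{..<1::nat} \<times> ?K. \<Sum>w\<in>{..<1::nat} \<times> ?K. cnj (c z) * (\<lambda>(i, p) (j, q). ?\<Phi> (gen_combination a b) p q) z w * c w)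
      = (\<Sum>z\<in>?K. \<Sum>w\<in>?K. cnj (?c z) * ?\<Phi> (gen_combination a b) z w * ?c w)"
      by (simp add: sum.cartesian_product' lessThan_Suc)
    also have "\<dots> = (\<Sum>z\<in>?K. \<Sum>w\<in>?K. (\<Sum>p\<in>UNIV. \<Sum>q\<in>UNIV. a p q * (cnj (?c z) * (?E (fst p) (fst q) (fst z) (fst w) * ?F (snd p) (snd q) (snd z) (snd w)) * ?c w))
        + (if w = z then b * (cnj (?c z) * ?c z) else 0))"
      by (intro sum.cong refl) (subst \<Phi>, auto simp: sum_distrib_left sum_distrib_right algebra_simps)
    also have "\<dots> = (\<Sum>z\<in>?K. \<Sum>w\<in>?K. \<Sum>p\<in>UNIV. \<Sum>q\<in>UNIV. a p q * (cnj (?c z) * (?E (fst p) (fst q) (fst z) (fst w) * ?F (snd p) (snd q) (snd z) (snd w)) * ?c w))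
        + (\<Sum>z\<in>?K. b * (cnj (?c z) * ?c z))"
      by (simp add: sum.distrib)
    also have "(\<Sum>z\<in>?K. \<Sum>w\<in>?K. \<Sum>p\<in>UNIV. \<Sum>q\<in>UNIV. a p q * (cnj (?c z) * (?E (fst p) (fst q) (fst z) (fst w) * ?F (snd p) (snd q) (snd z) (snd w)) * ?c w))
       = (\<Sum>q\<in>UNIV. \<Sum>p\<in>UNIV. \<Sum>z\<in>?K. \<Sum>w\<in>?K. a p q * (cnj (?c z) * (?E (fst p) (fst q) (fst z) (fst w) * ?F (snd p) (snd q) (snd z) (snd w)) * ?c w))"
      by (rule sum_swap4)
    also have "\<dots> = (\<Sum>p\<in>UNIV. \<Sum>q\<in>UNIV. a p q * mat_corr {..<k} ?E {..<m} ?F ?c p q)"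
      unfolding mat_corr_def by (subst sum.swap) (simp only: sum_distrib_left)
    also have "(\<Sum>z\<in>?K. b * (cnj (?c z) * ?c z)) = b * (\<Sum>z\<in>?K. cnj (?c z) * ?c z)"
      by (simp only: sum_distrib_left)
    finally show "(\<Sum>z\<in>{..<1::nat} \<times> ?K. \<Sum>w\<in>{..<1::nat} \<times> ?K. cnj (c z) * (\<lambda>(i, p) (j, q). ?\<Phi> (gen_combination a b) p q) z w * c w) \<in> \<real>\<^sub>\<ge>\<^sub>0"
      using pos[OF ucp_bistoch_mat[OF AB(1) \<phi>] ucp_bistoch_mat[OF AB(2) \<psi>], of ?c] by simp
  qed
qed

text \<open>On hermitian matrices a real linear functional is the restriction of a complex linear one, obtained by
symmetrising its coefficients.\<close>

lemma inner_eq_hermitian_pairing: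
  fixes \<alpha> z :: "complex ^ 'p ^ 'p"
  assumes "\<And>p q. z $ q $ p = cnj (z $ p $ q)"
  shows "of_real (inner \<alpha> z) = (\<Sum>p\<in>UNIV. \<Sum>q\<in>UNIV. (cnj (\<alpha> $ p $ q) + \<alpha> $ q $ p) / 2 * z $ p $ q)"
proof -
  have c: "complex_of_real (inner x y) = (cnj x * y + x * cnj y) / 2" for x y :: complex
    by (simp add: complex_eq_iff inner_complex_def)
  have "complex_of_real (inner \<alpha> z) = (\<Sum>p\<in>UNIV. \<Sum>q\<in>UNIV. cnj (\<alpha> $ p $ q) / 2 * z $ p $ q + \<alpha> $ p $ q / 2 * z $ q $ p)"
    unfolding inner_vec_def of_real_sum c
  proof (intro sum.cong refl)
    fix p q
    show "(cnj (\<alpha> $ p $ q) * z $ p $ q + \<alpha> $ p $ q * cnj (z $ p $ q)) / 2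
        = cnj (\<alpha> $ p $ q) / 2 * z $ p $ q + \<alpha> $ p $ q / 2 * z $ q $ p"
      unfolding assms[of p q] by (simp add: add_divide_distrib)
  qed
  also have "\<dots> = (\<Sum>p\<in>UNIV. \<Sum>q\<in>UNIV. cnj (\<alpha> $ p $ q) / 2 * z $ p $ q) + (\<Sum>p\<in>UNIV. \<Sum>q\<in>UNIV. \<alpha> $ p $ q / 2 * z $ q $ p)"
    by (simp only: sum.distrib)
  also have "(\<Sum>p\<in>UNIV. \<Sum>q\<in>UNIV. \<alpha> $ p $ q / 2 * z $ q $ p) = (\<Sum>p\<in>UNIV. \<Sum>q\<in>UNIV. \<alpha> $ q $ p / 2 * z $ p $ q)"
    by (rule sum.swap)
  finally show ?thesis by (simp add: sum.distrib[symmetric] add_divide_distrib distrib_right)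
qed

text \<open>The matrix \<open>z0\<close> of the state is positive semidefinite, hence hermitian, by testing the state on the
positive elements \<open>\<Sum> cnj (l p) * l q * (e \<otimes> f)\<close>. A hyperplane that separated it from the closed convex
set of quantum matrices would be given by a complex linear functional with coefficients \<open>a\<close>; then
\<open>\<Sum> a p q (e \<otimes> f) - \<beta> 1\<close> would be positive with a negative value under \<open>s\<close>.\<close>

lemma approximately_quantum_of_state:
  fixes s :: "(('x::finite, 'k) univ_index \<times> ('y::finite, 'k) univ_index, ('x, 'k) univ_index \<times> ('y, 'k) univ_index) op \<Rightarrow> complex"
  assumes AB: "gen_system A" "gen_system B"
    and s: "is_state (alg_tensor univ_dom univ_dom A B) (min_cone univ_dom univ_dom A B) (id_op (univ_dom \<times> univ_dom)) s"
  shows "Gamma_of s \<in> Q_qa_bi"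
proof -
  define T where "T p q = s (univ_tensor p q)" for p q
  define z0 :: "complex ^ (('x \<times> 'x) \<times> ('y \<times> 'y)) ^ (('x \<times> 'x) \<times> ('y \<times> 'y))" where "z0 = (\<chi> p q. T p q)"
  have key: "(\<Sum>p\<in>UNIV. \<Sum>q\<in>UNIV. a p q * T p q) + b \<in> \<real>\<^sub>\<ge>\<^sub>0"
    if pos: "\<And>k E m F c. bistoch_mat k E \<Longrightarrow> bistoch_mat m F \<Longrightarrow>
      (\<Sum>p\<in>UNIV. \<Sum>q\<in>UNIV. a p q * mat_corr {..<k} E {..<m} F c p q)
        + b * (\<Sum>z\<in>{..<k} \<times> {..<m}. cnj (c z) * c z) \<in> \<real>\<^sub>\<ge>\<^sub>0" for a b
  proof -
    have "s (gen_combination a b) \<in> \<real>\<^sub>\<ge>\<^sub>0"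
      using s gen_combination_in_min_cone[OF AB pos] by (simp add: is_state_def)
    moreover have "s (gen_combination a b) = (\<Sum>p\<in>UNIV. \<Sum>q\<in>UNIV. a p q * T p q) + b"
      using s linear_gen_combination[OF AB, of s a b] by (simp add: is_state_def T_def)
    ultimately show ?thesis by simp
  qed
  have psd: "psd_on UNIV (mat_corr {..<k} E {..<m} F c)"
    if "bistoch_mat k E" "bistoch_mat m F" for k m c and E :: "'x \<times> 'x \<Rightarrow> _" and F :: "'y \<times> 'y \<Rightarrow> _"
    using that by (intro psd_on_mat_corr) (simp_all add: bistoch_mat_def)
  have psdT: "psd_on UNIV T"
    unfolding psd_on_def
  proof
    fix l :: "('x \<times> 'x) \<times> ('y \<times> 'y) \<Rightarrow> complex"
    have "(\<Sum>p\<in>UNIV. \<Sum>q\<in>UNIV. (cnj (l p) * l q) * T p q) + 0 \<in> \<real>\<^sub>\<ge>\<^sub>0"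
    proof (rule key)
      fix k E m F c assume "bistoch_mat k (E :: 'x \<times> 'x \<Rightarrow> _)" "bistoch_mat m (F :: 'y \<times> 'y \<Rightarrow> _)"
      from psd_onD[OF psd[OF this], of l c]
      show "(\<Sum>p\<in>UNIV. \<Sum>q\<in>UNIV. (cnj (l p) * l q) * mat_corr {..<k} E {..<m} F c p q)
        + 0 * (\<Sum>z\<in>{..<k} \<times> {..<m}. cnj (c z) * c z) \<in> \<real>\<^sub>\<ge>\<^sub>0"
        by (simp add: mult_ac)
    qed
    then show "(\<Sum>p\<in>UNIV. \<Sum>q\<in>UNIV. cnj (l p) * T p q * l q) \<in> \<real>\<^sub>\<ge>\<^sub>0" by (simp add: mult_ac)
  qed
  have herm0: "z0 $ q $ p = cnj (z0 $ p $ q)" for p q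
    unfolding z0_def using psd_on_hermitian[OF finite psdT, of p q] by simp
  have "z0 \<in> closure quantum_points"
  proof (rule ccontr)
    assume "z0 \<notin> closure quantum_points"
    then obtain \<alpha> \<beta> where sep: "inner \<alpha> z0 < \<beta>" "\<forall>x\<in>closure quantum_points. inner \<alpha> x > \<beta>"
      using separating_hyperplane_closed_point[OF convex_closure[OF convex_quantum_points] closed_closure] by metis
    \<comment> \<open>The coefficients of the complex linear functional that agrees with \<open>inner \<alpha>\<close> on hermitian matrices.\<close>
    let ?a = "\<lambda>p q. (cnj (\<alpha> $ p $ q) + \<alpha> $ q $ p) / 2"
    have "(\<Sum>p\<in>UNIV. \<Sum>q\<in>UNIV. ?a p q * T p q) + (- of_real \<beta>) \<in> \<real>\<^sub>\<ge>\<^sub>0"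
    proof (rule key)
      fix k E m F c assume EF: "bistoch_mat k (E :: 'x \<times> 'x \<Rightarrow> _)" "bistoch_mat m (F :: 'y \<times> 'y \<Rightarrow> _)"
      let ?K = "{..<k} \<times> {..<m}"
      define N where "N = (\<Sum>z\<in>?K. (cmod (c z))\<^sup>2)"
      have N: "(\<Sum>z\<in>?K. cnj (c z) * c z) = of_real N"
        unfolding N_def of_real_sum by (intro sum.cong refl) (simp only: complex_norm_square mult.commute)
      have N0: "N \<ge> 0" unfolding N_def by (intro sum_nonneg) simp
      show "(\<Sum>p\<in>UNIV. \<Sum>q\<in>UNIV. ?a p q * mat_corr {..<k} E {..<m} F c p q)
        + - of_real \<beta> * (\<Sum>z\<in>?K. cnj (c z) * c z) \<in> \<real>\<^sub>\<ge>\<^sub>0"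
      proof (cases "N = 0")
        case True
        then have "c z = 0" if "z \<in> ?K" for z
          using that unfolding N_def by (subst (asm) sum_nonneg_eq_0_iff) auto
        then have "mat_corr {..<k} E {..<m} F c p q = 0" for p q
          unfolding mat_corr_def by (intro sum.neutral ballI) simp
        then show ?thesis using N True by simp
      next
        case False
        \<comment> \<open>Quantum points are defined with unit vectors, so \<open>c\<close> is normalised.\<close>
        define t where "t = complex_of_real (1 / sqrt N)"
        have t: "cnj t * t * of_real N = 1"
          using False N0 by (simp add: t_def flip: of_real_mult)
        let ?c = "\<lambda>z. t * c z"
        define x :: "complex ^ (('x \<times> 'x) \<times> ('y \<times> 'y)) ^ (('x \<times> 'x) \<times> ('y \<times> 'y))"
          where "x = (\<chi> p q. mat_corr {..<k} E {..<m} F ?c p q)"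
        have "(\<Sum>z\<in>?K. cnj (?c z) * ?c z) = cnj t * t * (\<Sum>z\<in>?K. cnj (c z) * c z)"
          by (simp add: sum_distrib_left mult_ac)
        then have "unit_vec ?K ?c" unfolding unit_vec_def N t by simp
        then have "x \<in> quantum_points" unfolding quantum_points_def x_def using EF by blast
        then have gt: "inner \<alpha> x > \<beta>" using sep(2) closure_subset by blast
        have herm: "x $ q $ p = cnj (x $ p $ q)" for p q
          unfolding x_def using psd_on_hermitian[OF finite psd[OF EF], of p q ?c] by simp
        have Nt: "of_real N * (cnj t * t) = (1 :: complex)" using t by (simp add: mult.commute)
        have "(\<Sum>p\<in>UNIV. \<Sum>q\<in>UNIV. ?a p q * mat_corr {..<k} E {..<m} F c p q)
           = (\<Sum>p\<in>UNIV. \<Sum>q\<in>UNIV. of_real N * (?a p q * x $ p $ q))"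
        proof (intro sum.cong refl)
          fix p q
          have "of_real N * x $ p $ q = mat_corr {..<k} E {..<m} F c p q"
            unfolding x_def by (simp add: mat_corr_scale mult.assoc[symmetric] Nt[unfolded mult.assoc[symmetric]])
          then show "?a p q * mat_corr {..<k} E {..<m} F c p q = of_real N * (?a p q * x $ p $ q)"
            by (simp add: mult.left_commute)
        qed
        also have "\<dots> = of_real N * of_real (inner \<alpha> x)"
          unfolding inner_eq_hermitian_pairing[of x \<alpha>, OF herm] by (simp only: sum_distrib_left)
        finally have "(\<Sum>p\<in>UNIV. \<Sum>q\<in>UNIV. ?a p q * mat_corr {..<k} E {..<m} F c p q)
            + - of_real \<beta> * (\<Sum>z\<in>?K. cnj (c z) * c z) = of_real (N * (inner \<alpha> x - \<beta>))"
          unfolding N by (simp add: algebra_simps)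
        then show ?thesis using N0 gt by (simp del: of_real_mult of_real_diff)
      qed
    qed
    moreover have "(\<Sum>p\<in>UNIV. \<Sum>q\<in>UNIV. ?a p q * T p q) = of_real (inner \<alpha> z0)"
      unfolding inner_eq_hermitian_pairing[of z0 \<alpha>, OF herm0] by (simp add: z0_def)
    ultimately have "complex_of_real (inner \<alpha> z0 - \<beta>) \<in> \<real>\<^sub>\<ge>\<^sub>0" by simp
    then have "inner \<alpha> z0 \<ge> \<beta>" by (simp add: complex_nonneg_Reals_iff)
    then show False using sep(1) by simp
  qed
  then obtain X where X: "\<And>n. X n \<in> quantum_points" "X \<longlonglongrightarrow> z0"
    unfolding closure_sequential by blast
  define G where "G n = chan (\<lambda>p q. X n $ p $ q)" for n
  have "quantum_bicorrelation (G n)" for n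
  proof -
    obtain k E m F c where x: "X n = (\<chi> p q. mat_corr {..<k} E {..<m} F c p q)"
      "bistoch_mat k E" "bistoch_mat m F" "unit_vec ({..<k} \<times> {..<m}) c"
      using X(1)[of n] unfolding quantum_points_def by blast
    have "(\<lambda>p q. X n $ p $ q) = mat_corr {..<k} E {..<m} F c" by (intro ext) (simp add: x(1))
    then have "G n = chan (mat_corr {..<k} E {..<m} F c)" unfolding G_def by (rule arg_cong)
    then show ?thesis using quantum_bicorrelation_chan_mat_corr[OF x(2-4)] by simp
  qed
  moreover have "(\<lambda>n. G n M) \<longlonglongrightarrow> Gamma_of s M" for M
  proof -
    have "(\<lambda>n. chan (\<lambda>p q. X n $ p $ q) M) \<longlonglongrightarrow> chan (\<lambda>p q. z0 $ p $ q) M"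
      unfolding chan_def by (intro tendsto_vec_lambda tendsto_sum tendsto_mult tendsto_const tendsto_vec_nth X(2))
    then show ?thesis by (simp add: G_def Gamma_of_eq_chan z0_def T_def)
  qed
  ultimately show ?thesis unfolding Q_qa_bi_def by blast
qed

theorem theorem5p6:
  fixes \<Gamma> :: "('x::finite \<times> 'y::finite) cmat \<Rightarrow> ('x \<times> 'y) cmat"
  assumes "mat_linear \<Gamma>"
    and "infinite (UNIV :: 'k set)"
  shows "(\<Gamma> \<in> Q_qa_bi \<longleftrightarrow>
           (\<exists>s :: (('x, 'k) univ_index \<times> ('y, 'k) univ_index,
                  ('x, 'k) univ_index \<times> ('y, 'k) univ_index) op \<Rightarrow> complex.
              min_state univ_dom univ_dom T_sys T_sys s \<and> \<Gamma> = Gamma_of s)) \<and>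
         (\<Gamma> \<in> Q_qa_bi \<longleftrightarrow>
           (\<exists>s :: (('x, 'k) univ_index \<times> ('y, 'k) univ_index,
                  ('x, 'k) univ_index \<times> ('y, 'k) univ_index) op \<Rightarrow> complex.
              cstar_min_state univ_dom univ_dom C_alg C_alg s \<and> \<Gamma> = Gamma_of s))"
proof -
  let ?D = "univ_dom :: ('x, 'k) univ_index set" and ?D' = "univ_dom :: ('y, 'k) univ_index set"
  have T: "Gamma_of s \<in> Q_qa_bi" if "min_state ?D ?D' T_sys T_sys s" for s
    using that unfolding min_state_def by (rule approximately_quantum_of_state[OF gen_system_T_sys gen_system_T_sys])
  have C: "Gamma_of s \<in> Q_qa_bi" if s: "cstar_min_state ?D ?D' C_alg C_alg s" for s
  proof (rule approximately_quantum_of_state[OF gen_system_C_alg gen_system_C_alg])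
    let ?W = "alg_tensor ?D ?D' C_alg C_alg"
    have W: "?W \<subseteq> Bop (?D \<times> ?D') (?D \<times> ?D')"
      by (rule alg_tensor_subset_Bop[OF gen_systemD(2)[OF gen_system_C_alg] gen_systemD(2)[OF gen_system_C_alg]])
    have "?W \<subseteq> op_closure (?D \<times> ?D') ?W" by (rule subset_op_closure[OF W])
    moreover have "min_cone ?D ?D' C_alg C_alg \<subseteq> op_closure (?D \<times> ?D') (min_cone ?D ?D' C_alg C_alg)"
      using min_cone_subset W by (intro subset_op_closure) blast
    ultimately show "is_state ?W (min_cone ?D ?D' C_alg C_alg) (id_op (?D \<times> ?D')) s"
      using s unfolding cstar_min_state_def is_state_def by (meson subsetD)
  qed
  show ?thesis
    using states_of_approximately_quantum[OF assms] T C by metis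
qed

end
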